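(* Let $X\to B$ be a flat symplectic fibre bundle over a noncompact Riemann surface $B$, with fibrewise symplectic form $\omega$ and corresponding Poisson structure $P$, and let $V:B\to\mathbb{R}$ be a nonconstant, positive pluriharmonic function. Let $P/V$ be the Poisson structure on $X$ determined by the fibrewise symplectic form $V\omega$, and let $I$ be the transverse complex structure on $X$ pulled back from $B$. Then $(P/V,I)$ are generalized complex.
   Context: All objects are smooth; a subscript $\mathbb{C}$ denotes complexification. Generalized complex structures: a spinor on $X$ is a complex mixed-degree differential form $\rho$; $(Y,\xi)\in\Gamma(T_{\mathbb C}X\oplus T^*_{\mathbb C}X)$ acts by $(Y,\xi)\cdot\rho=\iota_Y\rho+\xi\wedge\rho$. A (nowhere zero) spinor $\rho$ is pure if its annihilator $L_\rho\subset T_{\mathbb C}X\oplus T^*_{\mathbb C}X$ is maximal isotropic (of rank $\dim X$) for the standard symmetric pairing, and has real rank zero if $L_\rho\cap\overline{L_\rho}=0$. An almost generalized complex structure $J$ is a complex line subbundle $\kappa_J\subset\wedge^\bullet T^*_{\mathbb C}X$ locally generated by pure spinors of real rank zero. For a closed real 3-form $H$, put $d_H\rho=d\rho+H\wedge\rho$; $J$ is $H$-integrable if every local section $\rho$ of $\kappa_J$ satisfies $d_H\rho=(Y,\xi)\cdot\rho$ for some $(Y,\xi)$. A generalized complex structure is an almost generalized complex structure that is $H$-integrable for some closed real 3-form $H$. A symplectic fibre bundle $\pi:X\to B$ is a fibre bundle with a fibrewise symplectic form $\omega\in\Gamma(\wedge^2S^* )$, $S=\ker d\pi$, admitting local trivializations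 that are symplectomorphisms on each fibre; it is flat if it is equipped with a flat symplectic connection, i.e. an integrable horizontal distribution $N\subset TX$ complementary to $S$ whose parallel transport preserves $\omega$. $V$ is pluriharmonic if $\partial\bar\partial V=0$. The complex structure of $B$ pulls back to a complex structure $I$ on $TX/S\cong\pi^*TB$; $\kappa_I=\pi^*T^*_{1,0}B$. $(P/V,I)$ are generalized complex if there is a generalized complex structure $J$ on $X$ (for some closed real 3-form $H$) inducing them, i.e. such that near every point $\kappa_J=e^{C+i\tilde\eta}\wedge\kappa_I$ for some real 2-forms $C,\tilde\eta$ with $\tilde\eta|_S=V\omega$. *)

theory Defs
  imports "HOL-Analysis.Analysis"
begin

section \<open>Manifolds\<close>

primrec Ck_on :: "nat \<Rightarrow> ('a::real_normed_vector \<Rightarrow> 'b::real_normed_vector) \<Rightarrow> 'a set \<Rightarrow> bool" where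
  "Ck_on 0 f S \<longleftrightarrow> continuous_on S f"
| "Ck_on (Suc k) f S \<longleftrightarrow> (\<forall>x\<in>S. f differentiable (at x)) \<and>
     (\<forall>v. Ck_on k (\<lambda>x. frechet_derivative f (at x) v) S)"

text \<open>Only used for open \<open>S\<close> in finite-dimensional spaces.\<close>

definition smooth_on :: "('a::real_normed_vector \<Rightarrow> 'b::real_normed_vector) \<Rightarrow> 'a set \<Rightarrow> bool" where
  "smooth_on f S \<longleftrightarrow> (\<forall>k. Ck_on k f S)"

text \<open>A chart is a pair of a domain and a coordinate map, whose values off the domain are
  irrelevant. Manifolds are whole types of class \<open>t2_space\<close> and \<open>second_countable_topology\<close>.
  The model space is a finite-dimensional normed space, so that dimension 0 is allowed.\<close>

type_synonym ('a, 'e) chart = "'a set \<times> ('a \<Rightarrow> 'e)"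

definition chart_inv :: "('a, 'e) chart \<Rightarrow> 'e \<Rightarrow> 'a" where
  "chart_inv c = inv_into (fst c) (snd c)"

definition is_chart :: "('a::topological_space, 'e::real_normed_vector) chart \<Rightarrow> bool" where
  "is_chart c \<longleftrightarrow> open (fst c) \<and> open (snd c ` fst c) \<and>
     homeomorphism (fst c) (snd c ` fst c) (snd c) (chart_inv c)"

definition smooth_transition ::
    "('a::topological_space, 'e::real_normed_vector) chart \<Rightarrow> ('a, 'e) chart \<Rightarrow> bool" where
  "smooth_transition c d \<longleftrightarrow> smooth_on (snd d \<circ> chart_inv c) (snd c ` (fst c \<inter> fst d))"

definition smooth_atlas :: "('a::topological_space, 'e::real_normed_vector) chart set \<Rightarrow> bool" where
  "smooth_atlas A \<longleftrightarrow> (\<exists>K::'e set. finite K \<and> span K = UNIV) \<and>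
     (\<forall>c\<in>A. is_chart c) \<and> (\<Union>c\<in>A. fst c) = UNIV \<and> (\<forall>c\<in>A. \<forall>d\<in>A. smooth_transition c d)"

definition smooth_structure :: "('a::topological_space, 'e::real_normed_vector) chart set \<Rightarrow> bool" where
  "smooth_structure A \<longleftrightarrow> smooth_atlas A \<and>
     (\<forall>c. is_chart c \<and> (\<forall>d\<in>A. smooth_transition c d \<and> smooth_transition d c) \<longrightarrow> c \<in> A)"

text \<open>A complex structure is given by any holomorphic atlas, not necessarily a maximal atlas.\<close>

definition riemann_surface :: "('b::topological_space, complex) chart set \<Rightarrow> bool" where
  "riemann_surface Z \<longleftrightarrow> connected (UNIV :: 'b set) \<and>
     (\<forall>c\<in>Z. is_chart c) \<and> (\<Union>c\<in>Z. fst c) = UNIV \<and>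
     (\<forall>c\<in>Z. \<forall>d\<in>Z. (snd d \<circ> chart_inv c) holomorphic_on (snd c ` (fst c \<inter> fst d)))"

definition self_atlas :: "('e, 'e) chart set" where
  "self_atlas = {(UNIV, \<lambda>x. x)}"

definition prod_atlas ::
    "('a, 'e) chart set \<Rightarrow> ('b, 'f) chart set \<Rightarrow> ('a \<times> 'b, 'e \<times> 'f) chart set" where
  "prod_atlas A B = {(fst c \<times> fst d, map_prod (snd c) (snd d)) |c d. c \<in> A \<and> d \<in> B}"

definition smooth_map :: "('a::topological_space, 'e::real_normed_vector) chart set \<Rightarrow>
    ('b::topological_space, 'f::real_normed_vector) chart set \<Rightarrow> 'a set \<Rightarrow> ('a \<Rightarrow> 'b) \<Rightarrow> bool" where
  "smooth_map A B U f \<longleftrightarrow> continuous_on U f \<and>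
     (\<forall>c\<in>A. \<forall>d\<in>B. smooth_on (snd d \<circ> f \<circ> chart_inv c) (snd c ` (U \<inter> fst c \<inter> f -` fst d)))"

text \<open>Tangent spaces: every point gets a preferred chart of the atlas, and the tangent space at
  \<open>p\<close> is the model space, a vector standing for its coordinates in the preferred chart at \<open>p\<close>.
  \<open>to_chart A c p\<close> and \<open>from_chart A c p\<close> pass between these and the coordinates in the chart \<open>c\<close>.
  Sections of bundles over \<open>TX\<close> thus become functions of the point with values in a fixed space;
  as the preferred chart jumps, their smoothness is always tested after passing to a
  fixed chart.\<close>

definition chart_at :: "('a, 'e) chart set \<Rightarrow> 'a \<Rightarrow> ('a, 'e) chart" where
  "chart_at A p = (SOME c. c \<in> A \<and> p \<in> fst c)"

definition tangent_map :: "('a, 'e::real_normed_vector) chart set \<Rightarrow>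
    ('b, 'f::real_normed_vector) chart set \<Rightarrow> ('a \<Rightarrow> 'b) \<Rightarrow> 'a \<Rightarrow> 'e \<Rightarrow> 'f" where
  "tangent_map A B f p =
     frechet_derivative (snd (chart_at B (f p)) \<circ> f \<circ> chart_inv (chart_at A p))
       (at (snd (chart_at A p) p))"

definition velocity :: "('a, 'e::real_normed_vector) chart set \<Rightarrow> (real \<Rightarrow> 'a) \<Rightarrow> real \<Rightarrow> 'e" where
  "velocity A \<gamma> t = vector_derivative (snd (chart_at A (\<gamma> t)) \<circ> \<gamma>) (at t)"

definition to_chart ::
    "('a, 'e::real_normed_vector) chart set \<Rightarrow> ('a, 'e) chart \<Rightarrow> 'a \<Rightarrow> 'e \<Rightarrow> 'e" where
  "to_chart A c p =
     frechet_derivative (snd c \<circ> chart_inv (chart_at A p)) (at (snd (chart_at A p) p))"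

definition from_chart ::
    "('a, 'e::real_normed_vector) chart set \<Rightarrow> ('a, 'e) chart \<Rightarrow> 'a \<Rightarrow> 'e \<Rightarrow> 'e" where
  "from_chart A c p = frechet_derivative (snd (chart_at A p) \<circ> chart_inv c) (at (snd c p))"

definition smooth_field :: "('a::topological_space, 'e::real_normed_vector) chart set \<Rightarrow>
    'a set \<Rightarrow> ('a \<Rightarrow> 'e) \<Rightarrow> bool" where
  "smooth_field A U Y \<longleftrightarrow> (\<forall>c\<in>A.
     smooth_on (\<lambda>x. to_chart A c (chart_inv c x) (Y (chart_inv c x))) (snd c ` (U \<inter> fst c)))"


section \<open>Complex forms of mixed degree\<close>

text \<open>An element of the complexified exterior algebra of the dual of \<open>'e\<close> is a function on lists
  of vectors whose restriction to lists of length \<open>k\<close> is its component of degree \<open>k\<close>.\<close>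

type_synonym 'e form = "'e list \<Rightarrow> complex"

definition alt_form :: "'e::real_vector form \<Rightarrow> bool" where
  "alt_form \<alpha> \<longleftrightarrow> (\<forall>us vs. linear (\<lambda>x. \<alpha> (us @ x # vs))) \<and> (\<forall>vs. \<not> distinct vs \<longrightarrow> \<alpha> vs = 0)"

definition one_form :: "('e \<Rightarrow> complex) \<Rightarrow> 'e form" where
  "one_form \<xi> vs = (if length vs = 1 then \<xi> (hd vs) else 0)"

text \<open>The recursion says that contraction with \<open>v\<close> is an antiderivation, for the normalization
  \<open>(\<alpha> \<and> \<beta>)(u, v) = \<alpha>(u) \<beta>(v) - \<alpha>(v) \<beta>(u)\<close> on 1-forms.\<close>

fun wedge :: "'e form \<Rightarrow> 'e form \<Rightarrow> 'e form" where
  "wedge \<alpha> \<beta> [] = \<alpha> [] * \<beta> []"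
| "wedge \<alpha> \<beta> (v # vs) = wedge (\<lambda>us. \<alpha> (v # us)) \<beta> vs +
     wedge (\<lambda>us. (-1) ^ length us * \<alpha> us) (\<lambda>us. \<beta> (v # us)) vs"

primrec wedge_power :: "'e form \<Rightarrow> nat \<Rightarrow> 'e form" where
  "wedge_power \<alpha> 0 = (\<lambda>vs. if vs = [] then 1 else 0)"
| "wedge_power \<alpha> (Suc k) = wedge \<alpha> (wedge_power \<alpha> k)"

text \<open>Exponential of a form without component of degree 0: the powers beyond the
  degree evaluated vanish.\<close>

definition form_exp :: "'e form \<Rightarrow> 'e form" where
  "form_exp \<alpha> vs = (\<Sum>k\<le>length vs. wedge_power \<alpha> k vs / fact k)"

definition local_rep :: "('a, 'e::real_normed_vector) chart set \<Rightarrow> ('a, 'e) chart \<Rightarrow>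
    ('a \<Rightarrow> 'e form) \<Rightarrow> 'e \<Rightarrow> 'e form" where
  "local_rep A c \<rho> x vs = \<rho> (chart_inv c x) (map (from_chart A c (chart_inv c x)) vs)"

definition smooth_form_on :: "('a::topological_space, 'e::real_normed_vector) chart set \<Rightarrow>
    'a set \<Rightarrow> ('a \<Rightarrow> 'e form) \<Rightarrow> bool" where
  "smooth_form_on A U \<rho> \<longleftrightarrow> (\<forall>p\<in>U. alt_form (\<rho> p)) \<and>
     (\<forall>c\<in>A. \<forall>vs. smooth_on (\<lambda>x. local_rep A c \<rho> x vs) (snd c ` (U \<inter> fst c)))"

definition real_form_on :: "('a::topological_space, 'e::real_normed_vector) chart set \<Rightarrow>
    nat \<Rightarrow> 'a set \<Rightarrow> ('a \<Rightarrow> 'e form) \<Rightarrow> bool" where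
  "real_form_on A k U \<alpha> \<longleftrightarrow> smooth_form_on A U \<alpha> \<and>
     (\<forall>p\<in>U. \<forall>vs. \<alpha> p vs \<in> \<real> \<and> (length vs \<noteq> k \<longrightarrow> \<alpha> p vs = 0))"

text \<open>\<open>(d\<alpha>)(v\<^sub>0, \<dots>, v\<^sub>k)\<close> is the alternating sum of the derivatives along \<open>v\<^sub>i\<close> of
  \<open>\<alpha>(v\<^sub>0, \<dots>, v\<^sub>k)\<close> with \<open>v\<^sub>i\<close> omitted.\<close>

definition flat_ext_deriv :: "('e::real_normed_vector \<Rightarrow> 'e form) \<Rightarrow> 'e \<Rightarrow> 'e form" where
  "flat_ext_deriv \<alpha> x vs = (\<Sum>i<length vs.
     (-1) ^ i * frechet_derivative (\<lambda>y. \<alpha> y (take i vs @ drop (Suc i) vs)) (at x) (vs ! i))"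

definition ext_deriv :: "('a, 'e::real_normed_vector) chart set \<Rightarrow>
    ('a \<Rightarrow> 'e form) \<Rightarrow> 'a \<Rightarrow> 'e form" where
  "ext_deriv A \<rho> p =
     flat_ext_deriv (local_rep A (chart_at A p) \<rho>) (snd (chart_at A p) p)"

definition twisted_ext_deriv :: "('a, 'e::real_normed_vector) chart set \<Rightarrow>
    ('a \<Rightarrow> 'e form) \<Rightarrow> ('a \<Rightarrow> 'e form) \<Rightarrow> 'a \<Rightarrow> 'e form" where
  "twisted_ext_deriv A H \<rho> p vs = ext_deriv A \<rho> p vs + wedge (H p) (\<rho> p) vs"


section \<open>Pure spinors and generalized complex structures\<close>

text \<open>An element of \<open>T\<^sub>\<complex> \<oplus> T*\<^sub>\<complex>\<close> is \<open>((u, v), \<xi>)\<close>, with \<open>(u, v)\<close> standing for the complex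
  vector \<open>u + \<i> v\<close> and with \<open>\<xi>\<close> a real-linear map to \<open>complex\<close>.\<close>

type_synonym 'e gen_vec = "('e \<times> 'e) \<times> ('e \<Rightarrow> complex)"

definition clifford :: "'e gen_vec \<Rightarrow> 'e form \<Rightarrow> 'e form" where
  "clifford w \<rho> vs = \<rho> (fst (fst w) # vs) + \<i> * \<rho> (snd (fst w) # vs)
     + wedge (one_form (snd w)) \<rho> vs"

definition gv_add :: "'e::real_vector gen_vec \<Rightarrow> 'e gen_vec \<Rightarrow> 'e gen_vec" where
  "gv_add w z = (fst w + fst z, \<lambda>x. snd w x + snd z x)"

definition gv_scale :: "complex \<Rightarrow> 'e::real_vector gen_vec \<Rightarrow> 'e gen_vec" where
  "gv_scale a w = ((Re a *\<^sub>R fst (fst w) - Im a *\<^sub>R snd (fst w),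
                    Re a *\<^sub>R snd (fst w) + Im a *\<^sub>R fst (fst w)), \<lambda>x. a * snd w x)"

definition gv_zero :: "'e::real_vector gen_vec" where
  "gv_zero = ((0, 0), \<lambda>x. 0)"

definition gv_conj :: "'e::real_vector gen_vec \<Rightarrow> 'e gen_vec" where
  "gv_conj w = ((fst (fst w), - snd (fst w)), \<lambda>x. cnj (snd w x))"

definition gv_subspace :: "'e::real_vector gen_vec set \<Rightarrow> bool" where
  "gv_subspace L \<longleftrightarrow> (\<forall>w\<in>L. linear (snd w)) \<and> gv_zero \<in> L \<and>
     (\<forall>w\<in>L. \<forall>z\<in>L. gv_add w z \<in> L) \<and> (\<forall>a. \<forall>w\<in>L. gv_scale a w \<in> L)"

definition gv_pairing :: "'e gen_vec \<Rightarrow> 'e gen_vec \<Rightarrow> complex" where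
  "gv_pairing w z = (snd w (fst (fst z)) + \<i> * snd w (snd (fst z))
                   + snd z (fst (fst w)) + \<i> * snd z (snd (fst w))) / 2"

definition isotropic :: "'e::real_vector gen_vec set \<Rightarrow> bool" where
  "isotropic L \<longleftrightarrow> gv_subspace L \<and> (\<forall>w\<in>L. \<forall>z\<in>L. gv_pairing w z = 0)"

definition maximal_isotropic :: "'e::real_vector gen_vec set \<Rightarrow> bool" where
  "maximal_isotropic L \<longleftrightarrow> isotropic L \<and> (\<forall>M. isotropic M \<and> L \<subseteq> M \<longrightarrow> M = L)"

definition annihilator :: "'e::real_vector form \<Rightarrow> 'e gen_vec set" where
  "annihilator \<rho> = {w. linear (snd w) \<and> clifford w \<rho> = (\<lambda>vs. 0)}"

definition pure_spinor :: "'e::real_vector form \<Rightarrow> bool" where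
  "pure_spinor \<rho> \<longleftrightarrow> alt_form \<rho> \<and> \<rho> \<noteq> (\<lambda>vs. 0) \<and> maximal_isotropic (annihilator \<rho>)"

definition real_rank_zero :: "'e::real_vector form \<Rightarrow> bool" where
  "real_rank_zero \<rho> \<longleftrightarrow> annihilator \<rho> \<inter> gv_conj ` annihilator \<rho> = {gv_zero}"

definition almost_generalized_complex :: "('a::topological_space, 'e::real_normed_vector) chart set \<Rightarrow>
    ('a \<Rightarrow> 'e form set) \<Rightarrow> bool" where
  "almost_generalized_complex A \<kappa> \<longleftrightarrow> (\<forall>p. \<exists>U \<rho>. open U \<and> p \<in> U \<and> smooth_form_on A U \<rho> \<and>
     (\<forall>q\<in>U. pure_spinor (\<rho> q) \<and> real_rank_zero (\<rho> q) \<and>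
        \<kappa> q = range (\<lambda>a::complex. \<lambda>vs. a * \<rho> q vs)))"

text \<open>The local sections in the integrability condition are local spinors, hence nowhere zero.
  (At a zero of a section \<open>\<rho>\<close> the condition would force \<open>d\<rho> = 0\<close> there, so it would fail
  for suitable multiples of any spinor.)\<close>

definition integrable_wrt :: "('a::topological_space, 'e::real_normed_vector) chart set \<Rightarrow>
    ('a \<Rightarrow> 'e form) \<Rightarrow> ('a \<Rightarrow> 'e form set) \<Rightarrow> bool" where
  "integrable_wrt A H \<kappa> \<longleftrightarrow> (\<forall>U \<rho>. open U \<and> smooth_form_on A U \<rho> \<and>
       (\<forall>q\<in>U. \<rho> q \<in> \<kappa> q \<and> \<rho> q \<noteq> (\<lambda>vs. 0)) \<longrightarrow>
     (\<exists>u v \<xi>. smooth_field A U u \<and> smooth_field A U v \<and> smooth_form_on A U (\<lambda>q. one_form (\<xi> q)) \<and>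
       (\<forall>q\<in>U. twisted_ext_deriv A H \<rho> q = clifford ((u q, v q), \<xi> q) (\<rho> q))))"

definition generalized_complex_structure ::
    "('a::topological_space, 'e::real_normed_vector) chart set \<Rightarrow> ('a \<Rightarrow> 'e form set) \<Rightarrow> bool" where
  "generalized_complex_structure A \<kappa> \<longleftrightarrow> almost_generalized_complex A \<kappa> \<and>
     (\<exists>H. real_form_on A 3 UNIV H \<and> (\<forall>p. ext_deriv A H p = (\<lambda>vs. 0)) \<and> integrable_wrt A H \<kappa>)"


section \<open>Flat symplectic fibre bundles\<close>

definition vertical :: "('x, 'e::real_normed_vector) chart set \<Rightarrow>
    ('b, 'm::real_normed_vector) chart set \<Rightarrow> ('x \<Rightarrow> 'b) \<Rightarrow> 'x \<Rightarrow> 'e set" where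
  "vertical A Z \<pi> p = {v. tangent_map A Z \<pi> p v = 0}"

definition symplectic_form ::
    "('f::topological_space, 'k::real_normed_vector) chart set \<Rightarrow> ('f \<Rightarrow> 'k form) \<Rightarrow> bool" where
  "symplectic_form A \<sigma> \<longleftrightarrow> real_form_on A 2 UNIV \<sigma> \<and> (\<forall>p. ext_deriv A \<sigma> p = (\<lambda>vs. 0)) \<and>
     (\<forall>p v. v \<noteq> 0 \<longrightarrow> (\<exists>w. \<sigma> p [v, w] \<noteq> 0))"

text \<open>A section of \<open>\<and>\<^sup>2S*\<close> is a function of which only the values on \<open>S\<close> matter. Closedness along
  the fibres is part of the local triviality in \<open>symplectic_fibre_bundle\<close>.\<close>

definition nondegenerate_2form_along ::
    "('x::topological_space, 'e::real_normed_vector) chart set \<Rightarrow>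
     ('x \<Rightarrow> 'e set) \<Rightarrow> ('x \<Rightarrow> 'e \<Rightarrow> 'e \<Rightarrow> real) \<Rightarrow> bool" where
  "nondegenerate_2form_along A S \<omega> \<longleftrightarrow>
     (\<forall>p. \<forall>u\<in>S p. \<forall>v\<in>S p. \<forall>w\<in>S p. \<forall>a b.
        \<omega> p (a *\<^sub>R u + b *\<^sub>R v) w = a * \<omega> p u w + b * \<omega> p v w \<and> \<omega> p u v = - \<omega> p v u) \<and>
     (\<forall>p. \<forall>v\<in>S p. v \<noteq> 0 \<longrightarrow> (\<exists>w\<in>S p. \<omega> p v w \<noteq> 0)) \<and>
     (\<forall>U Y W. open U \<and> smooth_field A U Y \<and> smooth_field A U W \<and> (\<forall>q\<in>U. Y q \<in> S q \<and> W q \<in> S q) \<longrightarrow>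
        smooth_map A self_atlas U (\<lambda>q. \<omega> q (Y q) (W q)))"

text \<open>The typical fibre is the symplectic manifold \<open>(F, \<sigma>)\<close>, with atlas \<open>AF\<close>. A local
  trivialization \<open>p \<mapsto> (\<pi> p, \<Phi> p)\<close> over \<open>U\<close> has inverse \<open>g\<close>.\<close>

definition symplectic_fibre_bundle ::
    "('x::topological_space, 'e::real_normed_vector) chart set \<Rightarrow>
     ('b::topological_space, 'm::real_normed_vector) chart set \<Rightarrow> ('x \<Rightarrow> 'b) \<Rightarrow>
     ('f::topological_space, 'k::real_normed_vector) chart set \<Rightarrow> ('f \<Rightarrow> 'k form) \<Rightarrow>
     ('x \<Rightarrow> 'e \<Rightarrow> 'e \<Rightarrow> real) \<Rightarrow> bool" where
  "symplectic_fibre_bundle A Z \<pi> AF \<sigma> \<omega> \<longleftrightarrow>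
     smooth_map A Z UNIV \<pi> \<and> smooth_atlas AF \<and> symplectic_form AF \<sigma> \<and>
     nondegenerate_2form_along A (vertical A Z \<pi>) \<omega> \<and>
     (\<forall>b. \<exists>U \<Phi> g. open U \<and> b \<in> U \<and>
        smooth_map A (prod_atlas Z AF) (\<pi> -` U) (\<lambda>p. (\<pi> p, \<Phi> p)) \<and>
        smooth_map (prod_atlas Z AF) A (U \<times> UNIV) g \<and>
        (\<forall>p. \<pi> p \<in> U \<longrightarrow> g (\<pi> p, \<Phi> p) = p) \<and>
        (\<forall>b'\<in>U. \<forall>y. \<pi> (g (b', y)) = b' \<and> \<Phi> (g (b', y)) = y) \<and>
        (\<forall>p\<in>\<pi> -` U. \<forall>u\<in>vertical A Z \<pi> p. \<forall>v\<in>vertical A Z \<pi> p.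
           \<sigma> (\<Phi> p) [tangent_map A AF \<Phi> p u, tangent_map A AF \<Phi> p v] = of_real (\<omega> p u v)))"

text \<open>A distribution is integrable if it is tangent to a foliation, that is, if around every point
  there is a flat chart, in which it is a constant family of subspaces.\<close>

definition integrable_distribution :: "('x::topological_space, 'e::real_normed_vector) chart set \<Rightarrow>
    ('x \<Rightarrow> 'e set) \<Rightarrow> bool" where
  "integrable_distribution A N \<longleftrightarrow> (\<forall>p. subspace (N p)) \<and>
     (\<forall>p. \<exists>c\<in>A. p \<in> fst c \<and> (\<exists>W. \<forall>q\<in>fst c. to_chart A c q ` N q = W))"

definition horizontal_distribution :: "('x::topological_space, 'e::real_normed_vector) chart set \<Rightarrow>
    ('b, 'm::real_normed_vector) chart set \<Rightarrow> ('x \<Rightarrow> 'b) \<Rightarrow> ('x \<Rightarrow> 'e set) \<Rightarrow> bool" where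
  "horizontal_distribution A Z \<pi> N \<longleftrightarrow> (\<forall>p. vertical A Z \<pi> p \<inter> N p = {0} \<and>
     (\<forall>w. \<exists>u\<in>vertical A Z \<pi> p. \<exists>v\<in>N p. w = u + v))"

text \<open>\<open>transports A \<pi> N \<gamma> x y\<close>: some horizontal lift of the path \<open>\<gamma>\<close> leads from \<open>x\<close> to \<open>y\<close>.
  Parallel transport is not required to be defined on the whole fibre.\<close>

definition transports :: "('x::topological_space, 'e::real_normed_vector) chart set \<Rightarrow>
    ('x \<Rightarrow> 'b) \<Rightarrow> ('x \<Rightarrow> 'e set) \<Rightarrow> (real \<Rightarrow> 'b) \<Rightarrow> 'x \<Rightarrow> 'x \<Rightarrow> bool" where
  "transports A \<pi> N \<gamma> x y \<longleftrightarrow> (\<exists>W c. open W \<and> {0..1} \<subseteq> W \<and> smooth_map self_atlas A W c \<and>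
     c 0 = x \<and> c 1 = y \<and> (\<forall>t\<in>{0..1}. \<pi> (c t) = \<gamma> t \<and> velocity A c t \<in> N (c t)))"

text \<open>The parallel transport \<open>\<tau>\<close> along \<open>\<gamma>\<close> satisfies \<open>\<tau>*\<omega> = \<omega>\<close>. Its differential is expressed by
  curves: \<open>a\<close>, \<open>a'\<close> are curves through one point of the fibre over \<open>\<gamma> 0\<close>, and \<open>b\<close>, \<open>b'\<close> are their
  images under \<open>\<tau>\<close>.\<close>

definition parallel_transport_preserves ::
    "('x::topological_space, 'e::real_normed_vector) chart set \<Rightarrow>
     ('x \<Rightarrow> 'b) \<Rightarrow> ('x \<Rightarrow> 'e set) \<Rightarrow> ('x \<Rightarrow> 'e \<Rightarrow> 'e \<Rightarrow> real) \<Rightarrow> bool" where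
  "parallel_transport_preserves A \<pi> N \<omega> \<longleftrightarrow> (\<forall>\<gamma> W a a' b b'.
     open W \<and> 0 \<in> W \<and>
     smooth_map self_atlas A W a \<and> smooth_map self_atlas A W a' \<and>
     smooth_map self_atlas A W b \<and> smooth_map self_atlas A W b' \<and>
     a 0 = a' 0 \<and> b 0 = b' 0 \<and>
     (\<forall>s\<in>W. transports A \<pi> N \<gamma> (a s) (b s) \<and> transports A \<pi> N \<gamma> (a' s) (b' s)) \<longrightarrow>
     \<omega> (b 0) (velocity A b 0) (velocity A b' 0) = \<omega> (a 0) (velocity A a 0) (velocity A a' 0))"

definition flat_symplectic_fibre_bundle ::
    "('x::topological_space, 'e::real_normed_vector) chart set \<Rightarrow>
     ('b::topological_space, 'm::real_normed_vector) chart set \<Rightarrow> ('x \<Rightarrow> 'b) \<Rightarrow>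
     ('f::topological_space, 'k::real_normed_vector) chart set \<Rightarrow> ('f \<Rightarrow> 'k form) \<Rightarrow>
     ('x \<Rightarrow> 'e \<Rightarrow> 'e \<Rightarrow> real) \<Rightarrow> ('x \<Rightarrow> 'e set) \<Rightarrow> bool" where
  "flat_symplectic_fibre_bundle A Z \<pi> AF \<sigma> \<omega> N \<longleftrightarrow> symplectic_fibre_bundle A Z \<pi> AF \<sigma> \<omega> \<and>
     horizontal_distribution A Z \<pi> N \<and> integrable_distribution A N \<and>
     parallel_transport_preserves A \<pi> N \<omega>"


section \<open>Poisson structures with a transverse complex structure\<close>

text \<open>The Poisson structure with leafwise symplectic form \<open>\<omega>\<close> on \<open>S\<close>, as the map \<open>T* \<rightarrow> T\<close>
  with image in \<open>S\<close> that inverts \<open>\<omega>\<close>.\<close>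

definition poisson_structure_of ::
    "('x \<Rightarrow> 'e::real_vector set) \<Rightarrow> ('x \<Rightarrow> 'e \<Rightarrow> 'e \<Rightarrow> real) \<Rightarrow> ('x \<Rightarrow> ('e \<Rightarrow> real) \<Rightarrow> 'e) \<Rightarrow> bool" where
  "poisson_structure_of S \<omega> P \<longleftrightarrow>
     (\<forall>p \<xi>. linear \<xi> \<longrightarrow> P p \<xi> \<in> S p \<and> (\<forall>v\<in>S p. \<omega> p (P p \<xi>) v = \<xi> v))"

text \<open>The transverse complex structure \<open>I\<close> is given by its line bundle \<open>\<kappa>\<^sub>I = \<pi>*T*\<^sub>1\<^sub>,\<^sub>0 B\<close>. A form of
  type \<open>(1, 0)\<close> at a point of \<open>B\<close> is multiplication by a complex number in a holomorphic chart.\<close>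

definition kappa_I :: "('x, 'e::real_normed_vector) chart set \<Rightarrow> ('b, complex) chart set \<Rightarrow>
    ('x \<Rightarrow> 'b) \<Rightarrow> 'x \<Rightarrow> 'e form set" where
  "kappa_I A Z \<pi> p = range (\<lambda>a. one_form (\<lambda>v. a * tangent_map A Z \<pi> p v))"

text \<open>\<open>(Q, I)\<close> are generalized complex, for a Poisson structure \<open>Q\<close> with leafwise symplectic form
  \<open>\<omega>\<close> on the distribution \<open>S\<close>.\<close>

definition generalized_complex_pair ::
    "('x::topological_space, 'e::real_normed_vector) chart set \<Rightarrow> ('x \<Rightarrow> 'e set) \<Rightarrow>
     ('x \<Rightarrow> ('e \<Rightarrow> real) \<Rightarrow> 'e) \<Rightarrow> ('x \<Rightarrow> 'e form set) \<Rightarrow> bool" where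
  "generalized_complex_pair A S Q \<kappa>\<^sub>I \<longleftrightarrow> (\<exists>\<omega> \<kappa>.
     nondegenerate_2form_along A S \<omega> \<and> poisson_structure_of S \<omega> Q \<and>
     generalized_complex_structure A \<kappa> \<and>
     (\<forall>p. \<exists>U C \<eta>. open U \<and> p \<in> U \<and> real_form_on A 2 U C \<and> real_form_on A 2 U \<eta> \<and>
        (\<forall>q\<in>U. (\<forall>u\<in>S q. \<forall>v\<in>S q. \<eta> q [u, v] = of_real (\<omega> q u v)) \<and>
           \<kappa> q = wedge (form_exp (\<lambda>vs. C q vs + \<i> * \<eta> q vs)) ` \<kappa>\<^sub>I q)))"


section \<open>Pluriharmonic functions on a Riemann surface\<close>

definition wirtinger :: "(complex \<Rightarrow> complex) \<Rightarrow> complex \<Rightarrow> complex" where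
  "wirtinger f z = (frechet_derivative f (at z) 1 - \<i> * frechet_derivative f (at z) \<i>) / 2"

definition wirtinger_bar :: "(complex \<Rightarrow> complex) \<Rightarrow> complex \<Rightarrow> complex" where
  "wirtinger_bar f z = (frechet_derivative f (at z) 1 + \<i> * frechet_derivative f (at z) \<i>) / 2"

text \<open>In a chart, \<open>\<partial>\<partial>\<^sup>-V\<close> is the mixed second Wirtinger derivative of \<open>V\<close> times \<open>dz \<and> dz\<^sup>-\<close>.\<close>

definition pluriharmonic :: "('b::topological_space, complex) chart set \<Rightarrow> ('b \<Rightarrow> real) \<Rightarrow> bool" where
  "pluriharmonic Z V \<longleftrightarrow> smooth_map Z self_atlas UNIV V \<and>
     (\<forall>c\<in>Z. \<forall>z\<in>snd c ` fst c.
        wirtinger (wirtinger_bar (\<lambda>w. complex_of_real (V (chart_inv c w)))) z = 0)"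

end

theory Submission
  imports Defs
begin

text \<open>Let \<open>\<omega>\<close> also denote the 2-form on \<open>X\<close> that extends the fibrewise symplectic form by zero on the
  horizontal distribution \<open>N\<close>. Flatness makes it locally the pullback of the symplectic form
  of the typical fibre along the leaves of \<open>N\<close>, so it is closed. Take
  \<open>\<kappa> = exp(\<i> V \<omega>) \<and> \<kappa>\<^sub>I\<close> and \<open>H = d\<^sup>cV \<and> \<omega>\<close>. The form \<open>H\<close> is closed because \<open>V\<close> is pluriharmonic, and for a
  section \<open>\<theta>\<close> of \<open>\<kappa>\<^sub>I\<close> the factor \<open>d\<^sup>cV + \<i> dV\<close> of \<open>H + \<i> d(V \<omega>)\<close> is of type \<open>(1, 0)\<close>, so it is
  killed by \<open>\<theta>\<close> and \<open>d\<^sub>H (exp(\<i> V \<omega>) \<and> \<theta>) = exp(\<i> V \<omega>) \<and> d\<theta>\<close>. Finally \<open>d\<theta> = \<xi> \<and> \<theta>\<close>,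
  since \<open>\<kappa>\<^sub>I\<close> is locally spanned by closed forms.\<close>

section \<open>Smooth maps between normed spaces\<close>

text \<open>That \<open>\<omega>\<close> extended by zero is a pullback requires leaves and fibres
  to be straight in the same coordinates. A flat chart straightens only the leaves, so its
  coordinates along the leaves are replaced by the base coordinate, and a smooth inverse of this
  change is constructed explicitly. Sliding along a leaf is then a translation, and preservation of
  \<open>\<omega>\<close> by parallel transport is applied to line segments in a ball. The sign in
  \<open>dcV\<close> is chosen so that d^cV + \<i> dV = 2 \<i> \<partial>V. On a Riemann surface a
  (1,0)-form with holomorphic coefficient is closed; this is where pluriharmonicity enters.
  Positivity of V keeps V \<omega> nondegenerate on the fibres, which gives real rank zero. All of
  the non-closedness of V \<omega> is absorbed by H, so the real 2-form C can be zero. A tangent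
  vector is a coordinate vector in a preferred chart that jumps from point to point, so
  \<open>tangent_map\<close> need not vary smoothly. Objects built from it are rewritten in a fixed
  chart of the total space and a fixed holomorphic chart of the base, at the cost of a nonvanishing
  complex factor at each point.\<close>

lemma Ck_on_cong:
  assumes "open S" "\<And>x. x \<in> S \<Longrightarrow> f x = g x" "Ck_on k f S"
  shows "Ck_on k g S"
  using assms(2,3)
proof (induction k arbitrary: f g)
  case 0
  then show ?case using continuous_on_eq by auto
next
  case (Suc k)
  have eq: "frechet_derivative f (at x) = frechet_derivative g (at x)" if "x \<in> S" for x
    using frechet_derivative_transform_within_open[OF _ assms(1) that Suc.prems(1)] Suc.prems(2) that
    by auto
  have "g differentiable (at x)" if "x \<in> S" for x
    using Suc.prems that has_derivative_transform_within_open[OF _ assms(1) that, of f _ UNIV g]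
    unfolding differentiable_def by (metis Ck_on.simps(2) differentiable_def)
  then show ?case
    using Suc.IH[of "\<lambda>x. frechet_derivative f (at x) v" "\<lambda>x. frechet_derivative g (at x) v" for v]
      Suc.prems(2) eq by auto
qed

lemma Ck_on_subset: "Ck_on k f S \<Longrightarrow> T \<subseteq> S \<Longrightarrow> Ck_on k f T"
  by (induction k arbitrary: f) (auto intro: continuous_on_subset)

lemma Ck_on_SucD: "Ck_on (Suc k) f S \<Longrightarrow> Ck_on k f S"
proof (induction k arbitrary: f)
  case 0
  then show ?case
    by (auto intro!: continuous_at_imp_continuous_on differentiable_imp_continuous_within)
qed auto

lemma Ck_on_locally:
  assumes "\<And>x. x \<in> S \<Longrightarrow> \<exists>T. open T \<and> x \<in> T \<and> Ck_on k f T"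
  shows "Ck_on k f S"
  using assms
proof (induction k arbitrary: f)
  case 0
  then show ?case
    by (metis Ck_on.simps(1) continuous_at_imp_continuous_on continuous_on_eq_continuous_at)
next
  case (Suc k)
  then show ?case by (simp, meson)
qed

lemma Ck_on_Suc_has_derivative:
  "Ck_on (Suc k) f S \<Longrightarrow> x \<in> S \<Longrightarrow> (f has_derivative frechet_derivative f (at x)) (at x)"
  by (simp add: frechet_derivative_works[symmetric])

declare Ck_on.simps [simp del]

text \<open>Any formula for the derivative may replace the chosen \<open>frechet_derivative\<close>;
  the closure properties below are inductions on k that supply such a formula.\<close>

lemma Ck_on_SucI:
  assumes "open S" "\<And>x. x \<in> S \<Longrightarrow> (f has_derivative f' x) (at x)" "\<And>v. Ck_on k (\<lambda>x. f' x v) S"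
  shows "Ck_on (Suc k) f S"
proof -
  have "f differentiable (at x)" if "x \<in> S" for x
    using assms(2)[OF that] by (auto simp: differentiable_def)
  moreover have "Ck_on k (\<lambda>x. frechet_derivative f (at x) v) S" for v
    by (rule Ck_on_cong[OF assms(1) _ assms(3)[of v]]) (metis assms(2) frechet_derivative_at)
  ultimately show ?thesis by (simp add: Ck_on.simps)
qed

lemma Ck_on_const: "open S \<Longrightarrow> Ck_on k (\<lambda>x. c) S"
  by (induction k arbitrary: c) (auto simp: Ck_on.simps)

lemma Ck_on_bounded_linear:
  assumes "bounded_linear L" "open S"
  shows "Ck_on k L S"
proof (cases k)
  case 0
  then show ?thesis using assms by (simp add: linear_continuous_on Ck_on.simps)
next
  case (Suc m)
  show ?thesis unfolding Suc
    by (rule Ck_on_SucI[OF assms(2), where f' = "\<lambda>x. L"])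
       (auto intro: bounded_linear_imp_has_derivative assms Ck_on_const)
qed

lemma Ck_on_add:
  assumes "open S"
  shows "Ck_on k f S \<Longrightarrow> Ck_on k g S \<Longrightarrow> Ck_on k (\<lambda>x. f x + g x) S"
proof (induction k arbitrary: f g)
  case (Suc k)
  show ?case
    by (rule Ck_on_SucI[OF assms, where f' = "\<lambda>x v. frechet_derivative f (at x) v + frechet_derivative g (at x) v"])
       (use Suc in \<open>auto simp: Ck_on.simps(2) frechet_derivative_works intro: has_derivative_add\<close>)
qed (auto simp: Ck_on.simps intro: continuous_on_add continuous_on_inverse)

lemma Ck_on_bounded_linear_compose:
  assumes "bounded_linear L" "open S"
  shows "Ck_on k f S \<Longrightarrow> Ck_on k (\<lambda>x. L (f x)) S"
proof (induction k arbitrary: f)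
  case 0
  then show ?case using assms
    by (auto simp: Ck_on.simps intro: bounded_linear.continuous_on)
next
  case (Suc k)
  show ?case
    by (rule Ck_on_SucI[OF assms(2), where f' = "\<lambda>x v. L (frechet_derivative f (at x) v)"])
       (use Suc assms in \<open>auto simp: Ck_on.simps(2) frechet_derivative_works intro: bounded_linear.has_derivative\<close>)
qed

lemma Ck_on_bounded_bilinear:
  assumes "bounded_bilinear B" "open S"
  shows "Ck_on k f S \<Longrightarrow> Ck_on k g S \<Longrightarrow> Ck_on k (\<lambda>x. B (f x) (g x)) S"
proof (induction k arbitrary: f g)
  case 0
  then show ?case using assms
    by (auto simp: Ck_on.simps intro: bounded_bilinear.continuous_on)
next
  case (Suc k)
  show ?case
  proof (rule Ck_on_SucI[OF assms(2)])
    show "((\<lambda>x. B (f x) (g x)) has_derivative (\<lambda>v. B (f x) (frechet_derivative g (at x) v)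
        + B (frechet_derivative f (at x) v) (g x))) (at x)" if "x \<in> S" for x
      by (rule bounded_bilinear.FDERIV[OF assms(1) Ck_on_Suc_has_derivative[OF Suc.prems(1) that]
            Ck_on_Suc_has_derivative[OF Suc.prems(2) that]])
    show "Ck_on k (\<lambda>x. B (f x) (frechet_derivative g (at x) v) + B (frechet_derivative f (at x) v) (g x)) S" for v
      by (intro Ck_on_add assms Suc.IH) (use Suc.prems Suc.prems[THEN Ck_on_SucD] in \<open>auto simp: Ck_on.simps(2)\<close>)
  qed
qed

lemma Ck_on_sum:
  assumes "open S" "\<And>i. i \<in> I \<Longrightarrow> Ck_on k (f i) S"
  shows "Ck_on k (\<lambda>x. \<Sum>i\<in>I. f i x) S"
  using assms(2) by (induction I rule: infinite_finite_induct) (auto intro: Ck_on_add Ck_on_const assms(1))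

lemma linear_eq_sum_Basis:
  fixes L :: "'a::euclidean_space \<Rightarrow> 'b::real_vector"
  assumes "linear L"
  shows "L w = (\<Sum>b\<in>Basis. (w \<bullet> b) *\<^sub>R L b)"
proof -
  have "L w = L (\<Sum>b\<in>Basis. (w \<bullet> b) *\<^sub>R b)" by (simp only: euclidean_representation)
  also have "\<dots> = (\<Sum>b\<in>Basis. (w \<bullet> b) *\<^sub>R L b)"
    using assms by (simp add: linear_sum linear_scale)
  finally show ?thesis .
qed

text \<open>\<open>Ck_on\<close> controls a derivative along fixed vectors only, whereas the chain
  rule applies the derivative of g to the moving vector
  \<open>frechet_derivative f (at x) v\<close>. Expanding that vector in a basis gives a finite sum
  of products to which the induction applies; this is why the middle space is Euclidean.\<close>

lemma Ck_on_compose: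
  fixes f :: "'a::real_normed_vector \<Rightarrow> 'b::euclidean_space" and g :: "'b \<Rightarrow> 'c::real_normed_vector"
  assumes "open S" "open T" "f ` S \<subseteq> T"
  shows "Ck_on k f S \<Longrightarrow> Ck_on k g T \<Longrightarrow> Ck_on k (\<lambda>x. g (f x)) S"
proof (induction k arbitrary: g)
  case 0
  then show ?case using assms(3) by (auto simp: Ck_on.simps intro: continuous_on_compose2)
next
  case (Suc k)
  have der: "((\<lambda>x. g (f x)) has_derivative (\<lambda>v. \<Sum>b\<in>Basis.
      (frechet_derivative f (at x) v \<bullet> b) *\<^sub>R frechet_derivative g (at (f x)) b)) (at x)" if "x \<in> S" for x
  proof -
    have g: "(g has_derivative frechet_derivative g (at (f x))) (at (f x))"
      using Suc.prems(2) that assms(3) by (auto intro: Ck_on_Suc_has_derivative)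
    have "((\<lambda>x. g (f x)) has_derivative (\<lambda>v. frechet_derivative g (at (f x)) (frechet_derivative f (at x) v))) (at x)"
      using diff_chain_at[OF Ck_on_Suc_has_derivative[OF Suc.prems(1) that] g] by (simp add: o_def)
    then show ?thesis
      by (rule has_derivative_eq_rhs) (intro ext linear_eq_sum_Basis[OF has_derivative_linear[OF g]])
  qed
  show ?case
  proof (rule Ck_on_SucI[OF assms(1) der])
    fix v
    show "Ck_on k (\<lambda>x. \<Sum>b\<in>Basis. (frechet_derivative f (at x) v \<bullet> b) *\<^sub>R frechet_derivative g (at (f x)) b) S"
      by (intro Ck_on_sum assms Ck_on_bounded_bilinear[OF bounded_bilinear_scaleR]
          Ck_on_bounded_linear_compose[OF bounded_linear_inner_left] Suc.IH)
         (use Suc.prems Suc.prems(1)[THEN Ck_on_SucD] in \<open>auto simp: Ck_on.simps(2)\<close>)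
  qed
qed

text \<open>The inner derivative is the constant map L, so no basis expansion occurs and the middle
  space can be any normed space; this case serves the model space of the fibre.\<close>

lemma Ck_on_compose_bounded_linear:
  assumes "bounded_linear L" "open S" "open T" "L ` S \<subseteq> T"
  shows "Ck_on k g T \<Longrightarrow> Ck_on k (\<lambda>x. g (L x)) S"
proof (induction k arbitrary: g)
  case 0
  then show ?case using assms by (auto simp: Ck_on.simps intro: continuous_on_compose2 linear_continuous_on)
next
  case (Suc k)
  show ?case
  proof (rule Ck_on_SucI[OF assms(2)])
    show "((\<lambda>x. g (L x)) has_derivative (\<lambda>v. frechet_derivative g (at (L x)) (L v))) (at x)" if "x \<in> S" for x
      using diff_chain_at[OF bounded_linear_imp_has_derivative[OF assms(1)] Ck_on_Suc_has_derivative[OF Suc.prems, of "L x"]]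
        that assms(4) by (auto simp: o_def)
    show "Ck_on k (\<lambda>x. frechet_derivative g (at (L x)) (L v)) S" for v
      by (rule Suc.IH) (use Suc.prems in \<open>auto simp: Ck_on.simps\<close>)
  qed
qed

text \<open>The derivative at x in the direction v is a product of v and two inverses of x, so each
  order of differentiability yields the next.\<close>

lemma Ck_on_inverse: "Ck_on k (inverse :: 'a::real_normed_field \<Rightarrow> 'a) (- {0})"
proof (induction k)
  case (Suc k)
  show ?case
  proof (rule Ck_on_SucI[where f' = "\<lambda>x v. - (inverse x * v * inverse x)"])
    show "Ck_on k (\<lambda>x::'a. - (inverse x * v * inverse x)) (- {0})" for v
      by (intro Ck_on_bounded_linear_compose[OF bounded_linear_minus[OF bounded_linear_ident]]
          Ck_on_bounded_bilinear[OF bounded_bilinear_mult] Ck_on_const Suc) auto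
  qed (auto intro: has_derivative_inverse')
qed (auto simp: Ck_on.simps intro: continuous_on_add continuous_on_inverse)

section \<open>Closure properties of smooth functions\<close>

lemma smooth_on_cong:
  "open S \<Longrightarrow> (\<And>x. x \<in> S \<Longrightarrow> f x = g x) \<Longrightarrow> smooth_on f S \<longleftrightarrow> smooth_on g S"
  unfolding smooth_on_def using Ck_on_cong[of S f g] Ck_on_cong[of S g f] by auto

lemma smooth_on_subset: "smooth_on f S \<Longrightarrow> T \<subseteq> S \<Longrightarrow> smooth_on f T"
  unfolding smooth_on_def using Ck_on_subset by blast

lemma smooth_on_locally:
  "(\<And>x. x \<in> S \<Longrightarrow> \<exists>T. open T \<and> x \<in> T \<and> smooth_on f T) \<Longrightarrow> smooth_on f S"
  unfolding smooth_on_def using Ck_on_locally by metis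

lemma smooth_on_continuous_on: "smooth_on f S \<Longrightarrow> continuous_on S f"
  unfolding smooth_on_def using Ck_on.simps(1) by blast

lemma smooth_on_has_derivative:
  "smooth_on f S \<Longrightarrow> x \<in> S \<Longrightarrow> (f has_derivative frechet_derivative f (at x)) (at x)"
  unfolding smooth_on_def using Ck_on_Suc_has_derivative by blast

lemma smooth_on_derivative: "smooth_on f S \<Longrightarrow> smooth_on (\<lambda>x. frechet_derivative f (at x) v) S"
  unfolding smooth_on_def using Ck_on.simps(2) by blast

lemma smooth_on_const: "open S \<Longrightarrow> smooth_on (\<lambda>x. c) S"
  unfolding smooth_on_def using Ck_on_const by blast

lemma smooth_on_bounded_linear: "bounded_linear L \<Longrightarrow> open S \<Longrightarrow> smooth_on L S"
  unfolding smooth_on_def using Ck_on_bounded_linear by blast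

lemma smooth_on_ident: "open S \<Longrightarrow> smooth_on (\<lambda>x. x) S"
  by (intro smooth_on_bounded_linear bounded_linear_ident)

lemma smooth_on_add: "open S \<Longrightarrow> smooth_on f S \<Longrightarrow> smooth_on g S \<Longrightarrow> smooth_on (\<lambda>x. f x + g x) S"
  unfolding smooth_on_def using Ck_on_add by blast

lemma smooth_on_bounded_linear_compose:
  "bounded_linear L \<Longrightarrow> open S \<Longrightarrow> smooth_on f S \<Longrightarrow> smooth_on (\<lambda>x. L (f x)) S"
  unfolding smooth_on_def using Ck_on_bounded_linear_compose by blast

lemma smooth_on_minus: "open S \<Longrightarrow> smooth_on f S \<Longrightarrow> smooth_on (\<lambda>x. - f x) S"
  by (rule smooth_on_bounded_linear_compose[OF bounded_linear_minus[OF bounded_linear_ident]])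

lemma smooth_on_diff: "open S \<Longrightarrow> smooth_on f S \<Longrightarrow> smooth_on g S \<Longrightarrow> smooth_on (\<lambda>x. f x - g x) S"
  using smooth_on_add[of S f "\<lambda>x. - g x"] smooth_on_minus by fastforce

lemma smooth_on_bounded_bilinear:
  "bounded_bilinear B \<Longrightarrow> open S \<Longrightarrow> smooth_on f S \<Longrightarrow> smooth_on g S \<Longrightarrow> smooth_on (\<lambda>x. B (f x) (g x)) S"
  unfolding smooth_on_def using Ck_on_bounded_bilinear by blast

lemmas smooth_on_mult = smooth_on_bounded_bilinear[OF bounded_bilinear_mult]
lemmas smooth_on_scaleR = smooth_on_bounded_bilinear[OF bounded_bilinear_scaleR]
lemmas smooth_on_of_real = smooth_on_bounded_linear_compose[OF bounded_linear_of_real]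

lemma smooth_on_sum:
  "open S \<Longrightarrow> (\<And>i. i \<in> I \<Longrightarrow> smooth_on (f i) S) \<Longrightarrow> smooth_on (\<lambda>x. \<Sum>i\<in>I. f i x) S"
  by (simp add: smooth_on_def Ck_on_sum)

lemma smooth_on_compose:
  fixes f :: "'a::real_normed_vector \<Rightarrow> 'b::euclidean_space"
  shows "open S \<Longrightarrow> open T \<Longrightarrow> f ` S \<subseteq> T \<Longrightarrow> smooth_on f S \<Longrightarrow> smooth_on g T \<Longrightarrow> smooth_on (\<lambda>x. g (f x)) S"
  by (simp add: smooth_on_def Ck_on_compose[of S T f])

lemma smooth_on_compose_bounded_linear:
  "bounded_linear L \<Longrightarrow> open S \<Longrightarrow> open T \<Longrightarrow> L ` S \<subseteq> T \<Longrightarrow> smooth_on g T \<Longrightarrow> smooth_on (\<lambda>x. g (L x)) S"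
  by (simp add: smooth_on_def Ck_on_compose_bounded_linear[of L S T])

lemma smooth_on_inverse:
  fixes f :: "'a::real_normed_vector \<Rightarrow> 'b::{real_normed_field,euclidean_space}"
  assumes "open S" "smooth_on f S" "\<And>x. x \<in> S \<Longrightarrow> f x \<noteq> 0"
  shows "smooth_on (\<lambda>x. inverse (f x)) S"
  by (rule smooth_on_compose[where T = "- {0}"]) (use assms in \<open>auto simp: smooth_on_def Ck_on_inverse\<close>)

lemma smooth_on_divide:
  fixes f :: "'a::real_normed_vector \<Rightarrow> 'b::{real_normed_field,euclidean_space}"
  assumes "open S" "smooth_on f S" "smooth_on g S" "\<And>x. x \<in> S \<Longrightarrow> g x \<noteq> 0"
  shows "smooth_on (\<lambda>x. f x / g x) S"
  unfolding divide_inverse by (intro smooth_on_mult smooth_on_inverse assms)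

lemma smooth_on_derivative_apply:
  fixes f :: "'a::euclidean_space \<Rightarrow> 'b::real_normed_vector" and g :: "'a \<Rightarrow> 'a"
  assumes "open S" "smooth_on f S" "smooth_on g S"
  shows "smooth_on (\<lambda>x. frechet_derivative f (at x) (g x)) S"
proof -
  have eq: "frechet_derivative f (at x) (g x) = (\<Sum>b\<in>Basis. (g x \<bullet> b) *\<^sub>R frechet_derivative f (at x) b)"
    if "x \<in> S" for x
    by (rule linear_eq_sum_Basis[OF has_derivative_linear[OF smooth_on_has_derivative[OF assms(2) that]]])
  have "smooth_on (\<lambda>x. \<Sum>b\<in>Basis. (g x \<bullet> b) *\<^sub>R frechet_derivative f (at x) b) S"
    by (intro smooth_on_sum assms smooth_on_scaleR smooth_on_derivative
        smooth_on_bounded_linear_compose[OF bounded_linear_inner_left])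
  then show ?thesis using smooth_on_cong[OF assms(1) eq] by simp
qed

text \<open>In the equation Dg = E(g), a g of class k makes the right-hand side of class k, hence g
  of class k + 1. The application is to local inverses, whose derivative is a smooth function of the
  inverse itself.\<close>

lemma smooth_on_bootstrap:
  fixes g :: "'a::real_normed_vector \<Rightarrow> 'b::euclidean_space"
  assumes "open S" "open T" "g ` S \<subseteq> T" "\<And>x. x \<in> S \<Longrightarrow> (g has_derivative (\<lambda>v. E v (g x))) (at x)"
    "\<And>v. smooth_on (E v) T"
  shows "smooth_on g S"
proof -
  have "Ck_on k g S" for k
  proof (induction k)
    case 0
    have "continuous_on S g"
      by (intro continuous_at_imp_continuous_on ballI has_derivative_continuous[OF assms(4)])
    then show ?case by (simp add: Ck_on.simps)
  next
    case (Suc k)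
    have "Ck_on k (\<lambda>x. E v (g x)) S" for v
      using Ck_on_compose[OF assms(1,2,3) Suc, of "E v"] assms(5) by (simp add: smooth_on_def)
    then show ?case
      by (rule Ck_on_SucI[OF assms(1), where f' = "\<lambda>x v. E v (g x)", rotated]) (rule assms(4))
  qed
  then show ?thesis by (simp add: smooth_on_def)
qed

section \<open>The exterior algebra\<close>

text \<open>\<open>contract\<close> is the interior product and \<open>grade_inv\<close> the sign
  (-1)^degree. In these terms the recursion of \<open>wedge\<close> is the antiderivation rule for
  contraction, so identities between forms are proved by induction on the argument list with the
  forms left general. The algebraic laws are those of the signed shuffle product of arbitrary
  functions on lists; alternation is treated separately.\<close>

abbreviation (input) contract :: "'e \<Rightarrow> 'e form \<Rightarrow> 'e form" where
  "contract v \<alpha> \<equiv> (\<lambda>vs. \<alpha> (v # vs))"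

abbreviation (input) grade_inv :: "'e form \<Rightarrow> 'e form" where
  "grade_inv \<alpha> \<equiv> (\<lambda>vs. (-1) ^ length vs * \<alpha> vs)"

definition scalar_form :: "complex \<Rightarrow> 'e form" where
  "scalar_form c vs = (if vs = [] then c else 0)"

definition two_form :: "('e \<Rightarrow> 'e \<Rightarrow> complex) \<Rightarrow> 'e form" where
  "two_form B vs = (if length vs = 2 then B (vs ! 0) (vs ! 1) else 0)"

lemma wedge_add_left: "wedge (\<lambda>us. \<alpha> us + \<beta> us) \<gamma> vs = wedge \<alpha> \<gamma> vs + wedge \<beta> \<gamma> vs"
  by (induction vs arbitrary: \<alpha> \<beta> \<gamma>) (simp_all add: distrib_left distrib_right)

lemma wedge_add_right: "wedge \<alpha> (\<lambda>us. \<beta> us + \<gamma> us) vs = wedge \<alpha> \<beta> vs + wedge \<alpha> \<gamma> vs"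
  by (induction vs arbitrary: \<alpha> \<beta> \<gamma>) (simp_all add: distrib_left)

lemma wedge_scale_left: "wedge (\<lambda>us. c * \<alpha> us) \<beta> vs = c * wedge \<alpha> \<beta> vs"
proof (induction vs arbitrary: \<alpha> \<beta>)
  case (Cons v vs)
  have "wedge (\<lambda>us. (-1) ^ length us * (c * \<alpha> us)) (contract v \<beta>) vs
      = wedge (\<lambda>us. c * ((-1) ^ length us * \<alpha> us)) (contract v \<beta>) vs"
    by (simp only: mult.left_commute)
  then show ?case by (simp add: Cons distrib_left)
qed simp

lemma wedge_scale_right: "wedge \<alpha> (\<lambda>us. c * \<beta> us) vs = c * wedge \<alpha> \<beta> vs"
  by (induction vs arbitrary: \<alpha> \<beta>) (simp_all add: distrib_left)

lemma wedge_divide_right: "wedge \<alpha> (\<lambda>us. \<beta> us / c) vs = wedge \<alpha> \<beta> vs / c"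
  using wedge_scale_right[of \<alpha> "inverse c" \<beta> vs] by (simp add: field_simps)

lemma wedge_zero_left: "wedge (\<lambda>us. 0) \<beta> vs = 0"
  using wedge_scale_left[of 0 "\<lambda>us. 0" \<beta> vs] by simp

lemma wedge_zero_right: "wedge \<alpha> (\<lambda>us. 0) vs = 0"
  using wedge_scale_right[of \<alpha> 0 "\<lambda>us. 0" vs] by simp

lemma wedge_minus_left: "wedge (\<lambda>us. - \<alpha> us) \<beta> vs = - wedge \<alpha> \<beta> vs"
  using wedge_scale_left[of "-1" \<alpha> \<beta> vs] by simp

lemma wedge_minus_right: "wedge \<alpha> (\<lambda>us. - \<beta> us) vs = - wedge \<alpha> \<beta> vs"
  using wedge_scale_right[of \<alpha> "-1" \<beta> vs] by simp

lemma wedge_sum_right: "wedge \<alpha> (\<lambda>us. \<Sum>i\<in>I. \<beta> i us) vs = (\<Sum>i\<in>I. wedge \<alpha> (\<beta> i) vs)"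
  by (induction I rule: infinite_finite_induct) (simp_all add: wedge_add_right wedge_zero_right)

text \<open>Only arguments up to the length of \<open>vs\<close> enter. Identities known up to a
  given degree can thus be used under a wedge, in particular the replacement of
  \<open>form_exp\<close> by a sum with a fixed bound.\<close>

lemma wedge_cong_length:
  assumes "\<And>us. length us \<le> length vs \<Longrightarrow> \<alpha> us = \<alpha>' us" "\<And>us. length us \<le> length vs \<Longrightarrow> \<beta> us = \<beta>' us"
  shows "wedge \<alpha> \<beta> vs = wedge \<alpha>' \<beta>' vs"
  using assms
proof (induction vs arbitrary: \<alpha> \<beta> \<alpha>' \<beta>')
  case (Cons v vs)
  have "wedge (contract v \<alpha>) \<beta> vs = wedge (contract v \<alpha>') \<beta>' vs"
    by (rule Cons.IH) (use Cons.prems in auto)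
  moreover have "wedge (grade_inv \<alpha>) (contract v \<beta>) vs = wedge (grade_inv \<alpha>') (contract v \<beta>') vs"
    by (rule Cons.IH) (use Cons.prems in auto)
  ultimately show ?case by simp
qed simp

lemma grade_inv_grade_inv [simp]: "(-1) ^ n * ((-1) ^ n * (x::complex)) = x"
  by (simp add: mult.assoc[symmetric] power_mult_distrib[symmetric])

text \<open>The sign (-1)^degree is an automorphism of the exterior algebra; in the induction it
  anticommutes with contraction.\<close>

lemma wedge_grade_inv: "wedge (grade_inv \<alpha>) (grade_inv \<beta>) vs = (-1) ^ length vs * wedge \<alpha> \<beta> vs"
proof (induction vs arbitrary: \<alpha> \<beta>)
  case (Cons v vs)
  have "wedge (contract v (grade_inv \<alpha>)) (grade_inv \<beta>) vs = - wedge (grade_inv (contract v \<alpha>)) (grade_inv \<beta>) vs"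
    by (simp add: wedge_minus_left[symmetric])
  moreover have "wedge (grade_inv (grade_inv \<alpha>)) (contract v (grade_inv \<beta>)) vs
      = - wedge (grade_inv (grade_inv \<alpha>)) (grade_inv (contract v \<beta>)) vs"
    by (simp add: wedge_minus_right[symmetric])
  ultimately show ?case
    unfolding wedge.simps Cons by (simp add: distrib_left)
qed simp

text \<open>Contracting either side with the first vector gives the same three terms, with v
  inserted into \<alpha>, \<beta> or \<gamma>. Only the last one involves the sign of a product,
  settled by \<open>wedge_grade_inv\<close>.\<close>

lemma wedge_assoc: "wedge \<alpha> (wedge \<beta> \<gamma>) vs = wedge (wedge \<alpha> \<beta>) \<gamma> vs"
proof (induction vs arbitrary: \<alpha> \<beta> \<gamma>)
  case (Cons v vs)
  have "wedge (wedge (grade_inv \<alpha>) (grade_inv \<beta>)) (contract v \<gamma>) vs = wedge (grade_inv (wedge \<alpha> \<beta>)) (contract v \<gamma>) vs"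
    by (rule wedge_cong_length) (simp_all add: wedge_grade_inv)
  then show ?case
    by (simp add: wedge_add_right wedge_add_left Cons)
qed simp

lemma wedge_scalar_form_left: "wedge (scalar_form c) \<beta> vs = c * \<beta> vs"
proof (induction vs arbitrary: \<beta>)
  case (Cons v vs)
  have "grade_inv (scalar_form c) = (scalar_form c :: 'a form)" "contract v (scalar_form c) = (\<lambda>us. 0)"
    by (auto simp: scalar_form_def)
  then show ?case by (simp add: Cons wedge_zero_left)
qed (simp add: scalar_form_def)

lemma wedge_scalar_form_right: "wedge \<beta> (scalar_form c) vs = \<beta> vs * c"
proof (induction vs arbitrary: \<beta>)
  case (Cons v vs)
  have "contract v (scalar_form c) = (\<lambda>us. 0)"
    by (auto simp: scalar_form_def)
  then show ?case by (simp add: Cons wedge_zero_right)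
qed (simp add: scalar_form_def)

lemma contract_one_form: "contract v (one_form \<xi>) = scalar_form (\<xi> v)"
  by (auto simp: one_form_def scalar_form_def)

lemma grade_inv_one_form: "grade_inv (one_form \<xi>) = (\<lambda>vs. - one_form \<xi> vs)"
  by (auto simp: one_form_def)

lemma contract_two_form: "contract v (two_form B) = one_form (B v)"
  by (rule ext) (auto simp: two_form_def one_form_def length_Suc_conv numeral_2_eq_2)

lemma grade_inv_two_form: "grade_inv (two_form B) = two_form B"
  by (auto simp: two_form_def)

lemma two_form_Nil [simp]: "two_form B [] = 0"
  by (simp add: two_form_def)

lemma one_form_Nil [simp]: "one_form \<xi> [] = 0"
  by (simp add: one_form_def)

text \<open>Graded commutativity is proved for factors of degree 1 and 2, the ones that occur.
  Contraction turns the 1-form into a scalar, which commutes with everything.\<close>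

lemma wedge_one_form_commute: "wedge (one_form \<xi>) \<beta> vs = wedge (grade_inv \<beta>) (one_form \<xi>) vs"
proof (induction vs arbitrary: \<beta>)
  case (Cons v vs)
  have "wedge (contract v (grade_inv \<beta>)) (one_form \<xi>) vs = - wedge (grade_inv (contract v \<beta>)) (one_form \<xi>) vs"
    by (simp add: wedge_minus_left[symmetric])
  then show ?case
    by (simp add: contract_one_form grade_inv_one_form wedge_minus_left wedge_scalar_form_left
        wedge_scalar_form_right Cons del: mult_minus_left)
qed simp

lemma wedge_one_form_one_form: "wedge (one_form \<xi>) (one_form \<xi>) vs = 0"
  using wedge_one_form_commute[of \<xi> "one_form \<xi>" vs]
  by (simp add: grade_inv_one_form wedge_minus_left)

text \<open>Contraction turns the 2-form into a 1-form, and the sign from moving that 1-form across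
  \<beta> is the one in the recursion of \<open>wedge\<close>; hence 2-forms are central.\<close>

lemma wedge_two_form_commute: "wedge (two_form B) \<beta> vs = wedge \<beta> (two_form B) vs"
proof (induction vs arbitrary: \<beta>)
  case (Cons v vs)
  then show ?case
    by (simp add: contract_two_form grade_inv_two_form wedge_one_form_commute del: grade_inv_two_form)
       (simp add: grade_inv_two_form Cons)
qed simp

lemma wedge_two_form_left_commute:
  "wedge (two_form B) (wedge \<alpha> \<beta>) vs = wedge \<alpha> (wedge (two_form B) \<beta>) vs"
proof -
  have "wedge (two_form B) \<alpha> = wedge \<alpha> (two_form B)" by (rule ext) (rule wedge_two_form_commute)
  then show ?thesis by (simp add: wedge_assoc)
qed

section \<open>Powers and exponentials of forms\<close>

lemma wedge_power_length:
  assumes "\<alpha> [] = 0"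
  shows "length vs < k \<Longrightarrow> wedge_power \<alpha> k vs = 0"
proof -
  \<comment> \<open>The factor \<alpha> uses up at least one argument because it has no part of
    degree 0, so effectively \<beta> is evaluated on strictly shorter lists only.\<close>
  have *: "wedge \<alpha> \<beta> vs = 0" if "\<alpha> [] = 0" "\<And>us. length us < length vs \<Longrightarrow> \<beta> us = 0" for \<alpha> \<beta> :: "'a form" and vs
    using that
  proof (induction vs arbitrary: \<alpha> \<beta>)
    case (Cons v vs)
    have "wedge (contract v \<alpha>) \<beta> vs = wedge (contract v \<alpha>) (\<lambda>us. 0) vs"
      by (rule wedge_cong_length) (use Cons.prems in auto)
    moreover have "wedge (grade_inv \<alpha>) (contract v \<beta>) vs = 0"
      by (rule Cons.IH) (use Cons.prems in auto)
    ultimately show ?case by (simp add: wedge_zero_right)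
  qed simp
  show "length vs < k \<Longrightarrow> wedge_power \<alpha> k vs = 0"
  proof (induction k arbitrary: vs)
    case (Suc k)
    have "wedge \<alpha> (wedge_power \<alpha> k) vs = 0"
      by (rule *) (use Suc assms in auto)
    then show ?case by simp
  qed simp
qed

text \<open>The bound in the definition of \<open>form_exp\<close> depends on the argument list. A
  common bound for all lists up to a given length is what allows the sum to be interchanged with
  \<open>wedge\<close> and with differentiation.\<close>

lemma form_exp_sum:
  assumes "\<alpha> [] = 0" "length vs \<le> n"
  shows "form_exp \<alpha> vs = (\<Sum>k\<le>n. wedge_power \<alpha> k vs / fact k)"
proof -
  have "(\<Sum>k\<le>n. wedge_power \<alpha> k vs / fact k) = (\<Sum>k\<le>length vs. wedge_power \<alpha> k vs / fact k)"
    by (rule sum.mono_neutral_right) (use assms wedge_power_length[where \<alpha> = \<alpha> and vs = vs, OF assms(1)] in auto)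
  then show ?thesis by (simp add: form_exp_def)
qed

lemma wedge_form_exp:
  assumes "\<beta> [] = 0" "length vs \<le> n"
  shows "wedge \<alpha> (form_exp \<beta>) vs = (\<Sum>k\<le>n. wedge \<alpha> (wedge_power \<beta> k) vs / fact k)"
proof -
  have "wedge \<alpha> (form_exp \<beta>) vs = wedge \<alpha> (\<lambda>us. \<Sum>k\<le>n. wedge_power \<beta> k us / fact k) vs"
    by (rule wedge_cong_length) (use assms form_exp_sum[of \<beta> _ n] in auto)
  then show ?thesis by (simp add: wedge_sum_right wedge_divide_right)
qed

text \<open>Contraction is a derivation on even forms and 2-forms are central, so \<iota>_v B^(k+1)
  = (k+1) (\<iota>_v B) B^k; the factor k+1 cancels against the factorial in
  \<open>contract_form_exp\<close>.\<close>

lemma contract_wedge_power: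
  "wedge_power (two_form B) (Suc k) (v # vs) = of_nat (Suc k) * wedge (one_form (B v)) (wedge_power (two_form B) k) vs"
proof (induction k arbitrary: vs)
  case 0
  have "(\<lambda>vs. if vs = [] then 1 else 0) = (scalar_form 1 :: 'a form)" by (simp add: scalar_form_def fun_eq_iff)
  then show ?case
    by (simp add: wedge_scalar_form_right contract_two_form[unfolded fun_eq_iff])
       (simp add: scalar_form_def wedge_zero_right)
next
  case (Suc k)
  let ?E = "wedge_power (two_form B) k"
  have "wedge (two_form B) (contract v (wedge_power (two_form B) (Suc k))) vs
     = wedge (two_form B) (\<lambda>us. of_nat (Suc k) * wedge (one_form (B v)) ?E us) vs"
    by (rule wedge_cong_length) (simp_all only: Suc)
  also have "\<dots> = of_nat (Suc k) * wedge (one_form (B v)) (wedge_power (two_form B) (Suc k)) vs"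
    by (simp only: wedge_scale_right wedge_two_form_left_commute wedge_power.simps)
  finally show ?case
    unfolding wedge_power.simps(2)[of _ "Suc k"] wedge.simps contract_two_form grade_inv_two_form
    by (simp add: distrib_right del: wedge_power.simps)
qed

lemma contract_form_exp: "form_exp (two_form B) (v # vs) = wedge (one_form (B v)) (form_exp (two_form B)) vs"
proof -
  have "form_exp (two_form B) (v # vs) = (\<Sum>k\<le>length vs. wedge_power (two_form B) (Suc k) (v # vs) / fact (Suc k))"
    unfolding form_exp_def length_Cons by (subst sum.atMost_Suc_shift) simp
  also have "\<dots> = (\<Sum>k\<le>length vs. wedge (one_form (B v)) (wedge_power (two_form B) k) vs / fact k)"
  proof (rule sum.cong[OF refl])
    fix k
    have "of_nat (Suc k) * (x::complex) / fact (Suc k) = x / fact k" for x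
      unfolding fact_Suc using of_nat_neq_0[of k, where ?'a = complex] by (simp del: of_nat_Suc)
    then show "wedge_power (two_form B) (Suc k) (v # vs) / fact (Suc k) = wedge (one_form (B v)) (wedge_power (two_form B) k) vs / fact k"
      unfolding contract_wedge_power by blast
  qed
  finally show ?thesis by (simp add: wedge_form_exp[where n = "length vs"])
qed

lemma form_exp_Nil [simp]: "form_exp \<alpha> [] = 1"
  by (simp add: form_exp_def)

text \<open>The exponential of a 2-form lives in even degrees; hence it commutes with 1-forms and
  contributes no sign to the Leibniz rule.\<close>

lemma grade_inv_form_exp: "grade_inv (form_exp (two_form B)) = form_exp (two_form B)"
proof -
  have "grade_inv (wedge_power (two_form B) k) = wedge_power (two_form B) k" for k
  proof (induction k)
    case (Suc k)
    then show ?case by (simp add: wedge_grade_inv[symmetric] grade_inv_two_form)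
  qed auto
  then have "(-1) ^ length vs * (wedge_power (two_form B) k vs / fact k) = wedge_power (two_form B) k vs / fact k" for k vs
    by (metis times_divide_eq_right)
  then show ?thesis
    by (intro ext) (simp only: form_exp_def sum_distrib_left)
qed

lemma wedge_form_exp_one_form_commute:
  "wedge (form_exp (two_form B)) (one_form \<xi>) vs = wedge (one_form \<xi>) (form_exp (two_form B)) vs"
  by (simp add: wedge_one_form_commute[of \<xi>] grade_inv_form_exp)

section \<open>Multilinearity and alternation of wedge products\<close>

lemma alt_form_contract:
  assumes "alt_form \<alpha>"
  shows "alt_form (contract v \<alpha>)"
proof -
  have "linear (\<lambda>x. \<alpha> ((v # us) @ x # vs))" for us vs using assms unfolding alt_form_def by blast
  then show ?thesis using assms by (simp add: alt_form_def)
qed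

lemma linear_complex_scale: "linear f \<Longrightarrow> linear (\<lambda>x. c * (f x :: complex))"
  using linear_compose[of f "(*) c"] by (simp add: o_def linear_iff distrib_left)

lemma alt_form_scale: "alt_form \<alpha> \<Longrightarrow> alt_form (\<lambda>vs. c * \<alpha> vs)"
  unfolding alt_form_def by (auto intro: linear_complex_scale)

lemma alt_form_grade_inv:
  assumes "alt_form \<alpha>"
  shows "alt_form (grade_inv \<alpha>)"
proof -
  have "linear (\<lambda>x. grade_inv \<alpha> (us @ x # vs))" for us vs
    using linear_complex_scale[of "\<lambda>x. \<alpha> (us @ x # vs)" "- ((-1) ^ (length us + length vs))"] assms
    by (simp add: alt_form_def)
  then show ?thesis using assms by (simp add: alt_form_def)
qed

lemma alt_form_sum: "(\<And>i. i \<in> I \<Longrightarrow> alt_form (\<alpha> i)) \<Longrightarrow> alt_form (\<lambda>vs. \<Sum>i\<in>I. \<alpha> i vs)"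
  unfolding alt_form_def by (auto intro: linear_compose_sum)

lemma linear_wedge:
  assumes "\<And>us. linear (\<lambda>x. \<alpha> x us)"
  shows "linear (\<lambda>x. wedge (\<alpha> x) \<beta> vs)" "linear (\<lambda>x. wedge \<beta> (\<alpha> x) vs)"
  using assms
proof (induction vs arbitrary: \<alpha> \<beta>)
  case Nil
  { case 1 then show ?case using linear_complex_scale[of "\<lambda>x. \<alpha> x []" "\<beta> []"] by (simp add: mult.commute) }
  { case 2 then show ?case using linear_complex_scale[of "\<lambda>x. \<alpha> x []" "\<beta> []"] by simp }
next
  case (Cons v vs)
  { case 1 then show ?case
      using Cons(1)[of "\<lambda>x. contract v (\<alpha> x)" \<beta>] Cons(1)[of "\<lambda>x. grade_inv (\<alpha> x)" "contract v \<beta>"]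
      by (simp add: linear_compose_add linear_complex_scale) }
  { case 2 then show ?case
      using Cons(2)[of "\<alpha>" "contract v \<beta>"] Cons(2)[of "\<lambda>x. contract v (\<alpha> x)" "grade_inv \<beta>"]
      by (simp add: linear_compose_add) }
qed

lemma alt_form_linear_hd:
  assumes "alt_form \<alpha>"
  shows "linear (\<lambda>x. \<alpha> (x # vs))"
proof -
  have "linear (\<lambda>x. \<alpha> ([] @ x # vs))" using assms unfolding alt_form_def by blast
  then show ?thesis by simp
qed

lemma alt_form_hd_eq: "alt_form \<alpha> \<Longrightarrow> \<alpha> (v # v # vs) = 0"
  unfolding alt_form_def by simp

lemma linear_wedge_slot:
  assumes "alt_form \<alpha>" "alt_form \<beta>"
  shows "linear (\<lambda>x. wedge \<alpha> \<beta> (us @ x # vs))"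
  using assms
proof (induction us arbitrary: \<alpha> \<beta>)
  case Nil
  then show ?case
    by (simp, intro linear_compose_add linear_wedge) (auto intro: alt_form_linear_hd)
next
  case (Cons u us)
  then show ?case
    using Cons.IH[of "contract u \<alpha>" \<beta>] Cons.IH[of "grade_inv \<alpha>" "contract u \<beta>"]
    by (simp add: linear_compose_add alt_form_contract alt_form_grade_inv)
qed

text \<open>Of the four terms of the double recursion two vanish because \<alpha> and \<beta>
  alternate, and the two mixed ones differ by the sign of \<open>grade_inv\<close>.\<close>

lemma wedge_hd_eq:
  assumes "alt_form \<alpha>" "alt_form \<beta>"
  shows "wedge \<alpha> \<beta> (v # v # vs) = 0"
proof -
  have "wedge (\<lambda>us. (-1) ^ length (v # us) * \<alpha> (v # us)) (contract v \<beta>) vs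
    = - wedge (\<lambda>us. (-1) ^ length us * \<alpha> (v # us)) (contract v \<beta>) vs"
    by (simp add: wedge_minus_left[symmetric])
  then show ?thesis
    using alt_form_hd_eq[OF assms(1), of v] alt_form_hd_eq[OF assms(2), of v]
    by (simp add: wedge_zero_left wedge_zero_right del: length_Cons)
qed

text \<open>Alternation is hidden in the recursion, which treats the first argument specially. Equal
  first two arguments are covered by \<open>wedge_hd_eq\<close>; polarisation then makes the first
  two slots antisymmetric, so that a repetition of the first argument can be moved into the
  tail.\<close>

lemma wedge_not_distinct:
  assumes "alt_form \<alpha>" "alt_form \<beta>" "\<not> distinct vs"
  shows "wedge \<alpha> \<beta> vs = 0"
  using assms
proof (induction "length vs" arbitrary: vs \<alpha> \<beta>)
  case (Suc n)
  have step: "wedge \<alpha> \<beta> (u # us) = 0" if "\<not> distinct us" "length us = n" for u us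
    using that Suc.hyps(1)[of us "contract u \<alpha>" \<beta>] Suc.hyps(1)[of us "grade_inv \<alpha>" "contract u \<beta>"] Suc.prems
    by (simp add: alt_form_contract alt_form_grade_inv)
  obtain v ws where vs: "vs = v # ws" "length ws = n" using Suc.hyps(2) by (cases vs) auto
  show ?case
  proof (cases "distinct ws")
    case False
    then show ?thesis using step vs by simp
  next
    case True
    then have "v \<in> set ws" using Suc.prems vs by simp
    then obtain w us where ws: "ws = w # us" by (cases ws) auto
    show ?thesis
    proof (cases "v = w")
      case True
      then show ?thesis using wedge_hd_eq Suc.prems vs ws by simp
    next
      case False
      let ?W = "wedge \<alpha> \<beta>"
      have l1: "?W ((x + y) # zs) = ?W (x # zs) + ?W (y # zs)" for x y zs
        using linear_add[OF linear_wedge_slot[OF Suc.prems(1,2), of "[]"]] by simp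
      have l2: "?W (u # (x + y) # zs) = ?W (u # x # zs) + ?W (u # y # zs)" for u x y zs
        using linear_add[OF linear_wedge_slot[OF Suc.prems(1,2), of "[u]"]] by simp
      have "?W ((v + w) # (v + w) # us) = 0" "?W (v # v # us) = 0" "?W (w # w # us) = 0"
        using Suc.prems by (simp_all only: wedge_hd_eq)
      then have "?W (v # w # us) = - ?W (w # v # us)"
        unfolding l1 l2 by (simp only: add_0_left add_0_right eq_neg_iff_add_eq_0 add.commute)
      \<comment> \<open>After the swap v heads the tail and, being different from w, occurs again in
        \<open>us\<close>, so the tail itself has a repetition.\<close>
      moreover have "?W (w # v # us) = 0"
        by (rule step) (use \<open>v \<in> set ws\<close> False ws vs in auto)
      ultimately show ?thesis by (simp add: vs ws del: wedge.simps)
    qed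
  qed
qed simp

lemma alt_form_wedge: "alt_form \<alpha> \<Longrightarrow> alt_form \<beta> \<Longrightarrow> alt_form (wedge \<alpha> \<beta>)"
  using linear_wedge_slot wedge_not_distinct unfolding alt_form_def[of "wedge \<alpha> \<beta>"] by blast

lemma alt_form_scalar_form: "alt_form (scalar_form c)"
  unfolding alt_form_def scalar_form_def by (auto simp: linear_iff)

lemma alt_form_one_form:
  assumes "linear \<xi>"
  shows "alt_form (one_form \<xi>)"
proof -
  have "linear (\<lambda>x. one_form \<xi> (us @ x # vs))" for us vs
    using assms by (cases "us @ vs") (auto simp: one_form_def linear_iff)
  moreover have "one_form \<xi> vs = 0" if "\<not> distinct vs" for vs
    using that by (cases vs) (auto simp: one_form_def)
  ultimately show ?thesis by (simp add: alt_form_def)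
qed

lemma alt_form_two_form:
  assumes "\<And>u. linear (B u)" "\<And>v. linear (\<lambda>u. B u v)" "\<And>v. B v v = 0"
  shows "alt_form (two_form B)"
proof -
  have 1: "linear (\<lambda>x. two_form B (us @ x # vs))" for us vs
  proof -
    consider w where "us = []" "vs = [w]" | w where "us = [w]" "vs = []" | "length (us @ vs) \<noteq> 1"
      by (cases us; cases vs) (auto simp: length_Suc_conv)
    then show ?thesis
      by cases (auto simp: two_form_def assms linear_zero)
  qed
  have "two_form B vs = 0" if "\<not> distinct vs" for vs
    using that assms(3) by (auto simp: two_form_def length_Suc_conv numeral_2_eq_2)
  with 1 show ?thesis by (simp add: alt_form_def)
qed

lemma alt_form_form_exp:
  assumes "alt_form \<alpha>" "\<alpha> [] = 0"
  shows "alt_form (form_exp \<alpha>)"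
proof -
  have pow: "alt_form (wedge_power \<alpha> k)" for k
    by (induction k) (auto intro: alt_form_wedge assms simp: alt_form_scalar_form[unfolded scalar_form_def[abs_def]])
  have "linear (\<lambda>x. form_exp \<alpha> (us @ x # vs))" for us vs
  proof -
    \<comment> \<open>All lists \<open>us @ x # vs\<close> have the same length, so on them
      \<open>form_exp\<close> is this fixed linear combination of powers.\<close>
    have "alt_form (\<lambda>ws. \<Sum>k\<le>length us + length vs + 1. inverse (fact k) * wedge_power \<alpha> k ws)"
      by (intro alt_form_sum alt_form_scale pow)
    then show ?thesis
      unfolding alt_form_def form_exp_def by (simp add: field_simps)
  qed
  moreover have "form_exp \<alpha> vs = 0" if "\<not> distinct vs" for vs
    using pow that unfolding alt_form_def form_exp_def by simp
  ultimately show ?thesis by (simp add: alt_form_def)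
qed

section \<open>The exterior derivative in coordinates\<close>

abbreviation (input) form_differentiable :: "('e::real_normed_vector \<Rightarrow> 'e form) \<Rightarrow> 'e \<Rightarrow> bool" where
  "form_differentiable \<alpha> x \<equiv> (\<forall>vs. (\<lambda>y. \<alpha> y vs) differentiable (at x))"

definition form_deriv :: "('e::real_normed_vector \<Rightarrow> 'e form) \<Rightarrow> 'e \<Rightarrow> 'e \<Rightarrow> 'e form" where
  "form_deriv \<alpha> x v vs = frechet_derivative (\<lambda>y. \<alpha> y vs) (at x) v"

lemma form_deriv_unique: "((\<lambda>y. \<alpha> y vs) has_derivative D) (at x) \<Longrightarrow> form_deriv \<alpha> x v vs = D v"
  using frechet_derivative_at unfolding form_deriv_def by metis

lemma form_deriv_works:
  "form_differentiable \<alpha> x \<Longrightarrow> ((\<lambda>y. \<alpha> y vs) has_derivative (\<lambda>v. form_deriv \<alpha> x v vs)) (at x)"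
  unfolding form_deriv_def by (simp add: frechet_derivative_works[symmetric] cong: if_cong)

lemma flat_ext_deriv_Nil [simp]: "flat_ext_deriv \<alpha> x [] = 0"
  by (simp add: flat_ext_deriv_def)

text \<open>Cartan's formula for the constant vector field v: contracting d\<alpha> with v gives the
  Lie derivative, here a directional derivative, minus d of the contraction. It puts d into the same
  list recursion as \<open>wedge\<close>.\<close>

lemma flat_ext_deriv_Cons:
  "flat_ext_deriv \<alpha> x (v # vs) = form_deriv \<alpha> x v vs - flat_ext_deriv (\<lambda>y. contract v (\<alpha> y)) x vs"
  unfolding flat_ext_deriv_def form_deriv_def
  by (simp add: sum.lessThan_Suc_shift sum_negf del: sum.lessThan_Suc)

lemma flat_ext_deriv_add:
  assumes "form_differentiable \<alpha> x" "form_differentiable \<beta> x"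
  shows "flat_ext_deriv (\<lambda>y vs. \<alpha> y vs + \<beta> y vs) x vs = flat_ext_deriv \<alpha> x vs + flat_ext_deriv \<beta> x vs"
  using assms
proof (induction vs arbitrary: \<alpha> \<beta>)
  case (Cons v vs)
  have "form_deriv (\<lambda>y vs. \<alpha> y vs + \<beta> y vs) x v vs = form_deriv \<alpha> x v vs + form_deriv \<beta> x v vs"
    by (rule form_deriv_unique) (intro has_derivative_add form_deriv_works Cons.prems)
  moreover have "flat_ext_deriv (\<lambda>y us. \<alpha> y (v # us) + \<beta> y (v # us)) x vs
      = flat_ext_deriv (\<lambda>y. contract v (\<alpha> y)) x vs + flat_ext_deriv (\<lambda>y. contract v (\<beta> y)) x vs"
    by (rule Cons.IH) (use Cons.prems in auto)
  ultimately show ?case by (simp add: flat_ext_deriv_Cons)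
qed simp

lemma flat_ext_deriv_scale:
  assumes "form_differentiable \<alpha> x"
  shows "flat_ext_deriv (\<lambda>y vs. c * \<alpha> y vs) x vs = c * flat_ext_deriv \<alpha> x vs"
  using assms
proof (induction vs arbitrary: \<alpha>)
  case (Cons v vs)
  have "form_deriv (\<lambda>y vs. c * \<alpha> y vs) x v vs = c * form_deriv \<alpha> x v vs"
    by (rule form_deriv_unique) (intro has_derivative_mult_right form_deriv_works Cons.prems)
  moreover have "flat_ext_deriv (\<lambda>y us. c * \<alpha> y (v # us)) x vs = c * flat_ext_deriv (\<lambda>y. contract v (\<alpha> y)) x vs"
    by (rule Cons.IH) (use Cons.prems in auto)
  ultimately show ?case by (simp add: flat_ext_deriv_Cons algebra_simps)
qed simp

lemma flat_ext_deriv_minus: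
  "form_differentiable \<alpha> x \<Longrightarrow> flat_ext_deriv (\<lambda>y vs. - \<alpha> y vs) x vs = - flat_ext_deriv \<alpha> x vs"
  using flat_ext_deriv_scale[of \<alpha> x "-1"] by simp

lemma flat_ext_deriv_sum:
  assumes "\<And>i. i \<in> I \<Longrightarrow> form_differentiable (\<alpha> i) x" "finite I"
  shows "flat_ext_deriv (\<lambda>y vs. \<Sum>i\<in>I. \<alpha> i y vs) x vs = (\<Sum>i\<in>I. flat_ext_deriv (\<alpha> i) x vs)"
  using assms(2,1)
proof (induction I rule: finite_induct)
  case empty
  have "flat_ext_deriv (\<lambda>y vs. 0 * 0) x vs = 0 * flat_ext_deriv (\<lambda>y vs. 0) x vs"
    by (rule flat_ext_deriv_scale) simp
  then show ?case by simp
next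
  case (insert i I)
  then show ?case by (simp add: flat_ext_deriv_add)
qed

lemma differentiable_complex_scale:
  "f differentiable (at x) \<Longrightarrow> (\<lambda>y. c * (f y :: complex)) differentiable (at x)"
  unfolding differentiable_def using has_derivative_mult_right by blast

text \<open>Since d raises the degree by one, it anticommutes with the sign (-1)^degree.\<close>

lemma flat_ext_deriv_grade_inv:
  assumes "form_differentiable \<alpha> x"
  shows "flat_ext_deriv (\<lambda>y. grade_inv (\<alpha> y)) x vs = - ((-1) ^ length vs * flat_ext_deriv \<alpha> x vs)"
  using assms
proof (induction vs arbitrary: \<alpha>)
  case (Cons v vs)
  have "form_deriv (\<lambda>y. grade_inv (\<alpha> y)) x v vs = (-1) ^ length vs * form_deriv \<alpha> x v vs"
    by (rule form_deriv_unique) (intro has_derivative_mult_right form_deriv_works Cons.prems)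
  moreover have "flat_ext_deriv (\<lambda>y. contract v (grade_inv (\<alpha> y))) x vs
      = - flat_ext_deriv (\<lambda>y. grade_inv (contract v (\<alpha> y))) x vs"
    using flat_ext_deriv_minus[of "\<lambda>y. grade_inv (contract v (\<alpha> y))" x vs] Cons.prems
    by (simp add: differentiable_complex_scale)
  moreover have "flat_ext_deriv (\<lambda>y. grade_inv (contract v (\<alpha> y))) x vs
      = - ((-1) ^ length vs * flat_ext_deriv (\<lambda>y. contract v (\<alpha> y)) x vs)"
    by (rule Cons.IH) (use Cons.prems in auto)
  ultimately show ?case
    unfolding flat_ext_deriv_Cons by (simp add: algebra_simps)
qed simp

lemma has_derivative_wedge:
  assumes "form_differentiable \<alpha> x" "form_differentiable \<beta> x"
  shows "((\<lambda>y. wedge (\<alpha> y) (\<beta> y) vs) has_derivative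
    (\<lambda>v. wedge (form_deriv \<alpha> x v) (\<beta> x) vs + wedge (\<alpha> x) (form_deriv \<beta> x v) vs)) (at x)"
  using assms
proof (induction vs arbitrary: \<alpha> \<beta>)
  case Nil
  have "((\<lambda>y. \<alpha> y [] * \<beta> y []) has_derivative
    (\<lambda>v. \<alpha> x [] * form_deriv \<beta> x v [] + form_deriv \<alpha> x v [] * \<beta> x [])) (at x)"
    by (intro has_derivative_mult form_deriv_works Nil)
  then show ?case by (simp add: add.commute)
next
  case (Cons u us)
  have c: "form_deriv (\<lambda>y. contract u (\<alpha> y)) x v = contract u (form_deriv \<alpha> x v)" for \<alpha> :: "'a \<Rightarrow> 'a form" and v
    by (simp add: form_deriv_def fun_eq_iff)
  have g: "form_deriv (\<lambda>y. grade_inv (\<alpha> y)) x v = grade_inv (form_deriv \<alpha> x v)" for v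
    by (intro ext form_deriv_unique has_derivative_mult_right form_deriv_works Cons.prems)
  have 1: "((\<lambda>y. wedge (contract u (\<alpha> y)) (\<beta> y) us) has_derivative
    (\<lambda>v. wedge (form_deriv (\<lambda>y. contract u (\<alpha> y)) x v) (\<beta> x) us + wedge (contract u (\<alpha> x)) (form_deriv \<beta> x v) us)) (at x)"
    by (rule Cons.IH) (use Cons.prems in auto)
  have 2: "((\<lambda>y. wedge (grade_inv (\<alpha> y)) (contract u (\<beta> y)) us) has_derivative
    (\<lambda>v. wedge (form_deriv (\<lambda>y. grade_inv (\<alpha> y)) x v) (contract u (\<beta> x)) us
      + wedge (grade_inv (\<alpha> x)) (form_deriv (\<lambda>y. contract u (\<beta> y)) x v) us)) (at x)"
    by (rule Cons.IH) (use Cons.prems in \<open>auto intro: differentiable_complex_scale\<close>)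
  show ?case
    unfolding wedge.simps
    by (rule has_derivative_eq_rhs[OF has_derivative_add[OF 1 2]]) (simp add: c g fun_eq_iff)
qed

lemma form_differentiable_wedge:
  "form_differentiable \<alpha> x \<Longrightarrow> form_differentiable \<beta> x \<Longrightarrow> form_differentiable (\<lambda>y. wedge (\<alpha> y) (\<beta> y)) x"
  using has_derivative_wedge unfolding differentiable_def by blast

lemma form_deriv_wedge:
  assumes "form_differentiable \<alpha> x" "form_differentiable \<beta> x"
  shows "form_deriv (\<lambda>y. wedge (\<alpha> y) (\<beta> y)) x v vs
    = wedge (form_deriv \<alpha> x v) (\<beta> x) vs + wedge (\<alpha> x) (form_deriv \<beta> x v) vs"
  by (rule form_deriv_unique[OF has_derivative_wedge[OF assms]])

text \<open>Under the recursions for d and \<open>wedge\<close> the derivative terms are the product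
  rule \<open>form_deriv_wedge\<close>, and the rest is the induction hypothesis for the contracted
  forms. All signs come from \<open>grade_inv\<close> anticommuting with contraction and with
  d.\<close>

lemma flat_ext_deriv_wedge:
  assumes "form_differentiable \<alpha> x" "form_differentiable \<beta> x"
  shows "flat_ext_deriv (\<lambda>y. wedge (\<alpha> y) (\<beta> y)) x vs
    = wedge (flat_ext_deriv \<alpha> x) (\<beta> x) vs + wedge (grade_inv (\<alpha> x)) (flat_ext_deriv \<beta> x) vs"
  using assms
proof (induction vs arbitrary: \<alpha> \<beta>)
  case (Cons v vs)
  have dc: "form_differentiable (\<lambda>y. contract v (\<alpha> y)) x" "form_differentiable (\<lambda>y. contract v (\<beta> y)) x"
    "form_differentiable (\<lambda>y. grade_inv (\<alpha> y)) x"
    using Cons.prems by (auto intro: differentiable_complex_scale)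
  have Cf: "contract v (flat_ext_deriv \<gamma> x) = (\<lambda>us. form_deriv \<gamma> x v us - flat_ext_deriv (\<lambda>y. contract v (\<gamma> y)) x us)" for \<gamma>
    by (simp add: flat_ext_deriv_Cons)
  have neg: "contract v (grade_inv \<gamma>) = (\<lambda>us. - grade_inv (contract v \<gamma>) us)" for \<gamma> :: "'a form"
    by simp
  have diff_l: "wedge (\<lambda>us. a us - b us) c vs = wedge a c vs - wedge b c vs" for a b c :: "'a form"
    using wedge_add_left[of a "\<lambda>us. - b us" c vs] wedge_minus_left[of b c vs] by simp
  have diff_r: "wedge c (\<lambda>us. a us - b us) vs = wedge c a vs - wedge c b vs" for a b c :: "'a form"
    using wedge_add_right[of c a "\<lambda>us. - b us" vs] wedge_minus_right[of c b vs] by simp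
  have gg: "grade_inv (grade_inv \<gamma>) = \<gamma>" for \<gamma> :: "'a form" by simp
  have gf: "(\<lambda>us. flat_ext_deriv (\<lambda>y. grade_inv (\<alpha> y)) x us) = (\<lambda>us. - grade_inv (flat_ext_deriv \<alpha> x) us)"
    using flat_ext_deriv_grade_inv[OF Cons.prems(1)] by simp
  have "flat_ext_deriv (\<lambda>y. contract v (wedge (\<alpha> y) (\<beta> y))) x vs
     = flat_ext_deriv (\<lambda>y. wedge (contract v (\<alpha> y)) (\<beta> y)) x vs
      + flat_ext_deriv (\<lambda>y. wedge (grade_inv (\<alpha> y)) (contract v (\<beta> y))) x vs"
    unfolding wedge.simps
    by (rule flat_ext_deriv_add) (intro form_differentiable_wedge dc Cons.prems)+
  also have "\<dots> = wedge (flat_ext_deriv (\<lambda>y. contract v (\<alpha> y)) x) (\<beta> x) vs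
      + wedge (grade_inv (contract v (\<alpha> x))) (flat_ext_deriv \<beta> x) vs
      + (wedge (flat_ext_deriv (\<lambda>y. grade_inv (\<alpha> y)) x) (contract v (\<beta> x)) vs
        + wedge (grade_inv (grade_inv (\<alpha> x))) (flat_ext_deriv (\<lambda>y. contract v (\<beta> y)) x) vs)"
    by (intro arg_cong2[where f = "(+)"] Cons.IH dc Cons.prems)
  finally show ?case
    unfolding flat_ext_deriv_Cons[of "\<lambda>y. wedge (\<alpha> y) (\<beta> y)"] form_deriv_wedge[OF Cons.prems]
      wedge.simps Cf neg gg diff_l diff_r gf wedge_minus_left
    by simp
qed simp

lemma form_differentiable_wedge_power:
  "form_differentiable \<alpha> x \<Longrightarrow> form_differentiable (\<lambda>y. wedge_power (\<alpha> y) k) x"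
proof (induction k)
  case (Suc k)
  then show ?case unfolding wedge_power.simps by (intro form_differentiable_wedge)
qed simp

lemma form_differentiable_form_exp:
  assumes "form_differentiable \<alpha> x"
  shows "form_differentiable (\<lambda>y. form_exp (\<alpha> y)) x"
  unfolding form_exp_def
  using form_differentiable_wedge_power[OF assms]
  by (auto intro!: differentiable_sum differentiable_divide)

lemma flat_ext_deriv_wedge_power:
  assumes "form_differentiable (\<lambda>y. two_form (B y)) x"
  shows "flat_ext_deriv (\<lambda>y. wedge_power (two_form (B y)) (Suc k)) x vs
    = of_nat (Suc k) * wedge (flat_ext_deriv (\<lambda>y. two_form (B y)) x) (wedge_power (two_form (B x)) k) vs"
proof (induction k arbitrary: vs)
  case 0
  have sc: "wedge_power \<alpha> 0 = scalar_form 1" for \<alpha> :: "'a form" by (simp add: scalar_form_def fun_eq_iff)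
  have "wedge_power (two_form (B y)) (Suc 0) = two_form (B y)" for y
    unfolding wedge_power.simps(2) sc by (simp add: wedge_scalar_form_right fun_eq_iff)
  then show ?case by (simp only: sc wedge_scalar_form_right) simp
next
  case (Suc k)
  let ?a = "two_form (B x)" and ?da = "flat_ext_deriv (\<lambda>y. two_form (B y)) x"
  have "flat_ext_deriv (\<lambda>y. wedge_power (two_form (B y)) (Suc (Suc k))) x vs
     = wedge ?da (wedge_power ?a (Suc k)) vs
       + wedge (grade_inv ?a) (flat_ext_deriv (\<lambda>y. wedge_power (two_form (B y)) (Suc k)) x) vs"
    unfolding wedge_power.simps(2)[of _ "Suc k"]
    by (rule flat_ext_deriv_wedge[OF assms form_differentiable_wedge_power[OF assms]])
  also have "wedge (grade_inv ?a) (flat_ext_deriv (\<lambda>y. wedge_power (two_form (B y)) (Suc k)) x) vs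
     = wedge ?a (\<lambda>us. of_nat (Suc k) * wedge ?da (wedge_power ?a k) us) vs"
    unfolding grade_inv_two_form by (rule wedge_cong_length) (simp_all only: Suc)
  also have "\<dots> = of_nat (Suc k) * wedge ?da (wedge_power ?a (Suc k)) vs"
    by (simp only: wedge_scale_right wedge_two_form_left_commute wedge_power.simps)
  finally show ?case
    by (simp add: distrib_right del: wedge_power.simps)
qed

lemma flat_ext_deriv_form_exp:
  assumes "form_differentiable (\<lambda>y. two_form (B y)) x"
  shows "flat_ext_deriv (\<lambda>y. form_exp (two_form (B y))) x vs
    = wedge (flat_ext_deriv (\<lambda>y. two_form (B y)) x) (form_exp (two_form (B x))) vs"
proof -
  let ?a = "\<lambda>y. two_form (B y)" and ?n = "length vs"
  \<comment> \<open>The bound \<open>Suc ?n\<close> exceeds every length that occurs. Once the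
    constant power 0 drops out and the index is shifted, the sum ends at \<open>?n\<close>, as
    \<open>wedge_form_exp\<close> requires.\<close>
  have "flat_ext_deriv (\<lambda>y. form_exp (?a y)) x vs = flat_ext_deriv (\<lambda>y us. \<Sum>k\<le>Suc ?n. inverse (fact k) * wedge_power (?a y) k us) x vs"
    unfolding flat_ext_deriv_def
    by (intro sum.cong arg_cong2[where f = "(*)"] refl arg_cong[where f = "\<lambda>f. frechet_derivative f (at x) w" for w] ext)
       (subst form_exp_sum[where n = "Suc ?n"], auto simp: field_simps)
  also have "\<dots> = (\<Sum>k\<le>Suc ?n. inverse (fact k) * flat_ext_deriv (\<lambda>y. wedge_power (?a y) k) x vs)"
    using form_differentiable_wedge_power[OF assms]
    by (simp add: flat_ext_deriv_sum flat_ext_deriv_scale differentiable_complex_scale del: sum.atMost_Suc)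
  also have "\<dots> = (\<Sum>k\<le>?n. inverse (fact (Suc k)) * flat_ext_deriv (\<lambda>y. wedge_power (?a y) (Suc k)) x vs)"
  proof -
    have "flat_ext_deriv (\<lambda>y. wedge_power (?a y) 0) x vs = 0" by (simp add: flat_ext_deriv_def)
    then show ?thesis by (subst sum.atMost_Suc_shift) simp
  qed
  also have "\<dots> = (\<Sum>k\<le>?n. wedge (flat_ext_deriv ?a x) (wedge_power (?a x) k) vs / fact k)"
  proof (rule sum.cong[OF refl])
    fix k
    have "inverse (fact (Suc k)) * (of_nat (Suc k) * (z::complex)) = z / fact k" for z
      unfolding fact_Suc using of_nat_neq_0[of k, where ?'a = complex] by (simp add: field_simps del: of_nat_Suc)
    then show "inverse (fact (Suc k)) * flat_ext_deriv (\<lambda>y. wedge_power (?a y) (Suc k)) x vs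
        = wedge (flat_ext_deriv ?a x) (wedge_power (?a x) k) vs / fact k"
      unfolding flat_ext_deriv_wedge_power[OF assms] by blast
  qed
  finally show ?thesis by (simp add: wedge_form_exp[where n = ?n])
qed

section \<open>Pure spinors of the form \<open>exp(B) \<and> \<theta>\<close>\<close>

lemma wedge_form_exp_one_form_singleton:
  "wedge (form_exp (two_form B)) (one_form \<theta>) [x] = \<theta> x"
  by (simp add: wedge_form_exp_one_form_commute contract_one_form[unfolded fun_eq_iff] scalar_form_def)

lemma wedge_one_form_form_exp_self:
  "wedge (one_form \<theta>) (wedge (form_exp (two_form B)) (one_form \<theta>)) vs = 0"
proof -
  have "wedge (form_exp (two_form B)) (one_form \<theta>) = wedge (one_form \<theta>) (form_exp (two_form B))"
    by (rule ext) (rule wedge_form_exp_one_form_commute)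
  moreover have "wedge (one_form \<theta>) (one_form \<theta>) = (\<lambda>vs. 0)"
    by (rule ext) (rule wedge_one_form_one_form)
  ultimately show ?thesis by (simp add: wedge_assoc wedge_zero_left)
qed

text \<open>Wedging with exp(B) turns the action of (Y, \<xi>) into that of (Y, \<xi> + \<iota>_Y
  B): this is the B-field transform. The last term is the contraction of \<theta> itself.\<close>

lemma clifford_exp_spinor:
  "clifford ((u, v), \<xi>) (wedge (form_exp (two_form B)) (one_form \<theta>)) vs
    = wedge (one_form (\<lambda>x. \<xi> x + B u x + \<i> * B v x)) (wedge (form_exp (two_form B)) (one_form \<theta>)) vs
      + (\<theta> u + \<i> * \<theta> v) * form_exp (two_form B) vs"
proof -
  let ?E = "form_exp (two_form B)"
  let ?R = "wedge ?E (one_form \<theta>)"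
  have c: "?R (w # vs) = wedge (one_form (B w)) ?R vs + \<theta> w * ?E vs" for w
  proof -
    have "contract w ?E = wedge (one_form (B w)) ?E" by (rule ext) (rule contract_form_exp)
    then show ?thesis
      unfolding wedge.simps grade_inv_form_exp contract_one_form
      by (simp add: wedge_scalar_form_right wedge_assoc)
  qed
  have "(one_form (\<lambda>x. \<xi> x + B u x + \<i> * B v x)) = (\<lambda>vs. (one_form \<xi> vs + one_form (B u) vs) + \<i> * one_form (B v) vs)"
    by (auto simp: one_form_def fun_eq_iff)
  then have "wedge (one_form (\<lambda>x. \<xi> x + B u x + \<i> * B v x)) ?R vs
      = wedge (one_form \<xi>) ?R vs + wedge (one_form (B u)) ?R vs + \<i> * wedge (one_form (B v)) ?R vs"
    by (simp add: wedge_add_left wedge_scale_left)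
  then show ?thesis
    unfolding clifford_def fst_conv snd_conv c by (simp add: algebra_simps)
qed

lemma add_eq_imp_eq_diff: "a + b + c = d \<Longrightarrow> a = d - b - (c::'a::ab_group_add)"
  by auto

text \<open>This is the B-field transform of the annihilator of \<theta>, which is the complex
  kernel of \<theta> plus the line through \<theta>. The vector n normalises \<theta> and extracts
  the coefficient c.\<close>

lemma annihilator_exp_spinor:
  assumes "linear \<theta>" "\<theta> n = 1"
  shows "annihilator (wedge (form_exp (two_form B)) (one_form \<theta>)) =
    {w. linear (snd w) \<and> \<theta> (fst (fst w)) + \<i> * \<theta> (snd (fst w)) = 0 \<and>
      (\<exists>c. \<forall>x. snd w x = c * \<theta> x - B (fst (fst w)) x - \<i> * B (snd (fst w)) x)}"
    (is "annihilator ?R = ?L")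
proof (intro set_eqI iffI)
  fix w assume w: "w \<in> annihilator ?R"
  obtain u v \<xi> where wd: "w = ((u, v), \<xi>)" by (metis prod.exhaust)
  let ?z = "\<lambda>x. \<xi> x + B u x + \<i> * B v x"
  have lin: "linear \<xi>" and z: "wedge (one_form ?z) ?R vs + (\<theta> u + \<i> * \<theta> v) * form_exp (two_form B) vs = 0" for vs
    using w unfolding annihilator_def wd by (auto simp: clifford_exp_spinor fun_eq_iff)
  \<comment> \<open>In degree 0 the wedge product vanishes and the exponential is 1.\<close>
  have \<theta>0: "\<theta> u + \<i> * \<theta> v = 0" using z[of "[]"] by simp
  have zz: "?z x * \<theta> n - ?z n * \<theta> x = 0" for x
  proof -
    \<comment> \<open>On two arguments only the product of \<open>?z\<close> and \<theta> in degree
      2 remains; with \<theta> n = 1 it makes \<open>?z\<close> a multiple of \<theta>.\<close>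
    have "wedge (one_form ?z) ?R [x, n] = ?z x * \<theta> n - ?z n * \<theta> x"
      unfolding wedge.simps(2)[of "one_form ?z"] contract_one_form grade_inv_one_form wedge_scalar_form_left
        wedge_minus_left wedge_form_exp_one_form_singleton
      by (simp add: contract_one_form grade_inv_one_form wedge_minus_left wedge_scalar_form_left)
    then show ?thesis using z[of "[x, n]"] \<theta>0 by simp
  qed
  have "\<xi> x = ?z n * \<theta> x - B u x - \<i> * B v x" for x
    using zz[of x] unfolding assms(2) mult_1_right right_minus_eq by (rule add_eq_imp_eq_diff)
  with lin \<theta>0 show "w \<in> ?L" unfolding wd mem_Collect_eq fst_conv snd_conv by blast
next
  fix w assume w: "w \<in> ?L"
  obtain u v \<xi> where wd: "w = ((u, v), \<xi>)" by (metis prod.exhaust)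
  obtain c where "linear \<xi>" and \<theta>: "\<theta> u + \<i> * \<theta> v = 0" and c: "\<And>x. \<xi> x = c * \<theta> x - B u x - \<i> * B v x"
    using w unfolding wd by auto
  have "one_form (\<lambda>x. \<xi> x + B u x + \<i> * B v x) = (\<lambda>vs. c * one_form \<theta> vs)"
    by (auto simp: c one_form_def fun_eq_iff)
  then have "clifford ((u, v), \<xi>) ?R vs = 0" for vs
    unfolding clifford_exp_spinor \<theta> by (simp add: wedge_scale_left wedge_one_form_form_exp_self)
  with \<open>linear \<xi>\<close> show "w \<in> annihilator ?R" unfolding wd annihilator_def by auto
qed

lemma alt_form_exp_spinor:
  assumes "linear \<theta>" "\<And>u. linear (B u)" "\<And>v. linear (\<lambda>u. B u v)" "\<And>v. B v v = 0"
  shows "alt_form (wedge (form_exp (two_form B)) (one_form \<theta>))"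
  by (intro alt_form_wedge alt_form_form_exp alt_form_two_form alt_form_one_form assms two_form_Nil)

text \<open>Isotropy comes from skewness of B and from \<theta> vanishing on the vector parts. For
  maximality, an element orthogonal to the annihilator is tested against (0, \<theta>) and against
  lifts of kernel vectors, which forces the description in
  \<open>annihilator_exp_spinor\<close>.\<close>

lemma pure_exp_spinor:
  assumes "linear \<theta>" "\<theta> n = 1" "\<And>u. linear (B u)" "\<And>v. linear (\<lambda>u. B u v)" "\<And>v. B v v = 0"
  shows "pure_spinor (wedge (form_exp (two_form B)) (one_form \<theta>))" (is "pure_spinor ?R")
proof -
  have skew: "B u v = - B v u" for u v
  proof -
    have "B (u + v) (u + v) = B u v + B v u"
      using linear_add[OF assms(3)] linear_add[OF assms(4)] assms(5)[of u] assms(5)[of v] by simp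
    then show ?thesis using assms(5)[of "u + v"] by (simp add: eq_neg_iff_add_eq_0)
  qed
  then have skew0: "B u v + B v u = 0" for u v by (metis add.left_inverse)
  note L = annihilator_exp_spinor[OF assms(1,2), of B]
  have Badd: "B (x + y) z = B x z + B y z" "B x (y + z) = B x y + B x z"
    and Bsc: "B (r *\<^sub>R x) z = r *\<^sub>R B x z" "B x (r *\<^sub>R z) = r *\<^sub>R B x z"
    and Bdiff: "B (x - y) z = B x z - B y z" "B x (y - z) = B x y - B x z" for x y z r
    using linear_add[OF assms(3)] linear_add[OF assms(4)] linear_scale[OF assms(3)] linear_scale[OF assms(4)]
      linear_diff[OF assms(3)] linear_diff[OF assms(4)] by auto
  have B0: "B 0 z = 0" "B z 0 = 0" for z using linear_0[OF assms(3)] linear_0[OF assms(4)] by auto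
  have tadd: "\<theta> (x + y) = \<theta> x + \<theta> y" "\<theta> (x - y) = \<theta> x - \<theta> y" "\<theta> (r *\<^sub>R x) = r *\<^sub>R \<theta> x" "\<theta> 0 = 0" for x y r
    using linear_add[OF assms(1)] linear_scale[OF assms(1)] linear_diff[OF assms(1)] linear_0[OF assms(1)] by auto
  have sub: "gv_subspace (annihilator ?R)"
    unfolding gv_subspace_def
  proof (intro conjI ballI allI)
    show "linear (snd w)" if "w \<in> annihilator ?R" for w using that by (simp add: annihilator_def)
    show "gv_zero \<in> annihilator ?R"
      unfolding L gv_zero_def by (auto simp: tadd B0 linear_zero intro: exI[of _ 0])
    fix w z assume "w \<in> annihilator ?R" "z \<in> annihilator ?R"
    then obtain c d where lin: "linear (snd w)" "linear (snd z)"
      and t: "\<theta> (fst (fst w)) + \<i> * \<theta> (snd (fst w)) = 0" "\<theta> (fst (fst z)) + \<i> * \<theta> (snd (fst z)) = 0"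
      and c: "\<And>x. snd w x = c * \<theta> x - B (fst (fst w)) x - \<i> * B (snd (fst w)) x"
      and d: "\<And>x. snd z x = d * \<theta> x - B (fst (fst z)) x - \<i> * B (snd (fst z)) x"
      unfolding L by auto
    have "linear (\<lambda>x. snd w x + snd z x)" using lin by (intro linear_compose_add)
    moreover have "\<theta> (fst (fst w) + fst (fst z)) + \<i> * \<theta> (snd (fst w) + snd (fst z)) = 0"
      using arg_cong2[OF t, of "(+)"] by (simp add: tadd algebra_simps)
    moreover have "\<forall>x. snd w x + snd z x = (c + d) * \<theta> x - B (fst (fst w) + fst (fst z)) x - \<i> * B (snd (fst w) + snd (fst z)) x"
      by (simp add: c d Badd algebra_simps)
    ultimately show "gv_add w z \<in> annihilator ?R" unfolding L gv_add_def by auto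
  next
    fix a w assume "w \<in> annihilator ?R"
    then obtain c where lin: "linear (snd w)"
      and t: "\<theta> (fst (fst w)) + \<i> * \<theta> (snd (fst w)) = 0"
      and c: "\<And>x. snd w x = c * \<theta> x - B (fst (fst w)) x - \<i> * B (snd (fst w)) x"
      unfolding L by auto
    obtain p q where a: "a = Complex p q" by (cases a)
    have rot: "(p *\<^sub>R s - q *\<^sub>R t) + \<i> * (p *\<^sub>R t + q *\<^sub>R s) = Complex p q * (s + \<i> * t)" for s t :: complex
      by (simp add: complex_eq_iff algebra_simps)
    have "\<theta> (p *\<^sub>R fst (fst w) - q *\<^sub>R snd (fst w)) + \<i> * \<theta> (p *\<^sub>R snd (fst w) + q *\<^sub>R fst (fst w)) = 0"
      unfolding tadd rot t by simp
    moreover have "a * snd w x = (a * c) * \<theta> x - B (p *\<^sub>R fst (fst w) - q *\<^sub>R snd (fst w)) x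
        - \<i> * B (p *\<^sub>R snd (fst w) + q *\<^sub>R fst (fst w)) x" for x
    proof -
      have "B (p *\<^sub>R fst (fst w) - q *\<^sub>R snd (fst w)) x + \<i> * B (p *\<^sub>R snd (fst w) + q *\<^sub>R fst (fst w)) x
        = a * (B (fst (fst w)) x + \<i> * B (snd (fst w)) x)"
        unfolding Badd Bdiff Bsc a by (rule rot)
      then show ?thesis unfolding c by (simp add: algebra_simps)
    qed
    ultimately show "gv_scale a w \<in> annihilator ?R"
      unfolding L gv_scale_def a mem_Collect_eq fst_conv snd_conv complex.sel
      using linear_complex_scale[OF lin] by blast
  qed
  have iso: "isotropic (annihilator ?R)"
    unfolding isotropic_def
  proof (intro conjI ballI sub)
    fix w z assume "w \<in> annihilator ?R" "z \<in> annihilator ?R"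
    then obtain c d where 
      t: "\<theta> (fst (fst w)) + \<i> * \<theta> (snd (fst w)) = 0" "\<theta> (fst (fst z)) + \<i> * \<theta> (snd (fst z)) = 0"
      and c: "\<And>x. snd w x = c * \<theta> x - B (fst (fst w)) x - \<i> * B (snd (fst w)) x"
      and d: "\<And>x. snd z x = d * \<theta> x - B (fst (fst z)) x - \<i> * B (snd (fst z)) x"
      unfolding L by auto
    obtain u v u' v' where uv: "u = fst (fst w)" "v = snd (fst w)" "u' = fst (fst z)" "v' = snd (fst z)" by simp
    have "snd w u' + \<i> * snd w v' + snd z u + \<i> * snd z v
      = c * (\<theta> u' + \<i> * \<theta> v') + d * (\<theta> u + \<i> * \<theta> v)
        - (B u u' + B u' u) - \<i> * (B v u' + B u' v) - \<i> * (B u v' + B v' u) + (B v v' + B v' v)"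
      unfolding c d uv[symmetric] by (simp add: algebra_simps)
    then show "gv_pairing w z = 0"
      using t unfolding gv_pairing_def uv[symmetric] skew0 by simp
  qed
  have max: "M = annihilator ?R" if M: "isotropic M" "annihilator ?R \<subseteq> M" for M
  proof -
    have "w \<in> annihilator ?R" if "w \<in> M" for w
    proof -
      obtain u v \<xi> where wd: "w = ((u, v), \<xi>)" by (metis prod.exhaust)
      have lin: "linear \<xi>" using M(1) that unfolding isotropic_def gv_subspace_def wd by auto
      have pair: "gv_pairing w z = 0" if "z \<in> annihilator ?R" for z
        using M that \<open>w \<in> M\<close> unfolding isotropic_def by blast
      have "((0, 0), \<theta>) \<in> annihilator ?R"
        unfolding L using assms(1) by (auto simp: tadd B0 intro: exI[of _ 1])
      from pair[OF this] have t: "\<theta> u + \<i> * \<theta> v = 0"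
        by (simp add: gv_pairing_def wd linear_0[OF lin])
      define \<zeta> where "\<zeta> x = \<xi> x + B u x + \<i> * B v x" for x
      have "\<zeta> x = \<zeta> n * \<theta> x" for x
      proof -
        define r s where "r = Re (\<theta> x)" and "s = Im (\<theta> x)"
        \<comment> \<open>\<open>p + \<i> q\<close> is x - \<theta>(x) n, the projection of x to the
          complex kernel of \<theta> along n, split into real and imaginary part.\<close>
        define p q where "p = x - r *\<^sub>R n" and "q = - s *\<^sub>R n"
        have "\<theta> p + \<i> * \<theta> q = 0" unfolding p_def q_def r_def s_def tadd assms(2)
          by (simp add: complex_eq_iff)
        moreover have "linear (\<lambda>x. - B p x - \<i> * B q x)"
          using linear_compose_sub[OF linear_compose_neg[OF assms(3)] linear_complex_scale[OF assms(3)]] .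
        ultimately have "((p, q), \<lambda>x. - B p x - \<i> * B q x) \<in> annihilator ?R"
          unfolding L by (auto intro: exI[of _ 0])
        from pair[OF this] have "\<xi> p + \<i> * \<xi> q + (- B p u - \<i> * B q u) + \<i> * (- B p v - \<i> * B q v) = 0"
          by (simp add: gv_pairing_def wd add.assoc)
        then have "\<zeta> p + \<i> * \<zeta> q = 0"
          unfolding \<zeta>_def skew[of u] skew[of v] by (simp add: algebra_simps)
        moreover have "linear \<zeta>" unfolding \<zeta>_def[abs_def]
          by (intro linear_compose_add lin assms linear_complex_scale)
        ultimately have "\<zeta> x - r *\<^sub>R \<zeta> n - \<i> * (s *\<^sub>R \<zeta> n) = 0"
          unfolding p_def q_def by (simp add: linear_diff linear_scale linear_neg)
        then have "\<zeta> x = (of_real r + \<i> * of_real s) * \<zeta> n" by (simp add: scaleR_conv_of_real algebra_simps)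
        moreover have "of_real r + \<i> * of_real s = \<theta> x" unfolding r_def s_def by (simp add: complex_eq_iff)
        ultimately show ?thesis by (simp add: mult.commute)
      qed
      then have "\<xi> x + B u x + \<i> * B v x = \<zeta> n * \<theta> x" for x unfolding \<zeta>_def .
      then have "\<xi> x = \<zeta> n * \<theta> x - B u x - \<i> * B v x" for x
        by (rule add_eq_imp_eq_diff)
      with lin t show ?thesis unfolding L wd mem_Collect_eq fst_conv snd_conv by blast
    qed
    with M(2) show ?thesis by blast
  qed
  have "?R [n] = 1" by (simp only: wedge_form_exp_one_form_singleton assms(2))
  then have "?R \<noteq> (\<lambda>vs. 0)" by (metis zero_neq_one)
  with iso max alt_form_exp_spinor[OF assms(1,3,4,5)] show ?thesis
    unfolding pure_spinor_def maximal_isotropic_def by blast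
qed

text \<open>If an element and its conjugate lie in the annihilator, the real and imaginary parts u,
  v of its vector lie in the kernel of \<theta>. As B is imaginary, conjugation flips the sign of
  its contribution, so b(u, _) and b(v, _) vanish on that kernel and nondegeneracy gives u = v = 0.
  What is left is a multiple of \<theta> whose conjugate is again a multiple of \<theta>.\<close>

lemma real_rank_zero_exp_spinor:
  fixes b :: "'e::real_vector \<Rightarrow> 'e \<Rightarrow> real"
  assumes "linear \<theta>" "\<theta> n = 1" "\<theta> n' = \<i>" "\<And>v. linear (\<lambda>u. b u v)"
    "\<And>u. \<theta> u = 0 \<Longrightarrow> (\<And>v. \<theta> v = 0 \<Longrightarrow> b u v = 0) \<Longrightarrow> u = 0"
  shows "real_rank_zero (wedge (form_exp (two_form (\<lambda>u v. \<i> * of_real (b u v)))) (one_form \<theta>))"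
    (is "real_rank_zero ?R")
proof -
  let ?B = "\<lambda>u v. \<i> * complex_of_real (b u v)"
  note L = annihilator_exp_spinor[OF assms(1,2), of ?B]
  have b0: "b 0 x = 0" "b (- u) x = - b u x" for u x
    using linear_0[OF assms(4)] linear_neg[OF assms(4)] by auto
  have t0: "\<theta> 0 = 0" using linear_0[OF assms(1)] .
  have z: "gv_zero \<in> annihilator ?R"
    unfolding L gv_zero_def by (auto simp: t0 b0 linear_zero intro: exI[of _ 0])
  have zc: "gv_conj gv_zero = (gv_zero :: 'e gen_vec)" by (simp add: gv_conj_def gv_zero_def)
  have "w = gv_zero" if w: "w \<in> annihilator ?R" "w = gv_conj z" "z \<in> annihilator ?R" for w z
  proof -
    obtain u v \<xi> where zd: "z = ((u, v), \<xi>)" by (metis prod.exhaust)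
    then have wd: "w = ((u, - v), \<lambda>x. cnj (\<xi> x))" using w(2) by (simp add: gv_conj_def)
    obtain c where t1: "\<theta> u + \<i> * \<theta> v = 0" and c: "\<And>x. \<xi> x = c * \<theta> x - ?B u x - \<i> * ?B v x"
      using w(3) unfolding L zd by auto
    obtain d where t2: "\<theta> u - \<i> * \<theta> v = 0" and d: "\<And>x. cnj (\<xi> x) = d * \<theta> x - ?B u x - \<i> * ?B (-v) x"
      using w(1) unfolding L wd by (auto simp: linear_neg[OF assms(1)])
    have tu: "\<theta> u = 0" and tv: "\<theta> v = 0" using t1 t2 by (auto simp: algebra_simps)
    have e: "b u x = 0 \<and> b v x = 0" if "\<theta> x = 0" for x
    proof -
      have "cnj (c * \<theta> x - ?B u x - \<i> * ?B v x) = d * \<theta> x - ?B u x - \<i> * ?B (- v) x"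
        using d[of x] unfolding c .
      then show ?thesis unfolding that by (simp add: b0 complex_eq_iff)
    qed
    have u0: "u = 0" and v0: "v = 0"
      using assms(5)[OF tu] assms(5)[OF tv] e by blast+
    have "cnj (c * \<theta> x) = d * \<theta> x" for x
      using d[of x] unfolding c u0 v0 by (simp add: b0)
    \<comment> \<open>\<theta> takes the values 1 and \<i> at n and n', so \<theta> and its
      conjugate are linearly independent.\<close>
    from this[of n] this[of n'] have "cnj c = d" "cnj c * (- \<i>) = d * \<i>" using assms(2,3) by auto
    then have "c = 0" by (simp add: complex_eq_iff)
    then have "\<xi> x = 0" for x unfolding c u0 v0 by (simp add: b0)
    then show ?thesis unfolding wd u0 v0 by (auto simp: gv_zero_def fun_eq_iff)
  qed
  then show ?thesis
    unfolding real_rank_zero_def using z image_eqI[of _ gv_conj, OF zc[symmetric] z] by blast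
qed

section \<open>Second derivatives, pullbacks and inverse functions\<close>

text \<open>The mean value theorem is applied first in the direction u to the difference of f at
  points shifted by h v, then in the direction v to the derivative along u.\<close>

lemma second_difference_mean_value:
  fixes f :: "'a::real_normed_vector \<Rightarrow> real"
  assumes "open S" "Ck_on 2 f S" "h > 0"
    "\<And>r t. 0 \<le> r \<Longrightarrow> r \<le> h \<Longrightarrow> 0 \<le> t \<Longrightarrow> t \<le> h \<Longrightarrow> x + r *\<^sub>R u + t *\<^sub>R v \<in> S"
  obtains r t where "0 \<le> r" "r \<le> h" "0 \<le> t" "t \<le> h"
    "f (x + h *\<^sub>R u + h *\<^sub>R v) - f (x + h *\<^sub>R u) - f (x + h *\<^sub>R v) + f x
      = h * h * frechet_derivative (\<lambda>y. frechet_derivative f (at y) u) (at (x + r *\<^sub>R u + t *\<^sub>R v)) v"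
proof -
  let ?D = "\<lambda>y. frechet_derivative f (at y)"
  let ?A = "\<lambda>y. frechet_derivative (\<lambda>y. ?D y u) (at y)"
  have d1: "(f has_derivative ?D y) (at y)" if "y \<in> S" for y
    using assms(2) that by (auto simp: numeral_2_eq_2 Ck_on.simps(2) frechet_derivative_works[symmetric])
  have d2: "((\<lambda>y. ?D y u) has_derivative ?A y) (at y)" if "y \<in> S" for y
    using assms(2) that by (auto simp: numeral_2_eq_2 Ck_on.simps(2) frechet_derivative_works[symmetric])
  have line: "DERIV (\<lambda>r. g (p + r *\<^sub>R w)) r :> g' w"
    if "(g has_derivative g') (at (p + r *\<^sub>R w))" for g :: "'a \<Rightarrow> real" and g' p w r
  proof -
    have "((\<lambda>r. p + r *\<^sub>R w) has_derivative (\<lambda>s. s *\<^sub>R w)) (at r)"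
      by (auto intro!: derivative_eq_intros)
    from diff_chain_at[OF this that] have "((\<lambda>r. g (p + r *\<^sub>R w)) has_derivative (\<lambda>s. g' (s *\<^sub>R w))) (at r)"
      by (simp add: o_def)
    then show ?thesis
      unfolding has_field_derivative_def
      by (rule has_derivative_eq_rhs) (simp add: fun_eq_iff linear_scale[OF has_derivative_linear[OF that]] mult.commute)
  qed
  have S1: "x + r *\<^sub>R u + t *\<^sub>R v \<in> S" "x + r *\<^sub>R u \<in> S" "x + t *\<^sub>R v + r *\<^sub>R u \<in> S"
    if "0 \<le> r" "r \<le> h" "0 \<le> t" "t \<le> h" for r t
    using assms(4)[of r t] assms(4)[of r 0] that assms(3) by (auto simp: add.commute add.left_commute)
  have "\<exists>r>0. r < h \<and> (f (x + h *\<^sub>R v + h *\<^sub>R u) - f (x + h *\<^sub>R u)) - (f (x + h *\<^sub>R v + 0 *\<^sub>R u) - f (x + 0 *\<^sub>R u))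
     = (h - 0) * (?D (x + h *\<^sub>R v + r *\<^sub>R u) u - ?D (x + r *\<^sub>R u) u)"
  proof (rule MVT2[OF assms(3)])
    fix r assume "0 \<le> r" "r \<le> h"
    then show "DERIV (\<lambda>r. f (x + h *\<^sub>R v + r *\<^sub>R u) - f (x + r *\<^sub>R u)) r :> ?D (x + h *\<^sub>R v + r *\<^sub>R u) u - ?D (x + r *\<^sub>R u) u"
      using S1 assms(3) by (intro DERIV_diff line d1) auto
  qed
  then obtain r where r: "0 < r" "r < h"
    and e1: "(f (x + h *\<^sub>R v + h *\<^sub>R u) - f (x + h *\<^sub>R u)) - (f (x + h *\<^sub>R v) - f x)
     = h * (?D (x + h *\<^sub>R v + r *\<^sub>R u) u - ?D (x + r *\<^sub>R u) u)" by auto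
  have "\<exists>t>0. t < h \<and> ?D (x + r *\<^sub>R u + h *\<^sub>R v) u - ?D (x + r *\<^sub>R u + 0 *\<^sub>R v) u = (h - 0) * ?A (x + r *\<^sub>R u + t *\<^sub>R v) v"
  proof (rule MVT2[OF assms(3)])
    fix t assume "0 \<le> t" "t \<le> h"
    then show "DERIV (\<lambda>t. ?D (x + r *\<^sub>R u + t *\<^sub>R v) u) t :> ?A (x + r *\<^sub>R u + t *\<^sub>R v) v"
      using S1 r by (intro line[where g = "\<lambda>y. ?D y u"] d2) auto
  qed
  then obtain t where t: "0 < t" "t < h"
    and e2: "?D (x + r *\<^sub>R u + h *\<^sub>R v) u - ?D (x + r *\<^sub>R u) u = h * ?A (x + r *\<^sub>R u + t *\<^sub>R v) v" by auto
  have "x + h *\<^sub>R v + r *\<^sub>R u = x + r *\<^sub>R u + h *\<^sub>R v" "x + h *\<^sub>R v + h *\<^sub>R u = x + h *\<^sub>R u + h *\<^sub>R v"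
    by (simp_all add: algebra_simps)
  then have "f (x + h *\<^sub>R u + h *\<^sub>R v) - f (x + h *\<^sub>R u) - f (x + h *\<^sub>R v) + f x = h * h * ?A (x + r *\<^sub>R u + t *\<^sub>R v) v"
    using e1 e2 by (simp add: algebra_simps)
  from that[OF _ _ _ _ this] r t show thesis by simp
qed

text \<open>The second difference does not change when u and v are exchanged. By
  \<open>second_difference_mean_value\<close> some value of one mixed derivative equals some value
  of the other in every small parallelogram at x, and continuity carries this to x.\<close>

lemma second_derivative_symmetric_real:
  fixes f :: "'a::real_normed_vector \<Rightarrow> real"
  assumes "open S" "Ck_on 2 f S" "x \<in> S"
  shows "frechet_derivative (\<lambda>y. frechet_derivative f (at y) u) (at x) v
    = frechet_derivative (\<lambda>y. frechet_derivative f (at y) v) (at x) u"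
proof -
  let ?A = "\<lambda>u v y. frechet_derivative (\<lambda>y. frechet_derivative f (at y) u) (at y) v"
  have cont: "isCont (?A u v) x" for u v
  proof -
    have "continuous_on S (?A u v)" using assms(2) by (auto simp: numeral_2_eq_2 Ck_on.simps)
    then show ?thesis using assms(1,3) continuous_on_eq_continuous_at by blast
  qed
  have close: "\<exists>d>0. \<forall>r t. \<bar>r\<bar> \<le> d \<and> \<bar>t\<bar> \<le> d \<longrightarrow> x + r *\<^sub>R u + t *\<^sub>R v \<in> U" if UU: "open U" "x \<in> U" for U
  proof -
    obtain e where e: "e > 0" "ball x e \<subseteq> U" using openE[OF UU] by blast
    \<comment> \<open>Half of e leaves room for a strict bound on the displacement r u + t v; the
      summand 1 keeps the denominator positive when u = v = 0.\<close>
    define d where "d = (e / 2) / (norm u + norm v + 1)"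
    have n: "norm u + norm v + 1 > 0" using norm_ge_zero[of u] norm_ge_zero[of v] by linarith
    then have d: "d > 0" using e(1) by (simp add: d_def)
    have "x + r *\<^sub>R u + t *\<^sub>R v \<in> ball x e" if "\<bar>r\<bar> \<le> d" "\<bar>t\<bar> \<le> d" for r t
    proof -
      have "norm (r *\<^sub>R u + t *\<^sub>R v) \<le> \<bar>r\<bar> * norm u + \<bar>t\<bar> * norm v"
        by (metis norm_scaleR norm_triangle_ineq)
      also have "\<dots> \<le> d * norm u + d * norm v" using that by (intro add_mono mult_right_mono) auto
      also have "\<dots> < e"
      proof -
        have "d * norm u + d * norm v \<le> d * (norm u + norm v + 1)" using d by (simp add: algebra_simps)
        also have "\<dots> = e / 2" using n d_def nonzero_eq_divide_eq[of "norm u + norm v + 1" d "e / 2"]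
          by (metis less_irrefl)
        finally show ?thesis using e(1) by simp
      qed
      finally have "dist x (x + (r *\<^sub>R u + t *\<^sub>R v)) < e"
        by (metis add_diff_cancel_left' dist_commute dist_norm)
      then show ?thesis by (simp only: mem_ball add.assoc)
    qed
    then show ?thesis using d e(2) by blast
  qed
  have "\<bar>?A u v x - ?A v u x\<bar> \<le> 2 * e" if e0: "e > 0" for e
  proof -
    obtain U1 where U1: "open U1" "x \<in> U1" "\<And>y. y \<in> U1 \<Longrightarrow> \<bar>?A u v y - ?A u v x\<bar> < e"
    proof -
      have "\<exists>U. open U \<and> x \<in> U \<and> (\<forall>y\<in>U. ?A u v y \<in> ball (?A u v x) e)"
        using cont[of u v] e0 unfolding continuous_at_open by (meson centre_in_ball open_ball)
      then show thesis using that by (force simp: dist_real_def)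
    qed
    obtain U2 where U2: "open U2" "x \<in> U2" "\<And>y. y \<in> U2 \<Longrightarrow> \<bar>?A v u y - ?A v u x\<bar> < e"
    proof -
      have "\<exists>U. open U \<and> x \<in> U \<and> (\<forall>y\<in>U. ?A v u y \<in> ball (?A v u x) e)"
        using cont[of v u] e0 unfolding continuous_at_open by (meson centre_in_ball open_ball)
      then show thesis using that by (force simp: dist_real_def)
    qed
    obtain d where d: "d > 0" "\<And>r t. \<bar>r\<bar> \<le> d \<Longrightarrow> \<bar>t\<bar> \<le> d \<Longrightarrow> x + r *\<^sub>R u + t *\<^sub>R v \<in> S \<inter> U1 \<inter> U2"
      using close[of "S \<inter> U1 \<inter> U2"] assms(1,3) U1(1,2) U2(1,2) by (metis Int_iff open_Int)
    have in1: "x + r *\<^sub>R u + t *\<^sub>R v \<in> S" "x + t *\<^sub>R v + r *\<^sub>R u \<in> S" "x + r *\<^sub>R u + t *\<^sub>R v \<in> U1" "x + t *\<^sub>R v + r *\<^sub>R u \<in> U2"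
      if "0 \<le> r" "r \<le> d" "0 \<le> t" "t \<le> d" for r t
      using d(2)[of r t] that by (auto simp: add.commute add.left_commute)
    obtain r t where rt: "0 \<le> r" "r \<le> d" "0 \<le> t" "t \<le> d"
      and e1: "f (x + d *\<^sub>R u + d *\<^sub>R v) - f (x + d *\<^sub>R u) - f (x + d *\<^sub>R v) + f x = d * d * ?A u v (x + r *\<^sub>R u + t *\<^sub>R v)"
      using second_difference_mean_value[OF assms(1,2) d(1), of x u v] in1 by metis
    obtain r' t' where rt': "0 \<le> r'" "r' \<le> d" "0 \<le> t'" "t' \<le> d"
      and e2: "f (x + d *\<^sub>R v + d *\<^sub>R u) - f (x + d *\<^sub>R v) - f (x + d *\<^sub>R u) + f x = d * d * ?A v u (x + r' *\<^sub>R v + t' *\<^sub>R u)"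
      using second_difference_mean_value[OF assms(1,2) d(1), of x v u] in1 by metis
    have "f (x + d *\<^sub>R v + d *\<^sub>R u) = f (x + d *\<^sub>R u + d *\<^sub>R v)"
      by (rule arg_cong[where f = f]) (simp add: algebra_simps)
    then have "d * d * ?A u v (x + r *\<^sub>R u + t *\<^sub>R v) = d * d * ?A v u (x + r' *\<^sub>R v + t' *\<^sub>R u)"
      using e1 e2 by linarith
    then have "?A u v (x + r *\<^sub>R u + t *\<^sub>R v) = ?A v u (x + r' *\<^sub>R v + t' *\<^sub>R u)" using d(1) by simp
    then show ?thesis
      using U1(3)[OF in1(3)[OF rt]] U2(3)[OF in1(4)[OF rt'(3,4,1,2)]] by linarith
  qed
  then have "\<bar>?A u v x - ?A v u x\<bar> \<le> 0"
    by (metis field_le_epsilon add_0 mult_2 field_sum_of_halves half_gt_zero)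
  then show ?thesis by simp
qed

lemma frechet_derivative_bounded_linear_compose:
  assumes "bounded_linear L" "f differentiable (at x)"
  shows "frechet_derivative (\<lambda>y. L (f y)) (at x) v = L (frechet_derivative f (at x) v)"
  using bounded_linear.has_derivative[OF assms(1), of f "frechet_derivative f (at x)" "at x"] assms(2)
  by (metis frechet_derivative_at frechet_derivative_works)

lemma smooth_on_differentiable: "smooth_on f S \<Longrightarrow> x \<in> S \<Longrightarrow> f differentiable (at x)"
  using smooth_on_has_derivative differentiable_def by blast

lemma second_derivative_symmetric:
  fixes f :: "'a::real_normed_vector \<Rightarrow> 'b::euclidean_space"
  assumes "open S" "smooth_on f S" "x \<in> S"
  shows "frechet_derivative (\<lambda>y. frechet_derivative f (at y) u) (at x) v
    = frechet_derivative (\<lambda>y. frechet_derivative f (at y) v) (at x) u"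
proof (rule euclidean_eqI)
  fix b :: 'b assume "b \<in> Basis"
  have eq: "frechet_derivative (\<lambda>y. frechet_derivative f (at y) u) (at x) v \<bullet> b
    = frechet_derivative (\<lambda>y. frechet_derivative (\<lambda>y. f y \<bullet> b) (at y) u) (at x) v" for u v
  proof -
    have "frechet_derivative (\<lambda>y. frechet_derivative f (at y) u) (at x) v \<bullet> b
      = frechet_derivative (\<lambda>y. frechet_derivative f (at y) u \<bullet> b) (at x) v"
      by (rule frechet_derivative_bounded_linear_compose[OF bounded_linear_inner_left, symmetric])
         (rule smooth_on_differentiable[OF smooth_on_derivative[OF assms(2)] assms(3)])
    also have "frechet_derivative (\<lambda>y. frechet_derivative f (at y) u \<bullet> b) (at x)
      = frechet_derivative (\<lambda>y. frechet_derivative (\<lambda>y. f y \<bullet> b) (at y) u) (at x)"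
    proof (rule frechet_derivative_transform_within_open[OF _ assms(1,3)])
      show "(\<lambda>y. frechet_derivative f (at y) u \<bullet> b) differentiable at x"
        using smooth_on_bounded_linear_compose[OF bounded_linear_inner_left assms(1) smooth_on_derivative[OF assms(2)]] assms(3)
        by (rule smooth_on_differentiable)
      show "frechet_derivative f (at y) u \<bullet> b = frechet_derivative (\<lambda>y. f y \<bullet> b) (at y) u" if "y \<in> S" for y
        by (rule frechet_derivative_bounded_linear_compose[OF bounded_linear_inner_left smooth_on_differentiable[OF assms(2) that], symmetric])
    qed
    finally show ?thesis .
  qed
  have "smooth_on (\<lambda>y. f y \<bullet> b) S"
    by (rule smooth_on_bounded_linear_compose[OF bounded_linear_inner_left assms(1,2)])
  then show "frechet_derivative (\<lambda>y. frechet_derivative f (at y) u) (at x) v \<bullet> b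
    = frechet_derivative (\<lambda>y. frechet_derivative f (at y) v) (at x) u \<bullet> b"
    unfolding eq using second_derivative_symmetric_real[OF assms(1) _ assms(3)] by (simp add: smooth_on_def)
qed

section \<open>Exterior derivatives of 1-forms and 2-forms, and pullbacks\<close>

lemma flat_ext_deriv_one_form:
  "flat_ext_deriv (\<lambda>y. one_form (\<xi> y)) x vs = (if length vs = 2 then
     frechet_derivative (\<lambda>y. \<xi> y (vs ! 1)) (at x) (vs ! 0) - frechet_derivative (\<lambda>y. \<xi> y (vs ! 0)) (at x) (vs ! 1) else 0)"
proof (cases "length vs = 2")
  case True
  then obtain u v where "vs = [u, v]" by (auto simp: numeral_2_eq_2 length_Suc_conv)
  then show ?thesis
    by (simp add: flat_ext_deriv_Cons form_deriv_def one_form_def)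
next
  case False
  have "\<not> length (take i vs @ drop (Suc i) vs) = 1" if "i < length vs" for i
    using that False by auto
  then show ?thesis using False
    by (auto simp: flat_ext_deriv_def one_form_def intro!: sum.neutral)
qed

lemma flat_ext_deriv_two_form_other:
  assumes "length vs \<noteq> 3"
  shows "flat_ext_deriv (\<lambda>y. two_form (B y)) x vs = 0"
proof -
  have "\<not> length (take i vs @ drop (Suc i) vs) = 2" if "i < length vs" for i
    using that assms by auto
  then show ?thesis
    by (auto simp: flat_ext_deriv_def two_form_def intro!: sum.neutral)
qed

lemma flat_ext_deriv_three:
  "flat_ext_deriv \<alpha> x [u, v, w] = frechet_derivative (\<lambda>y. \<alpha> y [v, w]) (at x) u
    - frechet_derivative (\<lambda>y. \<alpha> y [u, w]) (at x) v + frechet_derivative (\<lambda>y. \<alpha> y [u, v]) (at x) w"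
  by (simp add: flat_ext_deriv_Cons form_deriv_def)

lemma bilinear_eq_sum_Basis:
  fixes b :: "'a::euclidean_space \<Rightarrow> 'b::euclidean_space \<Rightarrow> 'c::real_vector"
  assumes "\<And>u. linear (b u)" "\<And>v. linear (\<lambda>u. b u v)"
  shows "b u v = (\<Sum>i\<in>Basis. \<Sum>j\<in>Basis. ((u \<bullet> i) * (v \<bullet> j)) *\<^sub>R b i j)"
proof -
  have "b u v = (\<Sum>i\<in>Basis. (u \<bullet> i) *\<^sub>R b i v)" by (rule linear_eq_sum_Basis[OF assms(2)])
  also have "\<dots> = (\<Sum>i\<in>Basis. (u \<bullet> i) *\<^sub>R (\<Sum>j\<in>Basis. (v \<bullet> j) *\<^sub>R b i j))"
    by (intro sum.cong refl arg_cong2[where f = "(*\<^sub>R)"] linear_eq_sum_Basis[OF assms(1)])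
  finally show ?thesis by (simp add: scaleR_sum_right)
qed

lemma smooth_on_bilinear_apply:
  fixes B :: "'f::euclidean_space \<Rightarrow> 'f \<Rightarrow> 'f \<Rightarrow> complex" and f :: "'a::real_normed_vector \<Rightarrow> 'f"
  assumes "open S" "open T" "f ` S \<subseteq> T" "smooth_on f S" "smooth_on p S" "smooth_on q S"
    and "\<And>z u. z \<in> T \<Longrightarrow> linear (B z u)" "\<And>z v. z \<in> T \<Longrightarrow> linear (\<lambda>u. B z u v)"
    and "\<And>u v. smooth_on (\<lambda>z. B z u v) T"
  shows "smooth_on (\<lambda>y. B (f y) (p y) (q y)) S"
proof -
  have "smooth_on (\<lambda>y. \<Sum>i\<in>Basis. \<Sum>j\<in>Basis. ((p y \<bullet> i) * (q y \<bullet> j)) *\<^sub>R B (f y) i j) S"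
    by (intro smooth_on_sum smooth_on_scaleR smooth_on_mult assms
        smooth_on_bounded_linear_compose[OF bounded_linear_inner_left]
        smooth_on_compose[OF assms(1-4), where g = "\<lambda>z. B z i j" for i j])
  moreover have "(\<Sum>i\<in>Basis. \<Sum>j\<in>Basis. ((p y \<bullet> i) * (q y \<bullet> j)) *\<^sub>R B (f y) i j) = B (f y) (p y) (q y)" if "y \<in> S" for y
    by (rule bilinear_eq_sum_Basis[symmetric]) (use that assms in auto)
  ultimately show ?thesis by (rule iffD1[OF smooth_on_cong[OF assms(1)], rotated])
qed

text \<open>A product rule for a varying bilinear form at varying arguments. As \<open>diff\<close>
  concerns fixed arguments, B is expanded in a basis; the sum can be folded back because the
  derivative of a family of bilinear maps is again bilinear, by uniqueness of derivatives.\<close>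

lemma has_derivative_bilinear_apply:
  fixes B :: "'f::euclidean_space \<Rightarrow> 'f \<Rightarrow> 'f \<Rightarrow> complex" and f :: "'a::real_normed_vector \<Rightarrow> 'f"
  assumes "open S" "x \<in> S" "open T" "f ` S \<subseteq> T"
    and f: "(f has_derivative f') (at x)" and p: "(p has_derivative p') (at x)" and q: "(q has_derivative q') (at x)"
    and lin: "\<And>z u. z \<in> T \<Longrightarrow> linear (B z u)" "\<And>z v. z \<in> T \<Longrightarrow> linear (\<lambda>u. B z u v)"
    and diff: "\<And>u v. (\<lambda>z. B z u v) differentiable (at (f x))"
  defines "DB \<equiv> \<lambda>w u v. frechet_derivative (\<lambda>z. B z u v) (at (f x)) w"
  shows "((\<lambda>y. B (f y) (p y) (q y)) has_derivative
    (\<lambda>w. B (f x) (p' w) (q x) + B (f x) (p x) (q' w) + DB (f' w) (p x) (q x))) (at x)"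
proof -
  have fx: "f x \<in> T" using assms(2,4) by auto
  have dB: "((\<lambda>z. B z u v) has_derivative (\<lambda>w. DB w u v)) (at (f x))" for u v
    using diff unfolding DB_def by (simp add: frechet_derivative_works[symmetric])
  have linD: "linear (DB w u)" "linear (\<lambda>u. DB w u v)" for w u v
  proof -
    have "((\<lambda>z. B z u (r *\<^sub>R a + s *\<^sub>R b)) has_derivative (\<lambda>w. r *\<^sub>R DB w u a + s *\<^sub>R DB w u b)) (at (f x))" for r s a b
      by (rule has_derivative_transform_within_open[OF _ \<open>open T\<close> fx, where f = "\<lambda>z. r *\<^sub>R B z u a + s *\<^sub>R B z u b"])
         (auto intro!: derivative_intros dB simp: linear_add[OF lin(1)] linear_scale[OF lin(1)])
    from fun_cong[OF has_derivative_unique[OF dB this], of w]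
    have "DB w u (r *\<^sub>R a + s *\<^sub>R b) = r *\<^sub>R DB w u a + s *\<^sub>R DB w u b" for r s a b .
    from this[of 1 _ 1] this[of _ _ 0] show "linear (DB w u)" by (simp add: linear_iff)
    have "((\<lambda>z. B z (r *\<^sub>R a + s *\<^sub>R b) v) has_derivative (\<lambda>w. r *\<^sub>R DB w a v + s *\<^sub>R DB w b v)) (at (f x))" for r s a b
      by (rule has_derivative_transform_within_open[OF _ \<open>open T\<close> fx, where f = "\<lambda>z. r *\<^sub>R B z a v + s *\<^sub>R B z b v"])
         (auto intro!: derivative_intros dB simp: linear_add[OF lin(2)] linear_scale[OF lin(2)])
    from fun_cong[OF has_derivative_unique[OF dB this], of w]
    have "DB w (r *\<^sub>R a + s *\<^sub>R b) v = r *\<^sub>R DB w a v + s *\<^sub>R DB w b v" for r s a b .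
    from this[of 1 _ 1] this[of _ _ 0] show "linear (\<lambda>u. DB w u v)" by (simp add: linear_iff)
  qed
  have "((\<lambda>y. B (f y) i j) has_derivative (\<lambda>w. DB (f' w) i j)) (at x)" for i j
    using diff_chain_at[OF f dB] by (simp add: o_def)
  then have "((\<lambda>y. ((p y \<bullet> i) * (q y \<bullet> j)) *\<^sub>R B (f y) i j) has_derivative
     (\<lambda>w. ((p x \<bullet> i) * (q x \<bullet> j)) *\<^sub>R DB (f' w) i j + ((p x \<bullet> i) * (q' w \<bullet> j) + (p' w \<bullet> i) * (q x \<bullet> j)) *\<^sub>R B (f x) i j)) (at x)" for i j
    by (intro has_derivative_scaleR has_derivative_mult has_derivative_inner_left p q)
  then have "((\<lambda>y. \<Sum>i\<in>Basis. \<Sum>j\<in>Basis. ((p y \<bullet> i) * (q y \<bullet> j)) *\<^sub>R B (f y) i j) has_derivative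
     (\<lambda>w. \<Sum>i\<in>Basis. \<Sum>j\<in>Basis. ((p x \<bullet> i) * (q x \<bullet> j)) *\<^sub>R DB (f' w) i j
        + ((p x \<bullet> i) * (q' w \<bullet> j) + (p' w \<bullet> i) * (q x \<bullet> j)) *\<^sub>R B (f x) i j)) (at x)"
    by (intro has_derivative_sum)
  then have "((\<lambda>y. B (f y) (p y) (q y)) has_derivative
     (\<lambda>w. \<Sum>i\<in>Basis. \<Sum>j\<in>Basis. ((p x \<bullet> i) * (q x \<bullet> j)) *\<^sub>R DB (f' w) i j
        + ((p x \<bullet> i) * (q' w \<bullet> j) + (p' w \<bullet> i) * (q x \<bullet> j)) *\<^sub>R B (f x) i j)) (at x)"
  proof (rule has_derivative_transform_within_open[OF _ assms(1,2)])
    show "(\<Sum>i\<in>Basis. \<Sum>j\<in>Basis. ((p y \<bullet> i) * (q y \<bullet> j)) *\<^sub>R B (f y) i j) = B (f y) (p y) (q y)" if "y \<in> S" for y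
      by (rule bilinear_eq_sum_Basis[symmetric]) (use that assms(4) lin in auto)
  qed
  then show ?thesis
    apply (rule has_derivative_eq_rhs)
    apply (rule ext)
    apply (subst bilinear_eq_sum_Basis[OF lin[OF fx], of _ "q x"])
    apply (subst bilinear_eq_sum_Basis[OF lin[OF fx], of "p x"])
    apply (subst bilinear_eq_sum_Basis[OF linD, of _ "p x"])
    apply (simp add: sum.distrib scaleR_add_left)
    done
qed

text \<open>The exterior derivative of the pullback consists of the pullback of dB, which vanishes,
  and of terms with a second derivative of \<phi>. The latter cancel in pairs by symmetry of the
  second derivative and skewness of B.\<close>

lemma pullback_two_form_euclidean:
  fixes \<phi> :: "'a::real_normed_vector \<Rightarrow> 'f::euclidean_space" and B :: "'f \<Rightarrow> 'f \<Rightarrow> 'f \<Rightarrow> complex"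
  assumes S: "open S" "smooth_on \<phi> S" "open T" "\<phi> ` S \<subseteq> T"
    and lin: "\<And>z u. z \<in> T \<Longrightarrow> linear (B z u)" "\<And>z v. z \<in> T \<Longrightarrow> linear (\<lambda>u. B z u v)"
    and skew: "\<And>z u v. z \<in> T \<Longrightarrow> B z u v = - B z v u"
    and sm: "\<And>u v. smooth_on (\<lambda>z. B z u v) T"
    and x: "x \<in> S" and closed: "\<And>u v w. flat_ext_deriv (\<lambda>z. two_form (B z)) (\<phi> x) [u, v, w] = 0"
  defines "D \<equiv> \<lambda>y. frechet_derivative \<phi> (at y)"
  shows "flat_ext_deriv (\<lambda>y. two_form (\<lambda>u v. B (\<phi> y) (D y u) (D y v))) x vs = 0"
proof (cases "length vs = 3")
  case False
  then show ?thesis by (rule flat_ext_deriv_two_form_other)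
next
  case True
  then obtain u v w where vs: "vs = [u, v, w]" by (auto simp: numeral_3_eq_3 length_Suc_conv)
  have \<phi>x: "\<phi> x \<in> T" using S x by auto
  define H where "H a b = frechet_derivative (\<lambda>y. D y a) (at x) b" for a b
  have H: "((\<lambda>y. D y a) has_derivative H a) (at x)" for a
    unfolding H_def D_def using smooth_on_has_derivative[OF smooth_on_derivative[OF S(2)] x] by simp
  have sym: "H a b = H b a" for a b
    unfolding H_def D_def by (rule second_derivative_symmetric[OF S(1,2) x])
  define DB where "DB c a b = frechet_derivative (\<lambda>z. B z a b) (at (\<phi> x)) c" for c a b
  have der: "frechet_derivative (\<lambda>y. two_form (\<lambda>u v. B (\<phi> y) (D y u) (D y v)) [a, b]) (at x) c
    = B (\<phi> x) (H a c) (D x b) + B (\<phi> x) (D x a) (H b c) + DB (D x c) (D x a) (D x b)" for a b c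
  proof -
    have "((\<lambda>y. B (\<phi> y) (D y a) (D y b)) has_derivative
      (\<lambda>c. B (\<phi> x) (H a c) (D x b) + B (\<phi> x) (D x a) (H b c) + DB (D x c) (D x a) (D x b))) (at x)"
      unfolding DB_def
      by (rule has_derivative_bilinear_apply[OF S(1) x S(3,4) _ H H])
         (use S x \<phi>x lin sm in \<open>auto intro: smooth_on_has_derivative smooth_on_differentiable[OF sm] simp: D_def\<close>)
    then show ?thesis by (simp add: two_form_def frechet_derivative_at[symmetric])
  qed
  have cl: "DB a b c - DB b a c + DB c a b = 0" for a b c
    using closed[of a b c] unfolding flat_ext_deriv_three DB_def by (simp add: two_form_def)
  have sk: "B (\<phi> x) (D x a) (H b c) = - B (\<phi> x) (H b c) (D x a)" for a b c
    by (rule skew[OF \<phi>x])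
  show ?thesis
    unfolding vs flat_ext_deriv_three der sk
    using cl[of "D x u" "D x v" "D x w"] sym[of u v] sym[of u w] sym[of v w] by (simp add: algebra_simps)
qed

text \<open>The maps \<open>E\<close> and \<open>G\<close> replace the normed space \<open>'k\<close>, which is finite-dimensional but not
  of class \<open>euclidean_space\<close>, by a Euclidean space.\<close>

lemma pullback_two_form:
  fixes \<psi> :: "'a::real_normed_vector \<Rightarrow> 'k::real_normed_vector" and B :: "'k \<Rightarrow> 'k \<Rightarrow> 'k \<Rightarrow> complex"
    and G :: "'k \<Rightarrow> 'f::euclidean_space"
  assumes S: "open S" "smooth_on \<psi> S" "open T" "\<psi> ` S \<subseteq> T"
    and EG: "bounded_linear E" "bounded_linear G" "\<And>k. E (G k) = k"
    and lin: "\<And>z u. z \<in> T \<Longrightarrow> linear (B z u)" "\<And>z v. z \<in> T \<Longrightarrow> linear (\<lambda>u. B z u v)"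
    and skew: "\<And>z u v. z \<in> T \<Longrightarrow> B z u v = - B z v u"
    and sm: "\<And>u v. smooth_on (\<lambda>z. B z u v) T"
  defines "pb \<equiv> \<lambda>y u v. B (\<psi> y) (frechet_derivative \<psi> (at y) u) (frechet_derivative \<psi> (at y) v)"
  shows "smooth_on (\<lambda>y. pb y u v) S"
    and "x \<in> S \<Longrightarrow> (\<And>u v w. flat_ext_deriv (\<lambda>z. two_form (B z)) (\<psi> x) [u, v, w] = 0)
      \<Longrightarrow> flat_ext_deriv (\<lambda>y. two_form (pb y)) x vs = 0"
proof -
  \<comment> \<open>\<phi> maps into a Euclidean space and C is B transported by E. Since E inverts
    G on the left, C pulled back along \<phi> is B pulled back along \<psi>.\<close>
  define \<phi> where "\<phi> y = G (\<psi> y)" for y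
  define C where "C z u v = B (E z) (E u) (E v)" for z u v
  define T' where "T' = E -` T"
  interpret E: bounded_linear E by fact
  interpret G: bounded_linear G by fact
  have T': "open T'" unfolding T'_def
    by (rule open_vimage[OF S(3) linear_continuous_on[OF EG(1)]])
  have \<phi>: "smooth_on \<phi> S" unfolding \<phi>_def[abs_def]
    by (rule smooth_on_bounded_linear_compose[OF EG(2) S(1,2)])
  have \<phi>T: "\<phi> ` S \<subseteq> T'" using S(4) EG(3) by (auto simp: \<phi>_def T'_def)
  have smC: "smooth_on (\<lambda>z. C z u v) T'" for u v unfolding C_def
    by (rule smooth_on_compose_bounded_linear[OF EG(1) T' S(3) _ sm]) (auto simp: T'_def)
  have linC: "linear (C z u)" "linear (\<lambda>u. C z u v)" if "z \<in> T'" for z u v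
    using linear_compose[OF E.linear lin(1)] linear_compose[OF E.linear lin(2)] that
    by (auto simp: C_def[abs_def] T'_def o_def)
  have D: "frechet_derivative \<psi> (at y) u = E (frechet_derivative \<phi> (at y) u)" if "y \<in> S" for y u
    using frechet_derivative_bounded_linear_compose[OF EG(1) smooth_on_differentiable[OF \<phi> that], of u]
    by (simp add: \<phi>_def EG(3))
  have eq: "C (\<phi> y) (frechet_derivative \<phi> (at y) u) (frechet_derivative \<phi> (at y) v) = pb y u v" if "y \<in> S" for y u v
    by (simp add: pb_def C_def D[OF that] \<phi>_def EG(3))
  have "smooth_on (\<lambda>y. C (\<phi> y) (frechet_derivative \<phi> (at y) u) (frechet_derivative \<phi> (at y) v)) S"
    by (rule smooth_on_bilinear_apply[OF S(1) T' \<phi>T \<phi> smooth_on_derivative[OF \<phi>] smooth_on_derivative[OF \<phi>] linC smC])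
  then show "smooth_on (\<lambda>y. pb y u v) S"
    by (rule iffD1[OF smooth_on_cong[OF S(1)], rotated]) (simp add: eq)
  assume x: "x \<in> S" and closed: "\<And>u v w. flat_ext_deriv (\<lambda>z. two_form (B z)) (\<psi> x) [u, v, w] = 0"
  have \<psi>x: "\<psi> x \<in> T" "E (\<phi> x) = \<psi> x" using x S(4) by (auto simp: \<phi>_def EG(3))
  have "frechet_derivative (\<lambda>z. C z u v) (at (\<phi> x)) w = frechet_derivative (\<lambda>z. B z (E u) (E v)) (at (\<psi> x)) (E w)" for u v w
  proof -
    have "((\<lambda>z. B z (E u) (E v)) has_derivative frechet_derivative (\<lambda>z. B z (E u) (E v)) (at (\<psi> x))) (at (E (\<phi> x)))"
      unfolding \<psi>x(2) by (rule smooth_on_has_derivative[OF sm \<psi>x(1)])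
    from diff_chain_at[OF bounded_linear_imp_has_derivative[OF EG(1)] this]
    show ?thesis unfolding C_def by (simp add: o_def frechet_derivative_at[symmetric])
  qed
  then have "flat_ext_deriv (\<lambda>z. two_form (C z)) (\<phi> x) [u, v, w] = 0" for u v w
    using closed[of "E u" "E v" "E w"] unfolding flat_ext_deriv_three by (simp add: two_form_def)
  moreover have "C z u v = - C z v u" if "z \<in> T'" for z u v
    unfolding C_def by (rule skew) (use that in \<open>simp add: T'_def\<close>)
  ultimately have *: "flat_ext_deriv (\<lambda>y. two_form (\<lambda>u v. C (\<phi> y) (frechet_derivative \<phi> (at y) u) (frechet_derivative \<phi> (at y) v))) x vs = 0"
    by (intro pullback_two_form_euclidean[where T = T' and B = C and S = S] S(1) \<phi> T' \<phi>T linC smC x)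
  have "frechet_derivative (\<lambda>y. two_form (\<lambda>u v. C (\<phi> y) (frechet_derivative \<phi> (at y) u) (frechet_derivative \<phi> (at y) v)) us) (at x)
     = frechet_derivative (\<lambda>y. two_form (pb y) us) (at x)" for us
  proof (rule frechet_derivative_transform_within_open[OF _ S(1) x])
    show "two_form (\<lambda>u v. C (\<phi> y) (frechet_derivative \<phi> (at y) u) (frechet_derivative \<phi> (at y) v)) us = two_form (pb y) us"
      if "y \<in> S" for y by (simp add: eq[OF that])
    show "(\<lambda>y. two_form (\<lambda>u v. C (\<phi> y) (frechet_derivative \<phi> (at y) u) (frechet_derivative \<phi> (at y) v)) us) differentiable at x"
      by (cases "length us = 2")
         (auto simp: two_form_def intro!: smooth_on_differentiable[OF smooth_on_bilinear_apply[OF S(1) T' \<phi>T \<phi> smooth_on_derivative[OF \<phi>] smooth_on_derivative[OF \<phi>] linC smC] x])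
  qed
  with * show "flat_ext_deriv (\<lambda>y. two_form (pb y)) x vs = 0"
    unfolding flat_ext_deriv_def by simp
qed

text \<open>\<open>E v x\<close> is an explicit smooth preimage of v under the derivative of f.
  Where that derivative is bijective, the inverse g has the derivative v \<mapsto>
  \<open>E v (g y)\<close> at y, and \<open>smooth_on_bootstrap\<close> makes g smooth. The
  normalisation at \<open>x0\<close> makes the derivative there trivially invertible.\<close>

lemma smooth_inverse_function:
  fixes f :: "'a::euclidean_space \<Rightarrow> 'a"
  assumes U: "open U" "smooth_on f U" "x0 \<in> U"
    and id: "\<And>v. frechet_derivative f (at x0) v = v"
    and E: "\<And>v. smooth_on (E v) U" "\<And>x v. x \<in> U \<Longrightarrow> frechet_derivative f (at x) (E v x) = v"
  obtains U' V g where "open U'" "U' \<subseteq> U" "x0 \<in> U'" "open V" "homeomorphism U' V f g" "smooth_on g V"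
proof -
  define f' where "f' x = Blinfun (frechet_derivative f (at x))" for x
  have bl: "bounded_linear (frechet_derivative f (at x))" if "x \<in> U" for x
    using smooth_on_has_derivative[OF U(2) that] by (rule has_derivative_bounded_linear)
  have f': "blinfun_apply (f' x) = frechet_derivative f (at x)" if "x \<in> U" for x
    using bl[OF that] by (simp add: f'_def bounded_linear_Blinfun_apply)
  have der: "(f has_derivative blinfun_apply (f' x)) (at x)" if "x \<in> U" for x
    using smooth_on_has_derivative[OF U(2) that] f'[OF that] by simp
  have "continuous_on U (\<lambda>x. blinfun_apply (f' x) v)" for v
    using smooth_on_continuous_on[OF smooth_on_derivative[OF U(2), of v]]
    by (rule continuous_on_eq) (simp add: f')
  then have cont: "continuous_on U f'" by (intro continuous_on_blinfun_componentwise)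
  have inv: "id_blinfun o\<^sub>L f' x0 = id_blinfun"
    by (rule blinfun_eqI) (simp add: f' U id)
  obtain U' V g g' where V: "open U'" "U' \<subseteq> U" "x0 \<in> U'" "open V" "f x0 \<in> V" "homeomorphism U' V f g"
    and g: "\<And>y. y \<in> V \<Longrightarrow> (g has_derivative (g' y)) (at y)"
    and g': "\<And>y. y \<in> V \<Longrightarrow> g' y = inv (blinfun_apply (f' (g y)))"
    and bij: "\<And>y. y \<in> V \<Longrightarrow> bij (blinfun_apply (f' (g y)))"
    by (rule inverse_function_theorem[OF U(1) der cont U(3) inv]; (assumption)?) (rule that)
  have gV: "g ` V \<subseteq> U" using V unfolding homeomorphism_def by blast
  have "g' y v = E v (g y)" if "y \<in> V" for y v
  proof -
    have "g y \<in> U" using that gV by auto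
    then have "blinfun_apply (f' (g y)) (E v (g y)) = v" by (simp add: f' E(2))
    then show ?thesis using g'[OF that] bij[OF that] by (metis bij_inv_eq_iff)
  qed
  then have "g' y = (\<lambda>v. E v (g y))" if "y \<in> V" for y using that by blast
  then have "(g has_derivative (\<lambda>v. E v (g y))) (at y)" if "y \<in> V" for y using g that by metis
  then have "smooth_on g V"
    by (rule smooth_on_bootstrap[OF V(4) U(1) gV _ E(1)])
  with V that show thesis by blast
qed

section \<open>Calculus in charts\<close>

lemma chart_inv_chart: "is_chart c \<Longrightarrow> p \<in> fst c \<Longrightarrow> chart_inv c (snd c p) = p"
  and chart_chart_inv: "is_chart c \<Longrightarrow> x \<in> snd c ` fst c \<Longrightarrow> snd c (chart_inv c x) = x"
  and chart_inv_in: "is_chart c \<Longrightarrow> x \<in> snd c ` fst c \<Longrightarrow> chart_inv c x \<in> fst c"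
  and continuous_on_chart: "is_chart c \<Longrightarrow> continuous_on (fst c) (snd c)"
  and continuous_on_chart_inv: "is_chart c \<Longrightarrow> continuous_on (snd c ` fst c) (chart_inv c)"
  and open_chart_domain: "is_chart c \<Longrightarrow> open (fst c)"
  and open_chart_image: "is_chart c \<Longrightarrow> open (snd c ` fst c)"
  unfolding is_chart_def homeomorphism_def by auto

lemma chart_eqD: "is_chart c \<Longrightarrow> p \<in> fst c \<Longrightarrow> q \<in> fst c \<Longrightarrow> snd c p = snd c q \<Longrightarrow> p = q"
  by (metis chart_inv_chart)

lemma chart_image_Int:
  "is_chart c \<Longrightarrow> snd c ` (U \<inter> fst c) = snd c ` fst c \<inter> chart_inv c -` U"
  by (auto simp: chart_inv_chart chart_inv_in image_iff intro: chart_chart_inv[symmetric])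

lemma open_chart_image_Int: "is_chart c \<Longrightarrow> open U \<Longrightarrow> open (snd c ` (U \<inter> fst c))"
  unfolding chart_image_Int
  by (rule continuous_open_preimage[OF continuous_on_chart_inv open_chart_image])

text \<open>A derivative between two arbitrary charts. \<open>tangent_map\<close>,
  \<open>to_chart\<close> and \<open>from_chart\<close> are the cases in which charts are preferred
  ones or the map is the identity, so one chain rule covers all of them.\<close>

definition chart_deriv :: "('a, 'e::real_normed_vector) chart \<Rightarrow> ('b, 'f::real_normed_vector) chart \<Rightarrow>
    ('a \<Rightarrow> 'b) \<Rightarrow> 'a \<Rightarrow> 'e \<Rightarrow> 'f" where
  "chart_deriv c d f p = frechet_derivative (snd d \<circ> f \<circ> chart_inv c) (at (snd c p))"

text \<open>The neighbourhood mapped into the domain of d matters because coordinate maps are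
  arbitrary off their domains: only there do coordinate expressions compose.\<close>

definition chart_differentiable :: "('a::topological_space, 'e::real_normed_vector) chart \<Rightarrow>
    ('b::topological_space, 'f::real_normed_vector) chart \<Rightarrow> ('a \<Rightarrow> 'b) \<Rightarrow> 'a \<Rightarrow> bool" where
  "chart_differentiable c d f p \<longleftrightarrow> is_chart c \<and> is_chart d \<and> p \<in> fst c \<and>
     (\<exists>U. open U \<and> p \<in> U \<and> f ` U \<subseteq> fst d \<and> continuous_on U f) \<and>
     (snd d \<circ> f \<circ> chart_inv c) differentiable (at (snd c p))"

lemma chart_deriv_works:
  "chart_differentiable c d f p \<Longrightarrow> (snd d \<circ> f \<circ> chart_inv c has_derivative chart_deriv c d f p) (at (snd c p))"
  unfolding chart_differentiable_def chart_deriv_def by (simp add: frechet_derivative_works[symmetric])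

lemma bounded_linear_chart_deriv: "chart_differentiable c d f p \<Longrightarrow> bounded_linear (chart_deriv c d f p)"
  using chart_deriv_works has_derivative_bounded_linear by blast

lemma linear_chart_deriv: "chart_differentiable c d f p \<Longrightarrow> linear (chart_deriv c d f p)"
  using bounded_linear_chart_deriv bounded_linear.linear by blast

lemma chart_deriv_compose:
  assumes f: "chart_differentiable c d f p" and g: "chart_differentiable d e g (f p)"
  shows "chart_differentiable c e (g \<circ> f) p"
    and "chart_deriv c e (g \<circ> f) p v = chart_deriv d e g (f p) (chart_deriv c d f p v)"
proof -
  obtain U where U: "open U" "p \<in> U" "f ` U \<subseteq> fst d" "continuous_on U f"
    using f unfolding chart_differentiable_def by blast
  obtain U' where U': "open U'" "f p \<in> U'" "g ` U' \<subseteq> fst e" "continuous_on U' g"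
    using g unfolding chart_differentiable_def by blast
  have c: "is_chart c" "p \<in> fst c" and d: "is_chart d" and e: "is_chart e"
    using f g unfolding chart_differentiable_def by auto
  have [simp]: "chart_inv c (snd c p) = p" by (rule chart_inv_chart[OF c])
  have g': "(snd e \<circ> g \<circ> chart_inv d has_derivative chart_deriv d e g (f p)) (at ((snd d \<circ> f \<circ> chart_inv c) (snd c p)))"
    using chart_deriv_works[OF g] by simp
  have eq: "((snd e \<circ> g \<circ> chart_inv d) \<circ> (snd d \<circ> f \<circ> chart_inv c)) x = (snd e \<circ> (g \<circ> f) \<circ> chart_inv c) x"
    if "x \<in> snd c ` (U \<inter> fst c)" for x
    using that U(3) c(1) d by (auto simp: chart_inv_chart)
  have der: "(snd e \<circ> (g \<circ> f) \<circ> chart_inv c has_derivative chart_deriv d e g (f p) \<circ> chart_deriv c d f p) (at (snd c p))"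
    using diff_chain_at[OF chart_deriv_works[OF f] g']
    by (rule has_derivative_transform_within_open[OF _ open_chart_image_Int[OF c(1) U(1)]]) (use U(2) c(2) eq in auto)
  then show "chart_deriv c e (g \<circ> f) p v = chart_deriv d e g (f p) (chart_deriv c d f p v)"
    unfolding chart_deriv_def[of c e] by (simp add: frechet_derivative_at[symmetric])
  have "open (U \<inter> f -` U')" using continuous_open_preimage[OF U(4,1) U'(1)] .
  moreover have "continuous_on (U \<inter> f -` U') (g \<circ> f)"
    by (rule continuous_on_compose) (use U(4) U'(4) in \<open>auto intro: continuous_on_subset\<close>)
  moreover have "(g \<circ> f) ` (U \<inter> f -` U') \<subseteq> fst e" using U'(3) by auto
  ultimately show "chart_differentiable c e (g \<circ> f) p"
    unfolding chart_differentiable_def using c e der U(2) U'(2) by (auto simp: differentiable_def intro!: exI[of _ "U \<inter> f -` U'"])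
qed

lemma chart_deriv_cong:
  assumes "chart_differentiable c d f p" "open U" "p \<in> U" "\<And>q. q \<in> U \<Longrightarrow> f q = g q"
  shows "chart_deriv c d f p = chart_deriv c d g p"
  unfolding chart_deriv_def
proof (rule frechet_derivative_transform_within_open)
  have c: "is_chart c" "p \<in> fst c" using assms(1) unfolding chart_differentiable_def by auto
  show "open (snd c ` (U \<inter> fst c))" by (rule open_chart_image_Int[OF c(1) assms(2)])
  show "snd c p \<in> snd c ` (U \<inter> fst c)" using assms c by auto
  show "snd d \<circ> f \<circ> chart_inv c differentiable at (snd c p)" using assms(1) unfolding chart_differentiable_def by auto
  show "(snd d \<circ> f \<circ> chart_inv c) x = (snd d \<circ> g \<circ> chart_inv c) x" if "x \<in> snd c ` (U \<inter> fst c)" for x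
    using that assms(4) by (auto simp: chart_inv_chart[OF c(1)])
qed

text \<open>What a smooth atlas and a holomorphic atlas share for first-order calculus, so that the
  lemmas below serve the total space, the fibre and the base alike.\<close>

definition chart_compatible :: "('a::topological_space, 'e::real_normed_vector) chart set \<Rightarrow> bool" where
  "chart_compatible A \<longleftrightarrow> (\<forall>c\<in>A. is_chart c) \<and> (\<Union>c\<in>A. fst c) = UNIV \<and>
     (\<forall>c\<in>A. \<forall>d\<in>A. \<forall>p\<in>fst c \<inter> fst d. chart_differentiable c d id p)"

lemma chart_at_in:
  assumes "chart_compatible A"
  shows "chart_at A p \<in> A" "p \<in> fst (chart_at A p)" "is_chart (chart_at A p)"
proof -
  have "\<exists>c. c \<in> A \<and> p \<in> fst c" using assms unfolding chart_compatible_def by blast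
  then have "chart_at A p \<in> A \<and> p \<in> fst (chart_at A p)"
    unfolding chart_at_def by (rule someI_ex)
  then show "chart_at A p \<in> A" "p \<in> fst (chart_at A p)" "is_chart (chart_at A p)"
    using assms unfolding chart_compatible_def by auto
qed

lemma chart_compatibleD:
  "chart_compatible A \<Longrightarrow> c \<in> A \<Longrightarrow> d \<in> A \<Longrightarrow> p \<in> fst c \<Longrightarrow> p \<in> fst d \<Longrightarrow> chart_differentiable c d id p"
  "chart_compatible A \<Longrightarrow> c \<in> A \<Longrightarrow> is_chart c"
  unfolding chart_compatible_def by auto

lemma chart_compatible_smooth_atlas:
  assumes "smooth_atlas A"
  shows "chart_compatible A"
proof -
  have "chart_differentiable c d id p" if "c \<in> A" "d \<in> A" "p \<in> fst c" "p \<in> fst d" for c d p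
  proof -
    have ch: "is_chart c" "is_chart d" and sm: "smooth_on (snd d \<circ> chart_inv c) (snd c ` (fst c \<inter> fst d))"
      using assms that unfolding smooth_atlas_def smooth_transition_def by auto
    have "snd d \<circ> chart_inv c differentiable at (snd c p)"
      by (rule smooth_on_differentiable[OF sm]) (use that in auto)
    then show ?thesis
      unfolding chart_differentiable_def using ch that open_chart_domain[OF ch(2)]
      by (auto simp: o_def intro!: exI[of _ "fst d"])
  qed
  then show ?thesis using assms unfolding chart_compatible_def smooth_atlas_def by auto
qed

text \<open>Holomorphic transition maps are real differentiable with complex linear derivative. The
  second part is the reason why type (1, 0) and multiplication by \<i> do not depend on the
  chart.\<close>

lemma chart_compatible_riemann_surface:
  assumes "riemann_surface Z"
  shows "chart_compatible Z"
    and "c \<in> Z \<Longrightarrow> d \<in> Z \<Longrightarrow> b \<in> fst c \<Longrightarrow> b \<in> fst d \<Longrightarrow> \<exists>h. \<forall>v. chart_deriv c d id b v = h * v"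
proof -
  have *: "(snd d \<circ> chart_inv c) field_differentiable at (snd c p)"
    if "c \<in> Z" "d \<in> Z" "p \<in> fst c" "p \<in> fst d" for c d p
  proof -
    have ch: "is_chart c" "is_chart d" and hol: "(snd d \<circ> chart_inv c) holomorphic_on (snd c ` (fst c \<inter> fst d))"
      using assms that unfolding riemann_surface_def by auto
    have "open (snd c ` (fst d \<inter> fst c))"
      by (rule open_chart_image_Int[OF ch(1) open_chart_domain[OF ch(2)]])
    then show ?thesis
      using hol that by (intro holomorphic_on_imp_differentiable_at) (auto simp: Int_commute)
  qed
  have "chart_differentiable c d id p" if "c \<in> Z" "d \<in> Z" "p \<in> fst c" "p \<in> fst d" for c d p
  proof -
    have ch: "is_chart c" "is_chart d" using assms that unfolding riemann_surface_def by auto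
    have "snd d \<circ> chart_inv c differentiable at (snd c p)"
      using *[OF that] field_differentiable_imp_differentiable by blast
    then show ?thesis
      unfolding chart_differentiable_def using ch that open_chart_domain[OF ch(2)]
      by (auto simp: o_def intro!: exI[of _ "fst d"])
  qed
  then show "chart_compatible Z" using assms unfolding chart_compatible_def riemann_surface_def by auto
  assume cd: "c \<in> Z" "d \<in> Z" "b \<in> fst c" "b \<in> fst d"
  then obtain h where "((snd d \<circ> chart_inv c) has_field_derivative h) (at (snd c b))"
    using * unfolding field_differentiable_def by blast
  then have "chart_deriv c d id b = (\<lambda>v. h * v)"
    unfolding has_field_derivative_def chart_deriv_def by (simp add: frechet_derivative_at[symmetric])
  then show "\<exists>h. \<forall>v. chart_deriv c d id b v = h * v" by auto
qed

lemma chart_deriv_id_same: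
  assumes "is_chart c" "p \<in> fst c"
  shows "chart_deriv c c id p v = v"
proof -
  have "chart_deriv c c id p = frechet_derivative (\<lambda>x. x) (at (snd c p))"
    unfolding chart_deriv_def
    by (rule frechet_derivative_transform_within_open[symmetric, OF _ open_chart_image[OF assms(1)]])
       (use assms in \<open>auto simp: chart_chart_inv\<close>)
  then show ?thesis by simp
qed

lemma to_chart_eq: "to_chart A c p = chart_deriv (chart_at A p) c id p"
  and from_chart_eq: "from_chart A c p = chart_deriv c (chart_at A p) id p"
  and tangent_map_eq: "tangent_map A B f p = chart_deriv (chart_at A p) (chart_at B (f p)) f p"
  by (simp_all add: to_chart_def from_chart_def tangent_map_def chart_deriv_def o_def)

lemma to_from_chart:
  assumes "chart_compatible A" "c \<in> A" "p \<in> fst c"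
  shows "to_chart A c p (from_chart A c p v) = v" "from_chart A c p (to_chart A c p v) = v"
    "linear (to_chart A c p)" "linear (from_chart A c p)"
proof -
  note a = chart_at_in[OF assms(1), of p]
  have d: "chart_differentiable c (chart_at A p) id p" "chart_differentiable (chart_at A p) c id (id p)"
    "chart_differentiable (chart_at A p) c id p" "chart_differentiable c (chart_at A p) id (id p)"
    using chart_compatibleD(1)[OF assms(1)] assms a by auto
  show "to_chart A c p (from_chart A c p v) = v"
    using chart_deriv_compose(2)[where f = id and g = id, OF d(1,2), of v] chart_deriv_id_same[OF chart_compatibleD(2)[OF assms(1,2)] assms(3)]
    by (simp add: to_chart_eq from_chart_eq)
  show "from_chart A c p (to_chart A c p v) = v"
    using chart_deriv_compose(2)[where f = id and g = id, OF d(3,4), of v] chart_deriv_id_same[OF a(3,2)]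
    by (simp add: to_chart_eq from_chart_eq)
  show "linear (to_chart A c p)" "linear (from_chart A c p)"
    unfolding to_chart_eq from_chart_eq using d by (auto intro: linear_chart_deriv)
qed

lemma smooth_map_chart_differentiable:
  assumes "smooth_map A B U f" "open U" "p \<in> U" "c \<in> A" "d \<in> B" "is_chart c" "is_chart d" "p \<in> fst c" "f p \<in> fst d"
  shows "chart_differentiable c d f p"
proof -
  have o: "open (U \<inter> f -` fst d)"
    using assms(1) continuous_open_preimage[OF _ assms(2) open_chart_domain[OF assms(7)]]
    unfolding smooth_map_def by blast
  have "smooth_on (snd d \<circ> f \<circ> chart_inv c) (snd c ` (U \<inter> fst c \<inter> f -` fst d))"
    using assms(1,4,5) unfolding smooth_map_def by blast
  then have "(snd d \<circ> f \<circ> chart_inv c) differentiable (at (snd c p))"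
    by (rule smooth_on_differentiable) (use assms in auto)
  then show ?thesis
    unfolding chart_differentiable_def using assms o
    by (auto intro!: exI[of _ "U \<inter> f -` fst d"] simp: smooth_map_def intro: continuous_on_subset)
qed

text \<open>Both charts are connected with the preferred ones by the chain rule. This is the passage
  from pointwise data, whose reference chart jumps, to coordinate expressions that can be
  differentiated.\<close>

lemma chart_deriv_eq_tangent_map:
  assumes A: "chart_compatible A" "c \<in> A" "p \<in> fst c" and B: "chart_compatible B" "d \<in> B" "f p \<in> fst d"
    and f: "smooth_map A B U f" "open U" "p \<in> U"
  shows "chart_deriv c d f p v = to_chart B d (f p) (tangent_map A B f p (from_chart A c p v))"
    "tangent_map A B f p (from_chart A c p v) = from_chart B d (f p) (chart_deriv c d f p v)"
proof -
  note a = chart_at_in[OF A(1), of p] and b = chart_at_in[OF B(1), of "f p"]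
  note sd = smooth_map_chart_differentiable[OF f]
  have 1: "chart_differentiable c (chart_at A p) id p" using chart_compatibleD[OF A(1)] A a by blast
  have 2: "chart_differentiable (chart_at A p) (chart_at B (f p)) f (id p)"
    using sd[OF a(1) b(1) a(3) b(3) a(2) b(2)] by simp
  have 3: "chart_differentiable (chart_at B (f p)) d id (f p)" using chart_compatibleD[OF B(1)] B b by blast
  have 4: "chart_differentiable c (chart_at B (f p)) f p"
    using sd[OF A(2) b(1) chart_compatibleD(2)[OF A(1,2)] b(3) A(3) b(2)] .
  have "chart_deriv c d f p v = chart_deriv (chart_at B (f p)) d id (f p) (chart_deriv c (chart_at B (f p)) f p v)"
    using chart_deriv_compose(2)[where f = f and g = id, OF 4 3] by simp
  also have "chart_deriv c (chart_at B (f p)) f p v = chart_deriv (chart_at A p) (chart_at B (f p)) f p (chart_deriv c (chart_at A p) id p v)"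
    using chart_deriv_compose(2)[where f = id and g = f, OF 1 2] by simp
  finally show *: "chart_deriv c d f p v = to_chart B d (f p) (tangent_map A B f p (from_chart A c p v))"
    by (simp add: to_chart_eq from_chart_eq tangent_map_eq id_def)
  show "tangent_map A B f p (from_chart A c p v) = from_chart B d (f p) (chart_deriv c d f p v)"
    unfolding * using to_from_chart[OF B] by simp
qed

lemma linear_tangent_map:
  assumes A: "chart_compatible A" and B: "chart_compatible B" and f: "smooth_map A B U f" "open U" "p \<in> U"
  shows "linear (tangent_map A B f p)"
  unfolding tangent_map_eq
  using smooth_map_chart_differentiable[OF f chart_at_in(1)[OF A] chart_at_in(1)[OF B] chart_at_in(3)[OF A]
      chart_at_in(3)[OF B] chart_at_in(2)[OF A] chart_at_in(2)[OF B]]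
  by (rule linear_chart_deriv)

lemma tangent_map_compose:
  assumes A: "chart_compatible A" and B: "chart_compatible B" and C: "chart_compatible C"
    and f: "smooth_map A B U f" "open U" "p \<in> U" and g: "smooth_map B C U' g" "open U'" "f p \<in> U'"
  shows "tangent_map A C (g \<circ> f) p v = tangent_map B C g (f p) (tangent_map A B f p v)"
proof -
  note a = chart_at_in[OF A, of p] and b = chart_at_in[OF B, of "f p"] and c = chart_at_in[OF C, of "g (f p)"]
  show ?thesis
    unfolding tangent_map_eq o_apply[of g f p]
    by (rule chart_deriv_compose(2)[OF smooth_map_chart_differentiable[OF f a(1) b(1) a(3) b(3) a(2) b(2)]
          smooth_map_chart_differentiable[OF g b(1) c(1) b(3) c(3) b(2) c(2)]])
qed

section \<open>Smooth maps between manifolds\<close>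

lemma smooth_map_subset: "smooth_map A B U f \<Longrightarrow> U' \<subseteq> U \<Longrightarrow> smooth_map A B U' f"
  unfolding smooth_map_def by (auto intro: continuous_on_subset smooth_on_subset)

lemma smooth_map_cong:
  assumes "open U" "\<forall>c\<in>A. is_chart c" "\<forall>d\<in>B. is_chart d" "\<And>q. q \<in> U \<Longrightarrow> f q = g q" "smooth_map A B U f"
  shows "smooth_map A B U g"
  unfolding smooth_map_def
proof (intro conjI ballI)
  show "continuous_on U g" using assms(4,5) continuous_on_eq unfolding smooth_map_def by blast
  fix c d assume cd: "c \<in> A" "d \<in> B"
  have o: "open (U \<inter> f -` fst d)"
    using assms(5) continuous_open_preimage[OF _ assms(1) open_chart_domain] cd assms(3)
    unfolding smooth_map_def by blast
  have e: "U \<inter> fst c \<inter> g -` fst d = U \<inter> f -` fst d \<inter> fst c" using assms(4) by auto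
  have "smooth_on (snd d \<circ> f \<circ> chart_inv c) (snd c ` (U \<inter> f -` fst d \<inter> fst c))"
    using assms(5) cd unfolding smooth_map_def Int_assoc Int_commute[of "f -` fst d"] by simp
  then show "smooth_on (snd d \<circ> g \<circ> chart_inv c) (snd c ` (U \<inter> fst c \<inter> g -` fst d))"
    unfolding e
    by (rule iffD1[OF smooth_on_cong[OF open_chart_image_Int[OF _ o]], rotated 2])
       (use cd assms in \<open>auto simp: chart_inv_chart\<close>)
qed

text \<open>Different points may require different intermediate charts, so smoothness is checked
  near each point with a chart around f p. The Euclidean model of the middle manifold is inherited
  from \<open>smooth_on_compose\<close>.\<close>

lemma smooth_map_compose:
  fixes B :: "('b::topological_space, 'f::euclidean_space) chart set"
  assumes A: "\<forall>c\<in>A. is_chart c" and B: "chart_compatible B" and C: "\<forall>c\<in>C. is_chart c"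
    and f: "smooth_map A B U f" "open U" and g: "smooth_map B C U' g" "open U'" and fU: "f ` U \<subseteq> U'"
  shows "smooth_map A C U (g \<circ> f)"
  unfolding smooth_map_def
proof (intro conjI ballI)
  have cf: "continuous_on U f" and cg: "continuous_on U' g" using f g unfolding smooth_map_def by auto
  show cgf: "continuous_on U (g \<circ> f)"
    using cf cg fU by (intro continuous_on_compose) (auto intro: continuous_on_subset)
  fix c e assume c: "c \<in> A" and e: "e \<in> C"
  have chc: "is_chart c" "is_chart e" using A C c e by auto
  show "smooth_on (snd e \<circ> (g \<circ> f) \<circ> chart_inv c) (snd c ` (U \<inter> fst c \<inter> (g \<circ> f) -` fst e))"
  proof (rule smooth_on_locally)
    fix x assume "x \<in> snd c ` (U \<inter> fst c \<inter> (g \<circ> f) -` fst e)"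
    then obtain p where p: "p \<in> U" "p \<in> fst c" "g (f p) \<in> fst e" "x = snd c p" by auto
    define d where "d = chart_at B (f p)"
    have d: "d \<in> B" "f p \<in> fst d" "is_chart d" using chart_at_in[OF B] by (auto simp: d_def)
    define O1 where "O1 = U' \<inter> g -` fst e"
    have O1: "open O1" unfolding O1_def by (rule continuous_open_preimage[OF cg g(2) open_chart_domain[OF chc(2)]])
    define O2 where "O2 = U \<inter> f -` (O1 \<inter> fst d)"
    have O2: "open O2" unfolding O2_def
      by (rule continuous_open_preimage[OF cf f(2) open_Int[OF O1 open_chart_domain[OF d(3)]]])
    let ?S = "snd c ` (O2 \<inter> fst c)" and ?T = "snd d ` (O1 \<inter> fst d)"
    have S: "open ?S" by (rule open_chart_image_Int[OF chc(1) O2])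
    have T: "open ?T" by (rule open_chart_image_Int[OF d(3) O1])
    have "smooth_on (snd d \<circ> f \<circ> chart_inv c) (snd c ` (U \<inter> fst c \<inter> f -` fst d))"
      using f(1) c d(1) unfolding smooth_map_def by blast
    then have 1: "smooth_on (snd d \<circ> f \<circ> chart_inv c) ?S"
      by (rule smooth_on_subset) (auto simp: O2_def)
    have "smooth_on (snd e \<circ> g \<circ> chart_inv d) (snd d ` (U' \<inter> fst d \<inter> g -` fst e))"
      using g(1) e d(1) unfolding smooth_map_def by blast
    then have 2: "smooth_on (snd e \<circ> g \<circ> chart_inv d) ?T"
      by (rule smooth_on_subset) (auto simp: O1_def)
    have "(snd d \<circ> f \<circ> chart_inv c) ` ?S \<subseteq> ?T"
      using chc(1) by (auto simp: O2_def chart_inv_chart)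
    from smooth_on_compose[OF S T this 1 2]
    have "smooth_on (\<lambda>x. (snd e \<circ> g \<circ> chart_inv d) ((snd d \<circ> f \<circ> chart_inv c) x)) ?S" .
    then have "smooth_on (snd e \<circ> (g \<circ> f) \<circ> chart_inv c) ?S"
      by (rule iffD1[OF smooth_on_cong[OF S], rotated])
         (use chc(1) d(3) in \<open>auto simp: chart_inv_chart O2_def\<close>)
    moreover have "x \<in> ?S" using p d(2) fU by (auto simp: O2_def O1_def)
    ultimately show "\<exists>T. open T \<and> x \<in> T \<and> smooth_on (snd e \<circ> (g \<circ> f) \<circ> chart_inv c) T"
      using S by blast
  qed
qed

lemma chart_inv_self [simp]: "chart_inv (UNIV, \<lambda>x. x) = (\<lambda>x. x)"
  by (auto simp: chart_inv_def inv_into_def)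

lemma is_chart_self: "is_chart (UNIV, \<lambda>x. x)"
  by (simp add: is_chart_def homeomorphism_def)

lemma chart_compatible_self: "chart_compatible self_atlas"
  unfolding chart_compatible_def self_atlas_def chart_differentiable_def
  by (auto simp: is_chart_self o_def intro: exI[of _ UNIV])

lemma smooth_map_self: "smooth_map self_atlas self_atlas U f \<longleftrightarrow> smooth_on f U"
  unfolding smooth_map_def self_atlas_def
  by (auto simp: o_def smooth_on_continuous_on)

lemma smooth_map_chart:
  assumes "smooth_atlas A" "c \<in> A"
  shows "smooth_map A self_atlas (fst c) (snd c)"
  using assms unfolding smooth_map_def self_atlas_def smooth_atlas_def smooth_transition_def
  by (auto simp: continuous_on_chart o_def Int_commute)

lemma smooth_map_chart_inv:
  assumes "smooth_atlas A" "c \<in> A"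
  shows "smooth_map self_atlas A (snd c ` fst c) (chart_inv c)"
proof -
  have c: "is_chart c" using assms unfolding smooth_atlas_def by auto
  have e: "snd c ` fst c \<inter> chart_inv c -` fst d = snd c ` (fst c \<inter> fst d)" for d :: "('a, 'b) chart"
    using chart_image_Int[OF c, of "fst d"] by (simp add: Int_commute)
  show ?thesis
    using assms unfolding smooth_map_def self_atlas_def smooth_atlas_def smooth_transition_def
    by (auto simp: continuous_on_chart_inv e o_def)
qed

section \<open>Flat symplectic fibre bundles\<close>

abbreviation prod_chart :: "('a, 'e) chart \<Rightarrow> ('b, 'f) chart \<Rightarrow> ('a \<times> 'b, 'e \<times> 'f) chart" where
  "prod_chart c d \<equiv> (fst c \<times> fst d, map_prod (snd c) (snd d))"

lemma chart_inv_prod: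
  assumes "is_chart c" "is_chart d" "x \<in> snd c ` fst c" "y \<in> snd d ` fst d"
  shows "chart_inv (prod_chart c d) (x, y) = (chart_inv c x, chart_inv d y)"
proof -
  have "inj_on (map_prod (snd c) (snd d)) (fst c \<times> fst d)"
    by (rule inj_onI) (use chart_eqD[OF assms(1)] chart_eqD[OF assms(2)] in auto)
  moreover have "map_prod (snd c) (snd d) (chart_inv c x, chart_inv d y) = (x, y)"
    using assms by (simp add: chart_chart_inv)
  ultimately show ?thesis
    using assms unfolding chart_inv_def[of "prod_chart c d"]
    by (intro inv_into_f_eq) (auto simp: chart_inv_in)
qed

lemma is_chart_prod:
  assumes "is_chart c" "is_chart d"
  shows "is_chart (prod_chart c d)"
proof -
  have im: "map_prod (snd c) (snd d) ` (fst c \<times> fst d) = (snd c ` fst c) \<times> (snd d ` fst d)"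
    by auto
  have "homeomorphism (fst c \<times> fst d) (snd c ` fst c \<times> snd d ` fst d)
     (map_prod (snd c) (snd d)) (map_prod (chart_inv c) (chart_inv d))"
    unfolding homeomorphism_def
  proof (intro conjI)
    show "continuous_on (fst c \<times> fst d) (map_prod (snd c) (snd d))"
      unfolding map_prod_def split_def
      by (intro continuous_on_Pair continuous_on_compose2[OF continuous_on_chart] assms continuous_on_fst
          continuous_on_snd continuous_on_id) auto
    show "continuous_on (snd c ` fst c \<times> snd d ` fst d) (map_prod (chart_inv c) (chart_inv d))"
      unfolding map_prod_def split_def
      by (intro continuous_on_Pair continuous_on_compose2[OF continuous_on_chart_inv] assms continuous_on_fst
          continuous_on_snd continuous_on_id) auto
  qed (use assms in \<open>force simp: chart_inv_chart chart_chart_inv chart_inv_in image_iff\<close>)+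
  then have "homeomorphism (fst c \<times> fst d) (snd c ` fst c \<times> snd d ` fst d)
     (map_prod (snd c) (snd d)) (chart_inv (prod_chart c d))"
    by (rule homeomorphism_cong) (use chart_inv_prod[OF assms] in auto)
  then show ?thesis
    unfolding is_chart_def using assms by (simp add: im open_Times open_chart_domain open_chart_image)
qed

lemma chart_differentiable_Pair:
  assumes "is_chart c" "is_chart d" "p \<in> fst c" "q \<in> fst d"
  shows "chart_differentiable d (prod_chart c d) (\<lambda>y. (p, y)) q"
    and "chart_differentiable c (prod_chart c d) (\<lambda>x. (x, q)) p"
proof -
  have "((\<lambda>y. (snd c p, y)) has_derivative (\<lambda>v. (0, v))) (at (snd d q))"
    by (auto intro!: derivative_eq_intros)
  then have "(snd (prod_chart c d) \<circ> (\<lambda>y. (p, y)) \<circ> chart_inv d has_derivative (\<lambda>v. (0, v))) (at (snd d q))"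
    by (rule has_derivative_transform_within_open[OF _ open_chart_image[OF assms(2)]])
       (use assms in \<open>auto simp: chart_inv_chart\<close>)
  moreover have "((\<lambda>y. (y, snd d q)) has_derivative (\<lambda>v. (v, 0))) (at (snd c p))"
    by (auto intro!: derivative_eq_intros)
  then have "(snd (prod_chart c d) \<circ> (\<lambda>y. (y, q)) \<circ> chart_inv c has_derivative (\<lambda>v. (v, 0))) (at (snd c p))"
    by (rule has_derivative_transform_within_open[OF _ open_chart_image[OF assms(1)]])
       (use assms in \<open>auto simp: chart_inv_chart\<close>)
  ultimately show "chart_differentiable d (prod_chart c d) (\<lambda>y. (p, y)) q"
    "chart_differentiable c (prod_chart c d) (\<lambda>x. (x, q)) p"
    unfolding chart_differentiable_def using assms is_chart_prod[OF assms(1,2)]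
    by (auto simp: differentiable_def intro!: exI[of _ "fst d"] exI[of _ "fst c"] open_chart_domain continuous_intros)
qed

lemma smooth_map_snd_prod_atlas:
  fixes f :: "'a::topological_space \<Rightarrow> 'b::topological_space" and h :: "'a \<Rightarrow> 'c::topological_space"
  assumes A: "chart_compatible A" and B: "chart_compatible B" and C: "chart_compatible C"
    and U: "open U" and f: "smooth_map A (prod_atlas B C) U (\<lambda>p. (f p, h p))"
  shows "smooth_map A C U h"
  unfolding smooth_map_def
proof (intro conjI ballI)
  have cont: "continuous_on U (\<lambda>p. (f p, h p))" using f unfolding smooth_map_def by blast
  then show ch: "continuous_on U h" using continuous_on_snd[OF cont] by simp
  fix c d assume c: "c \<in> A" and d: "d \<in> C"
  show "smooth_on (snd d \<circ> h \<circ> chart_inv c) (snd c ` (U \<inter> fst c \<inter> h -` fst d))"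
  proof (rule smooth_on_locally)
    fix x assume "x \<in> snd c ` (U \<inter> fst c \<inter> h -` fst d)"
    then obtain p where p: "p \<in> U" "p \<in> fst c" "h p \<in> fst d" "x = snd c p" by auto
    define b where "b = chart_at B (f p)"
    have b: "b \<in> B" "f p \<in> fst b" "is_chart b" using chart_at_in[OF B] by (auto simp: b_def)
    have dc: "is_chart d" "is_chart c" using chart_compatibleD(2) A C c d by blast+
    define W where "W = U \<inter> (\<lambda>p. (f p, h p)) -` (fst b \<times> fst d)"
    have W: "open W" unfolding W_def
      by (rule continuous_open_preimage[OF cont U open_Times[OF open_chart_domain[OF b(3)] open_chart_domain[OF dc(1)]]])
    have "prod_chart b d \<in> prod_atlas B C" using b d unfolding prod_atlas_def by blast
    then have "smooth_on (snd (prod_chart b d) \<circ> (\<lambda>p. (f p, h p)) \<circ> chart_inv c)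
        (snd c ` (U \<inter> fst c \<inter> (\<lambda>p. (f p, h p)) -` fst (prod_chart b d)))"
      using f c unfolding smooth_map_def by blast
    then have "smooth_on (snd (prod_chart b d) \<circ> (\<lambda>p. (f p, h p)) \<circ> chart_inv c) (snd c ` (W \<inter> fst c))"
      by (rule smooth_on_subset) (auto simp: W_def)
    from smooth_on_bounded_linear_compose[OF bounded_linear_snd open_chart_image_Int[OF dc(2) W] this]
    have "smooth_on (snd d \<circ> h \<circ> chart_inv c) (snd c ` (W \<inter> fst c))"
      by (simp add: o_def)
    moreover have "x \<in> snd c ` (W \<inter> fst c)" using p b by (auto simp: W_def)
    ultimately show "\<exists>T. open T \<and> x \<in> T \<and> smooth_on (snd d \<circ> h \<circ> chart_inv c) T"
      using open_chart_image_Int[OF dc(2) W] by blast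
  qed
qed

section \<open>The bundle and its horizontal splitting\<close>

locale flat_bundle =
  fixes A :: "('x::topological_space, 'e::euclidean_space) chart set"
    and Z :: "('b::topological_space, complex) chart set"
    and AF :: "('f::topological_space, 'k::real_normed_vector) chart set"
    and \<pi> :: "'x \<Rightarrow> 'b" and \<sigma> :: "'f \<Rightarrow> 'k form" and \<omega> :: "'x \<Rightarrow> 'e \<Rightarrow> 'e \<Rightarrow> real" and N :: "'x \<Rightarrow> 'e set"
  assumes atlas: "smooth_atlas A"
    and surface: "riemann_surface Z"
    and flat: "flat_symplectic_fibre_bundle A Z \<pi> AF \<sigma> \<omega> N"
begin

abbreviation "d\<pi> \<equiv> tangent_map A Z \<pi>"

lemma symplectic_bundle: "symplectic_fibre_bundle A Z \<pi> AF \<sigma> \<omega>"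
  and horizontal: "horizontal_distribution A Z \<pi> N"
  and integrable: "integrable_distribution A N"
  and transport: "parallel_transport_preserves A \<pi> N \<omega>"
  using flat unfolding flat_symplectic_fibre_bundle_def by auto

lemma smooth_\<pi>: "smooth_map A Z UNIV \<pi>"
  and fibre_atlas: "smooth_atlas AF"
  and fibre_symplectic: "symplectic_form AF \<sigma>"
  and nondegenerate: "nondegenerate_2form_along A (vertical A Z \<pi>) \<omega>"
  using symplectic_bundle unfolding symplectic_fibre_bundle_def by auto

lemma compat: "chart_compatible A" "chart_compatible Z" "chart_compatible AF"
  using chart_compatible_smooth_atlas[OF atlas] chart_compatible_smooth_atlas[OF fibre_atlas]
    chart_compatible_riemann_surface(1)[OF surface] by auto

lemma linear_d\<pi>: "linear (d\<pi> p)"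
  by (rule linear_tangent_map[OF compat(1,2) smooth_\<pi>]) auto

lemma local_trivialization:
  obtains U \<Phi> g where "open U" "b \<in> U" "smooth_map A AF (\<pi> -` U) \<Phi>" "open (\<pi> -` U)"
    "smooth_map (prod_atlas Z AF) A (U \<times> UNIV) g"
    "\<And>p. \<pi> p \<in> U \<Longrightarrow> g (\<pi> p, \<Phi> p) = p"
    "\<And>b' y. b' \<in> U \<Longrightarrow> \<pi> (g (b', y)) = b'" "\<And>b' y. b' \<in> U \<Longrightarrow> \<Phi> (g (b', y)) = y"
    "\<And>p u v. \<pi> p \<in> U \<Longrightarrow> u \<in> vertical A Z \<pi> p \<Longrightarrow> v \<in> vertical A Z \<pi> p \<Longrightarrow>
      \<sigma> (\<Phi> p) [tangent_map A AF \<Phi> p u, tangent_map A AF \<Phi> p v] = of_real (\<omega> p u v)"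
proof -
  have "continuous_on UNIV \<pi>" using smooth_\<pi> unfolding smooth_map_def by blast
  then have o: "open (\<pi> -` U)" if "open U" for U using that open_vimage by blast
  obtain U \<Phi> g where *: "open U" "b \<in> U"
        "smooth_map A (prod_atlas Z AF) (\<pi> -` U) (\<lambda>p. (\<pi> p, \<Phi> p))"
        "smooth_map (prod_atlas Z AF) A (U \<times> UNIV) g"
        "\<forall>p. \<pi> p \<in> U \<longrightarrow> g (\<pi> p, \<Phi> p) = p"
        "\<forall>b'\<in>U. \<forall>y. \<pi> (g (b', y)) = b' \<and> \<Phi> (g (b', y)) = y"
        "\<forall>p\<in>\<pi> -` U. \<forall>u\<in>vertical A Z \<pi> p. \<forall>v\<in>vertical A Z \<pi> p.
           \<sigma> (\<Phi> p) [tangent_map A AF \<Phi> p u, tangent_map A AF \<Phi> p v] = of_real (\<omega> p u v)"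
    using symplectic_bundle unfolding symplectic_fibre_bundle_def
    by (elim conjE allE[of _ b] exE) (rule that; assumption)
  have "smooth_map A AF (\<pi> -` U) \<Phi>"
    by (rule smooth_map_snd_prod_atlas[OF compat o[OF *(1)] *(3)])
  then show thesis by (rule that[OF *(1,2) _ o[OF *(1)] *(4)]) (use * in auto)
qed

text \<open>The trivialization and its inverse g are differentiated at p: E is the derivative of
  \<Phi>, G that of y \<mapsto> g (\<pi> p, y) and L that of b \<mapsto> g (b, \<Phi> p). E and G
  make the model space of the fibre a retract of the Euclidean space \<open>'e\<close>, and L shows
  that the projection is a submersion.\<close>

lemma trivialization_derivatives:
  obtains E :: "'e \<Rightarrow> 'k" and G :: "'k \<Rightarrow> 'e" and L :: "complex \<Rightarrow> 'e"
  where "bounded_linear E" "bounded_linear G" "\<And>k. E (G k) = k" "\<And>z. d\<pi> p (L z) = z"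
proof -
  obtain U \<Phi> g where U: "open U" "\<pi> p \<in> U" and \<Phi>: "smooth_map A AF (\<pi> -` U) \<Phi>" and oU: "open (\<pi> -` U)"
    and g: "smooth_map (prod_atlas Z AF) A (U \<times> UNIV) g" "\<And>p. \<pi> p \<in> U \<Longrightarrow> g (\<pi> p, \<Phi> p) = p"
    and inv: "\<And>b' y. b' \<in> U \<Longrightarrow> \<pi> (g (b', y)) = b'" "\<And>b' y. b' \<in> U \<Longrightarrow> \<Phi> (g (b', y)) = y"
    by (rule local_trivialization[of "\<pi> p"]) (rule that)
  define c where "c = chart_at A p"
  define z where "z = chart_at Z (\<pi> p)"
  define e where "e = chart_at AF (\<Phi> p)"
  have c: "c \<in> A" "p \<in> fst c" "is_chart c" using chart_at_in[OF compat(1)] by (auto simp: c_def)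
  have z: "z \<in> Z" "\<pi> p \<in> fst z" "is_chart z" using chart_at_in[OF compat(2)] by (auto simp: z_def)
  have e: "e \<in> AF" "\<Phi> p \<in> fst e" "is_chart e" using chart_at_in[OF compat(3)] by (auto simp: e_def)
  have gp: "g (\<pi> p, \<Phi> p) = p" using g(2) U(2) by simp
  have pz: "prod_chart z e \<in> prod_atlas Z AF" using z(1) e(1) unfolding prod_atlas_def by blast
  have dg: "chart_differentiable (prod_chart z e) c g (\<pi> p, \<Phi> p)"
    by (rule smooth_map_chart_differentiable[OF g(1)])
       (use U c z(2) e(2) gp is_chart_prod[OF z(3) e(3)] pz in \<open>simp_all add: open_Times\<close>)
  have d\<Phi>: "chart_differentiable c e \<Phi> p"
    by (rule smooth_map_chart_differentiable[OF \<Phi> oU]) (use U c e in auto)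
  have d\<pi>: "chart_differentiable c z \<pi> p"
    by (rule smooth_map_chart_differentiable[OF smooth_\<pi>]) (use c z in auto)
  note P = chart_differentiable_Pair[OF z(3) e(3) z(2) e(2)]
  let ?gy = "g \<circ> (\<lambda>y. (\<pi> p, y))" and ?gb = "g \<circ> (\<lambda>b. (b, \<Phi> p))"
  have dy: "chart_differentiable e c ?gy (\<Phi> p)" and db: "chart_differentiable z c ?gb (\<pi> p)"
    using chart_deriv_compose(1)[where g = g, OF P(1) dg] chart_deriv_compose(1)[where g = g, OF P(2) dg] by auto
  have d1: "chart_differentiable c e \<Phi> (?gy (\<Phi> p))" and d2: "chart_differentiable c z \<pi> (?gb (\<pi> p))"
    using d\<Phi> d\<pi> gp by auto
  have "chart_deriv c e \<Phi> p (chart_deriv e c ?gy (\<Phi> p) k) = k" for k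
  proof -
    have "chart_deriv e e (\<Phi> \<circ> ?gy) (\<Phi> p) = chart_deriv e e id (\<Phi> p)"
      by (rule chart_deriv_cong[OF chart_deriv_compose(1)[where f = ?gy and g = \<Phi>, OF dy d1], of UNIV]) (auto simp: inv U)
    then show ?thesis
      using chart_deriv_compose(2)[where f = ?gy and g = \<Phi>, OF dy d1, of k] chart_deriv_id_same[OF e(3,2)] gp by simp
  qed
  moreover have "d\<pi> p (chart_deriv z c ?gb (\<pi> p) w) = w" for w
  proof -
    have "chart_deriv z z (\<pi> \<circ> ?gb) (\<pi> p) = chart_deriv z z id (\<pi> p)"
      by (rule chart_deriv_cong[OF chart_deriv_compose(1)[where f = ?gb and g = \<pi>, OF db d2] U(1,2)]) (auto simp: inv)
    then show ?thesis
      using chart_deriv_compose(2)[where f = ?gb and g = \<pi>, OF db d2, of w] chart_deriv_id_same[OF z(3,2)] gp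
      by (simp add: tangent_map_eq c_def z_def)
  qed
  ultimately show thesis
    using that bounded_linear_chart_deriv[OF d\<Phi>] bounded_linear_chart_deriv[OF dy] by blast
qed

lemma vertical_iff: "v \<in> vertical A Z \<pi> p \<longleftrightarrow> d\<pi> p v = 0"
  by (simp add: vertical_def)

lemma subspace_N: "subspace (N p)"
  using integrable unfolding integrable_distribution_def by blast

lemma N_vertical: "v \<in> N p \<Longrightarrow> d\<pi> p v = 0 \<Longrightarrow> v = 0"
  using horizontal unfolding horizontal_distribution_def vertical_iff[symmetric] by blast

lemma horizontal_lift: "\<exists>n\<in>N p. d\<pi> p n = z"
proof -
  obtain L where "d\<pi> p (L z) = z" using trivialization_derivatives[of p] by metis
  moreover obtain u v where "u \<in> vertical A Z \<pi> p" "v \<in> N p" "L z = u + v"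
    using horizontal unfolding horizontal_distribution_def by metis
  ultimately show ?thesis using linear_add[OF linear_d\<pi>] vertical_iff by force
qed

definition hlift :: "'x \<Rightarrow> complex \<Rightarrow> 'e" where
  "hlift p z = (SOME n. n \<in> N p \<and> d\<pi> p n = z)"

lemma hlift: "hlift p z \<in> N p" "d\<pi> p (hlift p z) = z"
  using someI_ex[of "\<lambda>n. n \<in> N p \<and> d\<pi> p n = z"] horizontal_lift[of p z] unfolding hlift_def by auto

lemma hlift_unique: "n \<in> N p \<Longrightarrow> n = hlift p (d\<pi> p n)"
  using N_vertical[of "n - hlift p (d\<pi> p n)" p] hlift[of p] subspace_diff[OF subspace_N, of n p]
    linear_diff[OF linear_d\<pi>, of p] by auto

lemma linear_hlift: "linear (hlift p)"
proof
  show "hlift p (x + y) = hlift p x + hlift p y" for x y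
    using hlift_unique[of "hlift p x + hlift p y" p] hlift subspace_add[OF subspace_N] by (simp add: linear_add[OF linear_d\<pi>])
  show "hlift p (r *\<^sub>R x) = r *\<^sub>R hlift p x" for r x
    using hlift_unique[of "r *\<^sub>R hlift p x" p] hlift subspace_scale[OF subspace_N] by (simp add: linear_scale[OF linear_d\<pi>])
qed

definition vproj :: "'x \<Rightarrow> 'e \<Rightarrow> 'e" where
  "vproj p v = v - hlift p (d\<pi> p v)"

lemma linear_vproj: "linear (vproj p)"
  unfolding vproj_def[abs_def]
  using linear_compose_sub[OF linear_id linear_compose[OF linear_d\<pi> linear_hlift]] by (simp add: o_def id_def)

lemma vproj_vertical: "vproj p v \<in> vertical A Z \<pi> p"
  by (simp add: vertical_iff vproj_def linear_diff[OF linear_d\<pi>] hlift)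

lemma vproj_of_vertical: "v \<in> vertical A Z \<pi> p \<Longrightarrow> vproj p v = v"
  by (simp add: vertical_iff vproj_def linear_0[OF linear_hlift])

definition hor_omega :: "'x \<Rightarrow> 'e \<Rightarrow> 'e \<Rightarrow> real" where
  "hor_omega p u v = \<omega> p (vproj p u) (vproj p v)"

lemma \<omega>_bilinear:
  assumes "u \<in> vertical A Z \<pi> p" "v \<in> vertical A Z \<pi> p" "w \<in> vertical A Z \<pi> p"
  shows "\<omega> p (a *\<^sub>R u + b *\<^sub>R v) w = a * \<omega> p u w + b * \<omega> p v w" "\<omega> p u v = - \<omega> p v u"
  using conjunct1[OF nondegenerate[unfolded nondegenerate_2form_along_def],
      THEN spec, THEN bspec, OF assms(1), THEN bspec, OF assms(2), THEN bspec, OF assms(3), THEN spec, THEN spec, of a b]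
  by auto

lemma hor_omega_skew: "hor_omega p u v = - hor_omega p v u"
  unfolding hor_omega_def by (rule \<omega>_bilinear(2)[OF vproj_vertical vproj_vertical vproj_vertical])

lemma linear_hor_omega: "linear (\<lambda>u. hor_omega p u v)" "linear (hor_omega p u)"
proof -
  show 1: "linear (\<lambda>u. hor_omega p u v)" for v
  proof
    show "hor_omega p (x + y) v = hor_omega p x v + hor_omega p y v" for x y
      using \<omega>_bilinear(1)[OF vproj_vertical vproj_vertical vproj_vertical, of p 1 x 1 y v]
      by (simp add: hor_omega_def linear_add[OF linear_vproj])
    show "hor_omega p (r *\<^sub>R x) v = r *\<^sub>R hor_omega p x v" for x r
      using \<omega>_bilinear(1)[OF vproj_vertical vproj_vertical vproj_vertical, of p r x 0 x v]
      by (simp add: hor_omega_def linear_scale[OF linear_vproj])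
  qed
  have "hor_omega p u = (\<lambda>v. - hor_omega p v u)" using hor_omega_skew by blast
  then show "linear (hor_omega p u)" using linear_compose_neg[OF 1] by simp
qed

end

section \<open>Functions and curves as maps between manifolds\<close>

lemma chart_at_self [simp]: "chart_at self_atlas x = (UNIV, \<lambda>x. x)"
  unfolding chart_at_def self_atlas_def by (rule some_equality) auto

lemma tangent_map_self: "tangent_map self_atlas self_atlas f x = frechet_derivative f (at x)"
  by (simp add: tangent_map_def o_def)

lemma tangent_map_chart: "tangent_map A self_atlas (snd c) p = to_chart A c p"
  by (simp add: tangent_map_def to_chart_def o_def)

lemma tangent_map_chart_inv:
  assumes "is_chart c" "x \<in> snd c ` fst c"
  shows "tangent_map self_atlas A (chart_inv c) x = from_chart A c (chart_inv c x)"
  using chart_chart_inv[OF assms] by (simp add: tangent_map_def from_chart_def o_def)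

lemma tangent_map_ident:
  assumes "chart_compatible A" "open U" "p \<in> U" "\<And>q. q \<in> U \<Longrightarrow> f q = q"
  shows "tangent_map A A f p v = v"
proof -
  note a = chart_at_in[OF assms(1), of p]
  have d: "chart_differentiable (chart_at A p) (chart_at A p) id p"
    using chart_compatibleD(1)[OF assms(1)] a by blast
  have "chart_deriv (chart_at A p) (chart_at A p) id p = chart_deriv (chart_at A p) (chart_at A p) f p"
    by (rule chart_deriv_cong[OF d assms(2,3)]) (simp add: assms(4))
  then show ?thesis
    unfolding tangent_map_eq using chart_deriv_id_same[OF a(3,2)] assms(3,4) by simp
qed

lemma velocity_eq:
  assumes "chart_compatible A" "smooth_map self_atlas A U \<gamma>" "open U" "t \<in> U"
  shows "velocity A \<gamma> t = tangent_map self_atlas A \<gamma> t 1"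
proof -
  have "chart_differentiable (UNIV, \<lambda>x. x) (chart_at A (\<gamma> t)) \<gamma> t"
    by (rule smooth_map_chart_differentiable[OF assms(2-4)])
       (use chart_at_in[OF assms(1)] in \<open>auto simp: self_atlas_def is_chart_self\<close>)
  then have "snd (chart_at A (\<gamma> t)) \<circ> \<gamma> differentiable (at t)"
    unfolding chart_differentiable_def by (simp add: o_def)
  then have "frechet_derivative (snd (chart_at A (\<gamma> t)) \<circ> \<gamma>) (at t)
      = (\<lambda>r. r *\<^sub>R vector_derivative (snd (chart_at A (\<gamma> t)) \<circ> \<gamma>) (at t))"
    by (rule frechet_derivative_eq_vector_derivative)
  then show ?thesis by (simp add: velocity_def tangent_map_def o_def)
qed

text \<open>Cramer's rule in the real plane: \<open>Im (cnj a * b)\<close> is the determinant with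
  columns a and b. The coefficients depend smoothly on a, b and t wherever the determinant is
  nonzero.\<close>

lemma complex_basis_solve:
  assumes "Im (cnj a * b) \<noteq> 0"
  shows "(Im (cnj t * b) / Im (cnj a * b)) *\<^sub>R a + (Im (cnj a * t) / Im (cnj a * b)) *\<^sub>R b = t"
proof -
  have "Im (cnj t * b) * Re a + Im (cnj a * t) * Re b = Im (cnj a * b) * Re t"
    "Im (cnj t * b) * Im a + Im (cnj a * t) * Im b = Im (cnj a * b) * Im t"
    by (simp_all add: algebra_simps)
  moreover have "(p / d) * x + (q / d) * y = w" if "p * x + q * y = d * w" "d \<noteq> 0" for p q x y d w :: real
    using that by (simp add: add_divide_distrib[symmetric])
  ultimately have
    "Im (cnj t * b) / Im (cnj a * b) * Re a + Im (cnj a * t) / Im (cnj a * b) * Re b = Re t"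
    "Im (cnj t * b) / Im (cnj a * b) * Im a + Im (cnj a * t) / Im (cnj a * b) * Im b = Im t"
    using assms by blast+
  then show ?thesis by (intro complex_eqI) (simp_all only: plus_complex.sel scaleR_complex.sel)
qed

context flat_bundle
begin

text \<open>In the flat chart \<open>c\<close> the leaves are the translates of \<open>W\<close>. Replacing the \<open>W\<close>-component of
  the coordinates by the projection to \<open>B\<close> turns the fibres into affine subspaces as well,
  without moving the leaves.\<close>

lemma straightening:
  obtains S h \<kappa> x0 r R and lam :: "'e \<Rightarrow> complex" where
    "open S" "p0 \<in> S" "smooth_map A self_atlas S h" "r > 0" "h ` S \<subseteq> ball x0 r" "h p0 = x0"
    "smooth_map self_atlas A (ball x0 r) \<kappa>" "\<kappa> ` ball x0 r \<subseteq> S"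
    "\<And>q. q \<in> S \<Longrightarrow> \<kappa> (h q) = q" "\<And>y. y \<in> ball x0 r \<Longrightarrow> h (\<kappa> y) = y"
    "bounded_linear R" "linear lam" "\<And>v. lam (R v) = lam v" "\<And>v. lam v = 0 \<Longrightarrow> R v = 0"
    "\<And>y y'. y \<in> ball x0 r \<Longrightarrow> y' \<in> ball x0 r \<Longrightarrow> lam y = lam y' \<Longrightarrow> \<pi> (\<kappa> y) = \<pi> (\<kappa> y')"
    "\<And>q u. q \<in> S \<Longrightarrow> d\<pi> q u = 0 \<longleftrightarrow> lam (tangent_map A self_atlas h q u) = 0"
    "\<And>q u. q \<in> S \<Longrightarrow> u \<in> N q \<Longrightarrow> R (tangent_map A self_atlas h q u) = tangent_map A self_atlas h q u"
    "\<And>y n. y \<in> ball x0 r \<Longrightarrow> R n = n \<Longrightarrow> tangent_map self_atlas A \<kappa> y n \<in> N (\<kappa> y)"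
proof -
  obtain c W where c: "c \<in> A" "p0 \<in> fst c" and W: "\<And>q. q \<in> fst c \<Longrightarrow> to_chart A c q ` N q = W"
    using conjunct2[OF integrable[unfolded integrable_distribution_def], THEN spec, of p0]
    by (elim bexE conjE exE) (rule that, assumption, assumption, erule (1) bspec)
  have chc: "is_chart c" using chart_compatibleD(2)[OF compat(1) c(1)] .
  define z where "z = chart_at Z (\<pi> p0)"
  have z: "z \<in> Z" "\<pi> p0 \<in> fst z" "is_chart z" using chart_at_in[OF compat(2)] by (auto simp: z_def)
  note tf = to_from_chart[OF compat(1) c(1)] and tfz = to_from_chart[OF compat(2) z(1)]
  define F where "F = snd z \<circ> \<pi> \<circ> chart_inv c"
  define DF where "DF x = frechet_derivative F (at x)" for x
  define Q where "Q = snd c ` (\<pi> -` fst z \<inter> fst c)"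
  define x0 where "x0 = snd c p0"
  have "open (\<pi> -` fst z)"
    using smooth_\<pi> open_vimage[OF open_chart_domain[OF z(3)]] unfolding smooth_map_def by blast
  then have Q: "open Q" unfolding Q_def by (rule open_chart_image_Int[OF chc])
  have x0Q: "x0 \<in> Q" unfolding Q_def x0_def using c z by auto
  have Qc: "chart_inv c x \<in> fst c" "\<pi> (chart_inv c x) \<in> fst z" "snd c (chart_inv c x) = x" "x \<in> snd c ` fst c" if "x \<in> Q" for x
    using that chc unfolding Q_def by (auto simp: chart_inv_chart)
  have "smooth_on F (snd c ` (UNIV \<inter> fst c \<inter> \<pi> -` fst z))"
    using smooth_\<pi> c(1) z(1) unfolding smooth_map_def F_def by blast
  then have F: "smooth_on F Q" by (simp add: Q_def Int_commute)
  have DF: "DF x v = to_chart Z z (\<pi> (chart_inv c x)) (d\<pi> (chart_inv c x) (from_chart A c (chart_inv c x) v))"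
    if "x \<in> Q" for x v
    using chart_deriv_eq_tangent_map(1)[OF compat(1) c(1) Qc(1)[OF that] compat(2) z(1) Qc(2)[OF that] smooth_\<pi>, of v]
      Qc(3)[OF that] by (simp add: chart_deriv_def DF_def F_def)
  have linDF: "linear (DF x)" if "x \<in> Q" for x
    unfolding DF_def using smooth_on_has_derivative[OF F that] has_derivative_linear by blast
  have DF0: "DF x v = 0 \<longleftrightarrow> d\<pi> (chart_inv c x) (from_chart A c (chart_inv c x) v) = 0" if "x \<in> Q" for x v
    unfolding DF[OF that] using tfz[OF Qc(2)[OF that]] by (metis linear_0)
  have cx0: "chart_inv c x0 = p0" unfolding x0_def using chart_inv_chart[OF chc c(2)] .
  \<comment> \<open>T is the horizontal lift at \<open>p0\<close> in coordinates, a right inverse of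
    \<open>lam\<close> with image in W. Hence R is the projection onto W along the kernel of
    \<open>lam\<close>.\<close>
  define lam where "lam = DF x0"
  define T where "T t = to_chart A c p0 (hlift p0 (from_chart Z z (\<pi> p0) t))" for t
  define R where "R v = T (lam v)" for v
  have linlam: "linear lam" unfolding lam_def by (rule linDF[OF x0Q])
  have linT: "linear T" unfolding T_def[abs_def]
    using linear_compose[OF linear_compose[OF tfz(4)[OF z(2)] linear_hlift] tf(3)[OF c(2)]] by (simp add: o_def)
  have blT: "bounded_linear T" and bllam: "bounded_linear lam"
    using linT linlam by (auto simp: linear_conv_bounded_linear)
  have blR: "bounded_linear R" unfolding R_def[abs_def] using bounded_linear_compose[OF blT bllam] .
  have linR: "linear R" using blR bounded_linear.linear by blast
  have lamT: "lam (T t) = t" for t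
    unfolding lam_def DF[OF x0Q] cx0 T_def tf[OF c(2)] hlift using tfz[OF z(2)] by simp
  have TW: "T t \<in> W" for t unfolding T_def W[OF c(2), symmetric] using hlift by blast
  have subW: "subspace W" unfolding W[OF c(2), symmetric]
    by (rule linear_subspace_image[OF tf(3)[OF c(2)] subspace_N])
  have inW: "w = 0" if "w \<in> W" "lam w = 0" for w
  proof -
    obtain n where n: "n \<in> N p0" "w = to_chart A c p0 n" using \<open>w \<in> W\<close> W[OF c(2)] by blast
    then have "d\<pi> p0 n = 0" using \<open>lam w = 0\<close> DF0[OF x0Q] tf[OF c(2)] unfolding lam_def cx0 by simp
    then have "n = 0" using N_vertical n(1) by blast
    then show ?thesis using n(2) linear_0[OF tf(3)[OF c(2)]] by simp
  qed
  have RW: "R w = w" if "w \<in> W" for w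
  proof -
    have "w - R w \<in> W" using subspace_diff[OF subW that TW] unfolding R_def .
    moreover have "lam (w - R w) = 0" by (simp add: linear_diff[OF linlam] R_def lamT)
    ultimately show ?thesis using inW by fastforce
  qed
  have RT: "R (T t) = T t" for t by (simp add: R_def lamT)
  have T0: "T 0 = 0" by (rule linear_0[OF linT])
  have RR: "R (v - R v) = 0" for v
    by (simp add: R_def linear_diff[OF linlam] lamT T0)
  \<comment> \<open>The W-part \<open>R (x - x0)\<close> is exchanged for
    \<open>T (F x - F x0)\<close>. Then \<open>lam (\<Psi> x - x0) = F x - F x0\<close>, so fibres
    become level sets of \<open>lam\<close>; points move only by elements of W, and the derivative
    at \<open>x0\<close> is the identity.\<close>
  define \<Psi> where "\<Psi> x = x - R (x - x0) + T (F x - F x0)" for x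
  \<comment> \<open>a and b are the columns of the real 2 by 2 matrix of the derivative of F on W.
    Where the determinant is nonzero, the derivative of \<Psi> is inverted by an explicit smooth
    formula.\<close>
  define a where "a x = DF x (T 1)" for x
  define b where "b x = DF x (T \<i>)" for x
  define det where "det x = Im (cnj (a x) * b x)" for x
  have smDF: "smooth_on (\<lambda>x. DF x v) Q" for v unfolding DF_def by (rule smooth_on_derivative[OF F])
  have sm_Im: "smooth_on (\<lambda>x. Im (cnj (f x) * g x)) Q'" if "smooth_on f Q'" "smooth_on g Q'" "open Q'" for f g and Q' :: "'e set"
    by (intro smooth_on_bounded_linear_compose[OF bounded_linear_Im] smooth_on_mult
        smooth_on_bounded_linear_compose[OF bounded_linear_cnj] that)
  have smab: "smooth_on a Q" "smooth_on b Q" unfolding a_def[abs_def] b_def[abs_def] by (rule smDF)+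
  have smdet: "smooth_on det Q" unfolding det_def[abs_def] by (rule sm_Im[OF smab Q])
  define Q' where "Q' = Q \<inter> det -` (- {0})"
  have Q': "open Q'" unfolding Q'_def
    by (rule continuous_open_preimage[OF smooth_on_continuous_on[OF smdet] Q]) auto
  have Q'Q: "Q' \<subseteq> Q" by (auto simp: Q'_def)
  have "a x0 = 1" "b x0 = \<i>" unfolding a_def b_def lam_def[symmetric] lamT by auto
  then have x0Q': "x0 \<in> Q'" using x0Q by (simp add: Q'_def det_def)
  have sm\<Psi>: "smooth_on \<Psi> Q" unfolding \<Psi>_def[abs_def]
    by (intro smooth_on_add smooth_on_diff smooth_on_ident smooth_on_const Q F
        smooth_on_bounded_linear_compose[OF blR] smooth_on_bounded_linear_compose[OF blT])
  have D\<Psi>: "frechet_derivative \<Psi> (at x) v = v - R v + T (DF x v)" if "x \<in> Q" for x v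
  proof -
    have "(F has_derivative DF x) (at x)" unfolding DF_def by (rule smooth_on_has_derivative[OF F that])
    then have "(\<Psi> has_derivative (\<lambda>v. v - R (v - 0) + T (DF x v - 0))) (at x)" unfolding \<Psi>_def[abs_def]
      by (intro has_derivative_add has_derivative_diff has_derivative_ident has_derivative_const
          bounded_linear.has_derivative[OF blR] bounded_linear.has_derivative[OF blT])
    then show ?thesis by (simp add: frechet_derivative_at[symmetric])
  qed
  \<comment> \<open>\<open>E v x\<close> solves for the preimage of v under the derivative of
    \<Psi>: its part in the kernel of \<open>lam\<close> must be \<open>v - R v\<close>, and its
    W-part T s has to satisfy \<open>DF x (T s) = lam v - DF x (v - R v)\<close>, which Cramer's
    rule solves.\<close>
  define t where "t v x = lam v - DF x (v - R v)" for v x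
  define E where "E v x = v - R v + T ((Im (cnj (t v x) * b x) / det x) *\<^sub>R 1 + (Im (cnj (a x) * t v x) / det x) *\<^sub>R \<i>)" for v x
  have DFT: "DF x (T (p *\<^sub>R 1 + q *\<^sub>R \<i>)) = p *\<^sub>R a x + q *\<^sub>R b x" if "x \<in> Q" for x p q
    unfolding a_def b_def
    by (simp only: linear_add[OF linT] linear_scale[OF linT] linear_add[OF linDF[OF that]] linear_scale[OF linDF[OF that]])
  have E: "frechet_derivative \<Psi> (at x) (E v x) = v" if "x \<in> Q'" for x v
  proof -
    have xQ: "x \<in> Q" and d: "Im (cnj (a x) * b x) \<noteq> 0" using that by (auto simp: Q'_def det_def)
    define s where "s = (Im (cnj (t v x) * b x) / det x) *\<^sub>R 1 + (Im (cnj (a x) * t v x) / det x) *\<^sub>R \<i>"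
    have Es: "E v x = v - R v + T s" by (simp add: E_def s_def)
    have "DF x (T s) = t v x"
      unfolding s_def DFT[OF xQ] det_def by (rule complex_basis_solve[OF d])
    then have "DF x (E v x) = lam v"
      unfolding Es linear_add[OF linDF[OF xQ]] t_def by simp
    moreover have "R (E v x) = T s" unfolding Es linear_add[OF linR] RR RT by simp
    ultimately have "frechet_derivative \<Psi> (at x) (E v x) = v - R v + T (lam v)"
      unfolding D\<Psi>[OF xQ] by (simp add: Es)
    then show ?thesis by (simp add: R_def)
  qed
  have smt: "smooth_on (t v) Q'" for v unfolding t_def[abs_def]
    by (intro smooth_on_diff Q' smooth_on_const smooth_on_subset[OF smDF Q'Q])
  have smE: "smooth_on (E v) Q'" for v unfolding E_def[abs_def]
    by (intro smooth_on_add smooth_on_const Q' smooth_on_bounded_linear_compose[OF blT] smooth_on_scaleR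
        smooth_on_divide sm_Im smt smooth_on_subset[OF smab(1) Q'Q] smooth_on_subset[OF smab(2) Q'Q]
        smooth_on_subset[OF smdet Q'Q]) (auto simp: Q'_def)
  have "frechet_derivative \<Psi> (at x0) v = v" for v
    unfolding D\<Psi>[OF x0Q] by (simp add: R_def lam_def)
  from smooth_inverse_function[OF Q' smooth_on_subset[OF sm\<Psi> Q'Q] x0Q' this smE E]
  obtain U' V G where U': "open U'" "U' \<subseteq> Q'" "x0 \<in> U'" "open V" "homeomorphism U' V \<Psi> G" "smooth_on G V"
    by metis
  have hom: "\<And>x. x \<in> U' \<Longrightarrow> \<Psi> x \<in> V" "\<And>x. x \<in> U' \<Longrightarrow> G (\<Psi> x) = x" "\<And>y. y \<in> V \<Longrightarrow> G y \<in> U'" "\<And>y. y \<in> V \<Longrightarrow> \<Psi> (G y) = y"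
    using U'(5) unfolding homeomorphism_def by auto
  have \<Psi>x0: "\<Psi> x0 = x0" unfolding \<Psi>_def using linear_0[OF linR] T0 by simp
  then have "x0 \<in> V" using hom(1)[OF U'(3)] by simp
  \<comment> \<open>A ball is convex: parallel transport will be applied along straight segments
    inside it.\<close>
  then obtain r where r: "r > 0" "ball x0 r \<subseteq> V" using U'(4) openE by blast
  have U'Q: "U' \<subseteq> Q" using U'(2) Q'Q by blast
  have DG: "frechet_derivative G (at (\<Psi> x)) n = E n x" if "x \<in> U'" for x n
  proof -
    have G: "(G has_derivative frechet_derivative G (at (\<Psi> x))) (at (\<Psi> x))"
      by (rule smooth_on_has_derivative[OF U'(6) hom(1)[OF that]])
    have "(\<Psi> has_derivative frechet_derivative \<Psi> (at x)) (at x)"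
      by (rule smooth_on_has_derivative[OF sm\<Psi>]) (use that U'Q in auto)
    from diff_chain_at[OF this G]
    have "((\<lambda>x. x) has_derivative frechet_derivative G (at (\<Psi> x)) \<circ> frechet_derivative \<Psi> (at x)) (at x)"
      by (rule has_derivative_transform_within_open[OF _ U'(1) that]) (simp add: hom)
    from has_derivative_unique[OF has_derivative_ident this]
    have "frechet_derivative G (at (\<Psi> x)) (frechet_derivative \<Psi> (at x) v) = v" for v
      by (metis o_apply)
    from this[of "E n x"] show ?thesis using E that U'(2) by auto
  qed
  define h where "h = \<Psi> \<circ> snd c"
  define \<kappa> where "\<kappa> = chart_inv c \<circ> G"
  define S1 where "S1 = fst c \<inter> snd c -` U'"
  define S where "S = S1 \<inter> h -` ball x0 r"
  have S1: "open S1" unfolding S1_def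
    by (rule continuous_open_preimage[OF continuous_on_chart[OF chc] open_chart_domain[OF chc] U'(1)])
  have chS: "\<forall>c\<in>A. is_chart c" "\<forall>c\<in>(self_atlas :: ('e, 'e) chart set). is_chart c"
    using compat(1) chart_compatible_self by (auto dest: chart_compatibleD(2))
  have sc: "smooth_map A self_atlas S1 (snd c)"
    by (rule smooth_map_subset[OF smooth_map_chart[OF atlas c(1)]]) (auto simp: S1_def)
  have s\<Psi>: "smooth_map self_atlas self_atlas U' \<Psi>"
    unfolding smooth_map_self by (rule smooth_on_subset[OF sm\<Psi> U'Q])
  have smh1: "smooth_map A self_atlas S1 h" unfolding h_def
    by (rule smooth_map_compose[OF chS(1) chart_compatible_self chS(2) sc S1 s\<Psi> U'(1)]) (auto simp: S1_def)
  then have S: "open S" unfolding S_def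
    using continuous_open_preimage[OF _ S1, of h "ball x0 r"] unfolding smooth_map_def by blast
  have sG: "smooth_map self_atlas self_atlas (ball x0 r) G"
    unfolding smooth_map_self by (rule smooth_on_subset[OF U'(6) r(2)])
  have cic: "smooth_map self_atlas A (snd c ` fst c) (chart_inv c)" by (rule smooth_map_chart_inv[OF atlas c(1)])
  have GQ: "G y \<in> U'" "G y \<in> Q" "G y \<in> snd c ` fst c" if "y \<in> ball x0 r" for y
    using hom(3)[of y] that r(2) U'Q Qc(4) by blast+
  have sm\<kappa>: "smooth_map self_atlas A (ball x0 r) \<kappa>" unfolding \<kappa>_def
    by (rule smooth_map_compose[OF chS(2) chart_compatible_self chS(1) sG open_ball cic open_chart_image[OF chc]])
       (use GQ in auto)
  have h\<kappa>: "h (\<kappa> y) = y" "snd c (\<kappa> y) = G y" "\<kappa> y \<in> S" if "y \<in> ball x0 r" for y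
  proof -
    show 1: "snd c (\<kappa> y) = G y" by (simp add: \<kappa>_def Qc(3)[OF GQ(2)[OF that]])
    then show 2: "h (\<kappa> y) = y" using hom(4)[of y] that r(2) by (auto simp: h_def)
    have "\<kappa> y \<in> fst c" by (simp add: \<kappa>_def Qc(1)[OF GQ(2)[OF that]])
    then show "\<kappa> y \<in> S" using 1 2 GQ(1)[OF that] that by (simp add: S_def S1_def)
  qed
  have SU: "snd c q \<in> U'" "q \<in> fst c" "h q \<in> ball x0 r" if "q \<in> S" for q using that by (auto simp: S_def S1_def)
  have \<kappa>h: "\<kappa> (h q) = q" if "q \<in> S" for q
    using SU[OF that] hom(2) chart_inv_chart[OF chc] by (simp add: \<kappa>_def h_def)
  have lam\<Psi>: "lam (\<Psi> x - x0) = F x - F x0" for x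
    by (simp add: \<Psi>_def linear_add[OF linlam] linear_diff[OF linlam] R_def lamT)
  have Th: "tangent_map A self_atlas h q u = frechet_derivative \<Psi> (at (snd c q)) (to_chart A c q u)" if "q \<in> S" for q u
    unfolding h_def
    using tangent_map_compose[OF compat(1) chart_compatible_self chart_compatible_self sc S1 _ s\<Psi> U'(1) SU(1)[OF that], of u] that
    by (simp add: S_def tangent_map_self tangent_map_chart)
  show thesis
  proof (rule that[of S h r x0 \<kappa> R lam])
    show "open S" by (rule S)
    have "snd c p0 \<in> U'" "h p0 = x0" using U'(3) \<Psi>x0 by (auto simp: x0_def[symmetric] h_def)
    then show "p0 \<in> S" "h p0 = x0" using c(2) r(1) by (auto simp: S_def S1_def)
    show "smooth_map A self_atlas S h" by (rule smooth_map_subset[OF smh1]) (auto simp: S_def)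
    show "h ` S \<subseteq> ball x0 r" using SU by auto
    show "\<kappa> ` ball x0 r \<subseteq> S" using h\<kappa> by auto
    show "lam (R v) = lam v" for v by (simp add: R_def lamT)
    show "R v = 0" if "lam v = 0" for v by (simp add: R_def that T0)
    show "\<pi> (\<kappa> y) = \<pi> (\<kappa> y')" if "y \<in> ball x0 r" "y' \<in> ball x0 r" "lam y = lam y'" for y y'
    proof -
      have "F (G y) - F x0 = lam (y - x0)" "F (G y') - F x0 = lam (y' - x0)"
        using lam\<Psi>[of "G y"] lam\<Psi>[of "G y'"] hom(4) that r(2) by auto
      then have "F (G y) - F x0 = F (G y') - F x0" using that(3) by (simp add: linear_diff[OF linlam])
      then have "F (G y) = F (G y')" by (metis diff_add_cancel)
      then have "snd z (\<pi> (\<kappa> y)) = snd z (\<pi> (\<kappa> y'))" by (simp add: F_def \<kappa>_def)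
      moreover have "\<pi> (\<kappa> y) \<in> fst z" "\<pi> (\<kappa> y') \<in> fst z"
        using Qc(2)[OF GQ(2)] that by (auto simp: \<kappa>_def)
      ultimately show ?thesis using chart_eqD[OF z(3)] by blast
    qed
    show "d\<pi> q u = 0 \<longleftrightarrow> lam (tangent_map A self_atlas h q u) = 0" if "q \<in> S" for q u
    proof -
      have xQ: "snd c q \<in> Q" and q: "chart_inv c (snd c q) = q" using SU[OF that] U'Q chart_inv_chart[OF chc] by auto
      have "lam (tangent_map A self_atlas h q u) = DF (snd c q) (to_chart A c q u)"
        unfolding Th[OF that] D\<Psi>[OF xQ] by (simp add: linear_add[OF linlam] linear_diff[OF linlam] R_def lamT)
      then show ?thesis using DF0[OF xQ] tf(2)[OF SU(2)[OF that]] by (simp add: q)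
    qed
    show "R (tangent_map A self_atlas h q u) = tangent_map A self_atlas h q u" if "q \<in> S" "u \<in> N q" for q u
    proof -
      have xQ: "snd c q \<in> Q" using SU[OF that(1)] U'Q by auto
      have "to_chart A c q u \<in> W" using W[OF SU(2)[OF that(1)]] that(2) by blast
      then show ?thesis unfolding Th[OF that(1)] D\<Psi>[OF xQ] by (simp add: RW RT)
    qed
    show "tangent_map self_atlas A \<kappa> y n \<in> N (\<kappa> y)" if "y \<in> ball x0 r" "R n = n" for y n
    proof -
      have yV: "y \<in> V" using that(1) r(2) by auto
      have "tangent_map self_atlas A \<kappa> y n = from_chart A c (\<kappa> y) (frechet_derivative G (at y) n)"
        unfolding \<kappa>_def
        using tangent_map_compose[OF chart_compatible_self chart_compatible_self compat(1) sG open_ball that(1) cic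
            open_chart_image[OF chc] GQ(3)[OF that(1)], of n]
        by (simp add: tangent_map_self tangent_map_chart_inv[OF chc GQ(3)[OF that(1)]])
      also have "frechet_derivative G (at y) n = E n (G y)"
        using DG[OF hom(3)[OF yV], of n] hom(4)[OF yV] by simp
      finally have *: "tangent_map self_atlas A \<kappa> y n = from_chart A c (\<kappa> y) (E n (G y))" .
      \<comment> \<open>For a vector n fixed by R the term \<open>n - R n\<close> is zero, so
        \<open>E n\<close> takes values in the image of T.\<close>
      have "E n (G y) \<in> W" unfolding E_def that(2) using TW by simp
      moreover have \<kappa>c: "\<kappa> y \<in> fst c" by (simp add: \<kappa>_def Qc(1)[OF GQ(2)[OF that(1)]])
      ultimately obtain m where "m \<in> N (\<kappa> y)" "E n (G y) = to_chart A c (\<kappa> y) m" using W by blast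
      then show ?thesis using * tf(2)[OF \<kappa>c] by simp
    qed
  qed (use r sm\<kappa> \<kappa>h h\<kappa> blR linlam in auto)
qed

end

text \<open>Straight lines in coordinates serve both as horizontal paths and as the test curves of
  \<open>parallel_transport_preserves\<close>.\<close>

lemma smooth_map_line:
  fixes A :: "('a::topological_space, 'e::euclidean_space) chart set" and \<kappa> :: "'v::euclidean_space \<Rightarrow> 'a"
  assumes "chart_compatible A" "smooth_map self_atlas A V \<kappa>" "open V"
  shows "open {t::real. p + t *\<^sub>R v \<in> V}"
    and "smooth_map self_atlas A {t. p + t *\<^sub>R v \<in> V} (\<lambda>t. \<kappa> (p + t *\<^sub>R v))"
    and "p + t *\<^sub>R v \<in> V \<Longrightarrow> velocity A (\<lambda>t. \<kappa> (p + t *\<^sub>R v)) t = tangent_map self_atlas A \<kappa> (p + t *\<^sub>R v) v"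
proof -
  let ?l = "\<lambda>t::real. p + t *\<^sub>R v" and ?W = "{t::real. p + t *\<^sub>R v \<in> V}"
  have "?W = ?l -` V" by auto
  then show W: "open ?W"
    using open_vimage[OF assms(3), of ?l] by (simp add: continuous_intros)
  have "smooth_on ?l ?W"
    by (intro smooth_on_add W smooth_on_const smooth_on_scaleR smooth_on_ident)
  then have l: "smooth_map self_atlas self_atlas ?W ?l" by (simp add: smooth_map_self)
  have ch: "\<forall>c\<in>A. is_chart c" "\<forall>c\<in>(self_atlas :: (real, real) chart set). is_chart c"
    using assms(1) chart_compatible_self by (auto dest: chart_compatibleD(2))
  have "smooth_map self_atlas A ?W (\<kappa> \<circ> ?l)"
    by (rule smooth_map_compose[OF ch(2) chart_compatible_self ch(1) l W assms(2,3)]) auto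
  then show sm: "smooth_map self_atlas A ?W (\<lambda>t. \<kappa> (?l t))" by (simp add: o_def)
  assume t: "?l t \<in> V"
  have d: "(?l has_derivative (\<lambda>s. s *\<^sub>R v)) (at t)" by (auto intro!: derivative_eq_intros)
  have "tangent_map self_atlas A (\<kappa> \<circ> ?l) t 1 = tangent_map self_atlas A \<kappa> (?l t) (tangent_map self_atlas self_atlas ?l t 1)"
    by (rule tangent_map_compose[OF chart_compatible_self chart_compatible_self assms(1) l W _ assms(2,3)]) (use t in auto)
  then show "velocity A (\<lambda>t. \<kappa> (?l t)) t = tangent_map self_atlas A \<kappa> (?l t) v"
    using velocity_eq[OF assms(1) sm W, of t] t
    by (simp add: tangent_map_self frechet_derivative_at[OF d, symmetric] o_def)
qed

context flat_bundle
begin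

text \<open>Translation by n in straightened coordinates is parallel transport: t \<mapsto> \<kappa>
  (p + t n) is horizontal, and it lies over the same base path for all p with the same value of
  \<open>lam\<close>. Lines in the directions s1 and s2 are therefore carried to lines, and
  invariance of \<omega> applies to their velocities.\<close>

lemma transport_along_leaves:
  assumes \<kappa>: "smooth_map self_atlas A V \<kappa>" "open V" "convex V"
    and eq: "\<And>y y'. y \<in> V \<Longrightarrow> y' \<in> V \<Longrightarrow> lam y = lam y' \<Longrightarrow> \<pi> (\<kappa> y) = \<pi> (\<kappa> y')"
    and N: "\<And>y. y \<in> V \<Longrightarrow> tangent_map self_atlas A \<kappa> y n \<in> N (\<kappa> y)"
    and lam: "linear (lam :: 'v::euclidean_space \<Rightarrow> complex)" "lam s1 = 0" "lam s2 = 0"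
    and y: "y \<in> V" "y + n \<in> V"
  shows "\<omega> (\<kappa> (y + n)) (tangent_map self_atlas A \<kappa> (y + n) s1) (tangent_map self_atlas A \<kappa> (y + n) s2)
    = \<omega> (\<kappa> y) (tangent_map self_atlas A \<kappa> y s1) (tangent_map self_atlas A \<kappa> y s2)"
proof -
  note L = smooth_map_line[OF compat(1) \<kappa>(1,2)]
  define W where "W = {s. y + s *\<^sub>R s1 \<in> V} \<inter> {s. y + s *\<^sub>R s2 \<in> V} \<inter> {s. (y + n) + s *\<^sub>R s1 \<in> V} \<inter> {s. (y + n) + s *\<^sub>R s2 \<in> V}"
  have W: "open W" "0 \<in> W" unfolding W_def using y by (auto intro!: open_Int L(1))
  have trans: "transports A \<pi> N (\<lambda>t. \<pi> (\<kappa> (y + t *\<^sub>R n))) (\<kappa> (y + s *\<^sub>R v)) (\<kappa> ((y + n) + s *\<^sub>R v))"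
    if "y + s *\<^sub>R v \<in> V" "(y + n) + s *\<^sub>R v \<in> V" "lam v = 0" for s v
  proof -
    have seg: "p + t *\<^sub>R n \<in> V" if "p \<in> V" "p + n \<in> V" "t \<in> {0..1}" for p t
    proof -
      have "(1 - t) *\<^sub>R p + t *\<^sub>R (p + n) \<in> V"
        by (rule convexD_alt[OF \<kappa>(3)]) (use that in auto)
      then show ?thesis by (simp add: algebra_simps)
    qed
    let ?p = "y + s *\<^sub>R v"
    have pn: "?p + n \<in> V" using that(2) by (metis add.assoc add.commute)
    show ?thesis unfolding transports_def
    proof (intro exI[of _ "{t. ?p + t *\<^sub>R n \<in> V}"] exI[of _ "\<lambda>t. \<kappa> (?p + t *\<^sub>R n)"] conjI ballI)
      show "{0..1} \<subseteq> {t. ?p + t *\<^sub>R n \<in> V}" using seg[OF that(1) pn] by auto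
      show "\<kappa> (?p + 1 *\<^sub>R n) = \<kappa> ((y + n) + s *\<^sub>R v)" by (simp add: algebra_simps)
      fix t :: real assume t: "t \<in> {0..1}"
      have in1: "?p + t *\<^sub>R n \<in> V" and in2: "y + t *\<^sub>R n \<in> V"
        using seg[OF that(1) pn t] seg[OF y t] by auto
      have "lam (?p + t *\<^sub>R n) = lam (y + t *\<^sub>R n)"
        using that(3) by (simp add: linear_add[OF lam(1)] linear_scale[OF lam(1)])
      then show "\<pi> (\<kappa> (?p + t *\<^sub>R n)) = \<pi> (\<kappa> (y + t *\<^sub>R n))" by (rule eq[OF in1 in2])
      show "velocity A (\<lambda>t. \<kappa> (?p + t *\<^sub>R n)) t \<in> N (\<kappa> (?p + t *\<^sub>R n))"
        using L(3)[OF in1] N[OF in1] by simp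
    qed (use L in auto)
  qed
  have "\<omega> (\<kappa> ((y + n) + 0 *\<^sub>R s1)) (velocity A (\<lambda>s. \<kappa> ((y + n) + s *\<^sub>R s1)) 0) (velocity A (\<lambda>s. \<kappa> ((y + n) + s *\<^sub>R s2)) 0)
    = \<omega> (\<kappa> (y + 0 *\<^sub>R s1)) (velocity A (\<lambda>s. \<kappa> (y + s *\<^sub>R s1)) 0) (velocity A (\<lambda>s. \<kappa> (y + s *\<^sub>R s2)) 0)"
  proof (rule transport[unfolded parallel_transport_preserves_def, rule_format, of W])
    show "open W \<and> 0 \<in> W \<and> smooth_map self_atlas A W (\<lambda>s. \<kappa> (y + s *\<^sub>R s1)) \<and> smooth_map self_atlas A W (\<lambda>s. \<kappa> (y + s *\<^sub>R s2)) \<and>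
      smooth_map self_atlas A W (\<lambda>s. \<kappa> ((y + n) + s *\<^sub>R s1)) \<and> smooth_map self_atlas A W (\<lambda>s. \<kappa> ((y + n) + s *\<^sub>R s2)) \<and>
      \<kappa> (y + 0 *\<^sub>R s1) = \<kappa> (y + 0 *\<^sub>R s2) \<and> \<kappa> ((y + n) + 0 *\<^sub>R s1) = \<kappa> ((y + n) + 0 *\<^sub>R s2) \<and>
      (\<forall>s\<in>W. transports A \<pi> N (\<lambda>t. \<pi> (\<kappa> (y + t *\<^sub>R n))) (\<kappa> (y + s *\<^sub>R s1)) (\<kappa> ((y + n) + s *\<^sub>R s1)) \<and>
        transports A \<pi> N (\<lambda>t. \<pi> (\<kappa> (y + t *\<^sub>R n))) (\<kappa> (y + s *\<^sub>R s2)) (\<kappa> ((y + n) + s *\<^sub>R s2)))"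
    proof (intro conjI ballI W)
      show "smooth_map self_atlas A W (\<lambda>s. \<kappa> (y + s *\<^sub>R s1))" "smooth_map self_atlas A W (\<lambda>s. \<kappa> (y + s *\<^sub>R s2))"
        "smooth_map self_atlas A W (\<lambda>s. \<kappa> ((y + n) + s *\<^sub>R s1))" "smooth_map self_atlas A W (\<lambda>s. \<kappa> ((y + n) + s *\<^sub>R s2))"
        unfolding W_def by (rule smooth_map_subset[OF L(2)], blast)+
      fix s assume "s \<in> W"
      then show "transports A \<pi> N (\<lambda>t. \<pi> (\<kappa> (y + t *\<^sub>R n))) (\<kappa> (y + s *\<^sub>R s1)) (\<kappa> ((y + n) + s *\<^sub>R s1))"
        "transports A \<pi> N (\<lambda>t. \<pi> (\<kappa> (y + t *\<^sub>R n))) (\<kappa> (y + s *\<^sub>R s2)) (\<kappa> ((y + n) + s *\<^sub>R s2))"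
        unfolding W_def by (intro trans lam(2,3); blast)+
    qed simp_all
  qed
  then show ?thesis
    using L(3)[of "y + n" 0 s1] L(3)[of "y + n" 0 s2] L(3)[of y 0 s1] L(3)[of y 0 s2] y by simp
qed

text \<open>The horizontal extension of \<open>\<omega>\<close> is locally the pullback of \<open>\<sigma>\<close> along the projection of the
  total space to one fibre along the leaves, so it is smooth and closed.\<close>

lemma local_fibre_projection:
  obtains S \<psi> where "open S" "p0 \<in> S" "smooth_map A AF S \<psi>"
    "\<And>q u v. q \<in> S \<Longrightarrow> \<sigma> (\<psi> q) [tangent_map A AF \<psi> q u, tangent_map A AF \<psi> q v] = of_real (hor_omega q u v)"
proof -
  obtain S h \<kappa> x0 r R and lam :: "'e \<Rightarrow> complex" where
    S: "open S" "p0 \<in> S" and h: "smooth_map A self_atlas S h" and r: "r > 0" and hS: "h ` S \<subseteq> ball x0 r" "h p0 = x0"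
    and \<kappa>: "smooth_map self_atlas A (ball x0 r) \<kappa>" "\<kappa> ` ball x0 r \<subseteq> S"
    and \<kappa>h: "\<And>q. q \<in> S \<Longrightarrow> \<kappa> (h q) = q" "\<And>y. y \<in> ball x0 r \<Longrightarrow> h (\<kappa> y) = y"
    and R: "bounded_linear R" "linear lam" "\<And>v. lam (R v) = lam v" "\<And>v. lam v = 0 \<Longrightarrow> R v = 0"
    and eq: "\<And>y y'. y \<in> ball x0 r \<Longrightarrow> y' \<in> ball x0 r \<Longrightarrow> lam y = lam y' \<Longrightarrow> \<pi> (\<kappa> y) = \<pi> (\<kappa> y')"
    and vert: "\<And>q u. q \<in> S \<Longrightarrow> d\<pi> q u = 0 \<longleftrightarrow> lam (tangent_map A self_atlas h q u) = 0"
    and RN: "\<And>q u. q \<in> S \<Longrightarrow> u \<in> N q \<Longrightarrow> R (tangent_map A self_atlas h q u) = tangent_map A self_atlas h q u"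
    and NR: "\<And>y n. y \<in> ball x0 r \<Longrightarrow> R n = n \<Longrightarrow> tangent_map self_atlas A \<kappa> y n \<in> N (\<kappa> y)"
    by (rule straightening[of p0]) (rule that)
  obtain U \<Phi> g where U: "open U" "\<pi> p0 \<in> U" and \<Phi>: "smooth_map A AF (\<pi> -` U) \<Phi>" and oU: "open (\<pi> -` U)"
    and g: "smooth_map (prod_atlas Z AF) A (U \<times> UNIV) g" "\<And>p. \<pi> p \<in> U \<Longrightarrow> g (\<pi> p, \<Phi> p) = p"
    and inv: "\<And>b' y. b' \<in> U \<Longrightarrow> \<pi> (g (b', y)) = b'" "\<And>b' y. b' \<in> U \<Longrightarrow> \<Phi> (g (b', y)) = y"
    and \<sigma>: "\<And>p u v. \<pi> p \<in> U \<Longrightarrow> u \<in> vertical A Z \<pi> p \<Longrightarrow> v \<in> vertical A Z \<pi> p \<Longrightarrow>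
      \<sigma> (\<Phi> p) [tangent_map A AF \<Phi> p u, tangent_map A AF \<Phi> p v] = of_real (\<omega> p u v)"
    by (rule local_trivialization[of "\<pi> p0"]) (rule that)
  interpret R: bounded_linear R by fact
  let ?T = "tangent_map A self_atlas h" and ?K = "tangent_map self_atlas A \<kappa>"
  \<comment> \<open>The affine projection along the leaves onto the slice
    \<open>lam = lam x0\<close>, which corresponds to the fibre through \<open>p0\<close>.\<close>
  define pr0 where "pr0 y = y - R (y - x0)" for y
  have ch: "\<forall>c\<in>A. is_chart c" "\<forall>c\<in>AF. is_chart c" "\<forall>c\<in>(self_atlas :: ('e, 'e) chart set). is_chart c"
    using compat chart_compatible_self by (auto dest: chart_compatibleD(2))
  have spr0: "smooth_on pr0 V" if "open V" for V unfolding pr0_def[abs_def]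
    by (intro smooth_on_diff smooth_on_ident smooth_on_const smooth_on_bounded_linear_compose[OF R(1)] that)
  have dpr0: "(pr0 has_derivative (\<lambda>v. v - R (v - 0))) (at y)" for y unfolding pr0_def[abs_def]
    by (intro has_derivative_diff has_derivative_ident has_derivative_const R.has_derivative)
  have lampr0: "lam (pr0 y) = lam x0" for y
    by (simp add: pr0_def linear_diff[OF R(2)] R(3))
  \<comment> \<open>Both y and its projection lie in the ball, hence so does the segment between
    them.\<close>
  define V where "V = ball x0 r \<inter> pr0 -` ball x0 r"
  have V: "open V" unfolding V_def
    by (rule continuous_open_preimage[OF smooth_on_continuous_on[OF spr0]]) auto
  define S' where "S' = S \<inter> h -` V"
  have S': "open S'" unfolding S'_def
    by (rule continuous_open_preimage[OF _ S(1) V]) (use h in \<open>simp add: smooth_map_def\<close>)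
  define pr where "pr = \<kappa> \<circ> (pr0 \<circ> h)"
  have h': "smooth_map A self_atlas S' h" by (rule smooth_map_subset[OF h]) (auto simp: S'_def)
  have p0: "smooth_map self_atlas self_atlas V pr0" unfolding smooth_map_self by (rule spr0[OF V])
  have s1: "smooth_map A self_atlas S' (pr0 \<circ> h)"
    by (rule smooth_map_compose[OF ch(1) chart_compatible_self ch(3) h' S' p0 V]) (auto simp: S'_def)
  have spr: "smooth_map A A S' pr" unfolding pr_def
    by (rule smooth_map_compose[OF ch(1) chart_compatible_self ch(1) s1 S' \<kappa>(1) open_ball]) (auto simp: S'_def V_def)
  have x0: "x0 \<in> ball x0 r" using r by simp
  have prU: "\<pi> (pr q) = \<pi> p0" if "q \<in> S'" for q
  proof -
    have "\<pi> (\<kappa> (pr0 (h q))) = \<pi> (\<kappa> x0)"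
      by (rule eq[OF _ x0 lampr0]) (use that in \<open>simp add: S'_def V_def\<close>)
    then show ?thesis using \<kappa>h(1)[OF S(2)] hS(2) by (simp add: pr_def)
  qed
  have s\<psi>: "smooth_map A AF S' (\<Phi> \<circ> pr)"
    by (rule smooth_map_compose[OF ch(1) compat(1) ch(2) spr S' \<Phi> oU]) (use prU U in auto)
  have linT: "linear (?T q)" if "q \<in> S" for q
    by (rule linear_tangent_map[OF compat(1) chart_compatible_self h S(1) that])
  have TK: "?T (\<kappa> y) (?K y v) = v" if "y \<in> ball x0 r" for y v
  proof -
    have "tangent_map self_atlas self_atlas (h \<circ> \<kappa>) y v = ?T (\<kappa> y) (?K y v)"
      by (rule tangent_map_compose[OF chart_compatible_self compat(1) chart_compatible_self \<kappa>(1) open_ball that h S(1)])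
         (use \<kappa>(2) that in auto)
    then show ?thesis
      using tangent_map_ident[OF chart_compatible_self open_ball that, of "h \<circ> \<kappa>" v] \<kappa>h(2) by simp
  qed
  have KT: "?K (h q) (?T q v) = v" if "q \<in> S" for q v
  proof -
    have "tangent_map A A (\<kappa> \<circ> h) q v = ?K (h q) (?T q v)"
      by (rule tangent_map_compose[OF compat(1) chart_compatible_self compat(1) h S(1) that \<kappa>(1) open_ball])
         (use hS that in auto)
    then show ?thesis
      using tangent_map_ident[OF compat(1) S(1) that, of "\<kappa> \<circ> h" v] \<kappa>h(1) by simp
  qed
  \<comment> \<open>In straightened coordinates the vertical projection is the derivative of
    \<open>pr0\<close>: R fixes horizontal vectors and kills vertical ones.\<close>
  have Tv: "?T q (vproj q u) = ?T q u - R (?T q u)" "lam (?T q (vproj q u)) = 0" if "q \<in> S" for q u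
  proof -
    show 1: "lam (?T q (vproj q u)) = 0" using vert[OF that] vproj_vertical vertical_iff by blast
    let ?n = "hlift q (d\<pi> q u)"
    have "?T q u = ?T q (vproj q u) + ?T q ?n"
      unfolding linear_add[OF linT[OF that], symmetric] by (simp add: vproj_def)
    moreover from this have "R (?T q u) = ?T q ?n"
      using R(4)[OF 1] RN[OF that hlift(1)] by (simp add: R.add)
    ultimately show "?T q (vproj q u) = ?T q u - R (?T q u)" by simp
  qed
  have Tpr: "tangent_map A A pr q u = ?K (pr0 (h q)) (?T q (vproj q u))" if "q \<in> S'" for q u
  proof -
    have q: "q \<in> S" "h q \<in> V" "pr0 (h q) \<in> ball x0 r" using that by (auto simp: S'_def V_def)
    have "tangent_map A A pr q u = ?K ((pr0 \<circ> h) q) (tangent_map A self_atlas (pr0 \<circ> h) q u)" unfolding pr_def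
      by (rule tangent_map_compose[OF compat(1) chart_compatible_self compat(1) s1 S' that \<kappa>(1) open_ball])
         (use q in auto)
    also have "tangent_map A self_atlas (pr0 \<circ> h) q u = tangent_map self_atlas self_atlas pr0 (h q) (?T q u)"
      by (rule tangent_map_compose[OF compat(1) chart_compatible_self chart_compatible_self h' S' that p0 V q(2)])
    also have "\<dots> = ?T q (vproj q u)"
      by (simp add: tangent_map_self frechet_derivative_at[OF dpr0, symmetric] Tv(1)[OF q(1)])
    finally show ?thesis by simp
  qed
  show thesis
  proof (rule that[OF S' _ s\<psi>])
    have "pr0 x0 = x0" by (simp add: pr0_def R.zero)
    then show "p0 \<in> S'" using S(2) hS(2) x0 by (simp add: S'_def V_def)
    fix q u v assume qS': "q \<in> S'"
    have q: "q \<in> S" "h q \<in> ball x0 r" "pr0 (h q) \<in> ball x0 r" using qS' by (auto simp: S'_def V_def)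
    \<comment> \<open>The translation from \<open>h q\<close> to its projection is horizontal, R n =
      n, because R is idempotent; \<open>transport_along_leaves\<close> compares \<omega> at its two
      ends.\<close>
    define n where "n = pr0 (h q) - h q"
    have n: "h q + n = pr0 (h q)" by (simp add: n_def)
    define w where "w = h q - x0"
    have "lam (w - R w) = 0" by (simp add: linear_diff[OF R(2)] R(3))
    from R(4)[OF this] have "R (R w) = R w" by (simp add: R.diff)
    moreover have "n = - R w" by (simp add: n_def pr0_def w_def)
    ultimately have "R n = n" by (simp add: R.neg)
    have T\<psi>: "tangent_map A AF (\<Phi> \<circ> pr) q w = tangent_map A AF \<Phi> (pr q) (tangent_map A A pr q w)" for w
      by (rule tangent_map_compose[OF compat(1) compat(1) compat(3) spr S' qS' \<Phi> oU]) (use prU[OF qS'] U in auto)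
    have prq: "pr q = \<kappa> (pr0 (h q))" by (simp add: pr_def)
    have vt: "tangent_map A A pr q w \<in> vertical A Z \<pi> (pr q)" for w
    proof -
      have "\<kappa> (pr0 (h q)) \<in> S" using \<kappa>(2) q(3) by blast
      then show ?thesis
        unfolding vertical_iff Tpr[OF qS'] prq using vert TK[OF q(3)] Tv(2)[OF q(1)] by metis
    qed
    have "\<sigma> ((\<Phi> \<circ> pr) q) [tangent_map A AF (\<Phi> \<circ> pr) q u, tangent_map A AF (\<Phi> \<circ> pr) q v]
      = of_real (\<omega> (pr q) (tangent_map A A pr q u) (tangent_map A A pr q v))"
      unfolding T\<psi> o_apply by (rule \<sigma>[OF _ vt vt]) (simp add: prU[OF qS'] U)
    also have "\<omega> (pr q) (tangent_map A A pr q u) (tangent_map A A pr q v)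
      = \<omega> (\<kappa> (h q)) (?K (h q) (?T q (vproj q u))) (?K (h q) (?T q (vproj q v)))"
      unfolding Tpr[OF qS'] prq n[symmetric]
      by (rule transport_along_leaves[OF \<kappa>(1) open_ball convex_ball eq NR R(2)])
         (use \<open>R n = n\<close> q n Tv(2)[OF q(1)] in auto)
    also have "\<dots> = hor_omega q u v"
      unfolding hor_omega_def KT[OF q(1)] \<kappa>h(1)[OF q(1)] ..
    finally show "\<sigma> ((\<Phi> \<circ> pr) q) [tangent_map A AF (\<Phi> \<circ> pr) q u, tangent_map A AF (\<Phi> \<circ> pr) q v]
      = of_real (hor_omega q u v)" .
  qed
qed

end

section \<open>Differential forms in charts\<close>

lemma wedge_map: "wedge \<alpha> \<beta> (map L vs) = wedge (\<lambda>us. \<alpha> (map L us)) (\<lambda>us. \<beta> (map L us)) vs"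
  by (induction vs arbitrary: \<alpha> \<beta>) simp_all

lemma wedge_power_map: "wedge_power \<alpha> k (map L vs) = wedge_power (\<lambda>us. \<alpha> (map L us)) k vs"
  by (induction k arbitrary: vs) (simp_all add: wedge_map)

lemma form_exp_map: "form_exp \<alpha> (map L vs) = form_exp (\<lambda>us. \<alpha> (map L us)) vs"
  by (simp add: form_exp_def wedge_power_map)

lemma one_form_map: "one_form \<xi> (map L vs) = one_form (\<lambda>v. \<xi> (L v)) vs"
  by (auto simp: one_form_def length_Suc_conv)

lemma two_form_map: "two_form B (map L vs) = two_form (\<lambda>u v. B (L u) (L v)) vs"
  by (auto simp: two_form_def)

lemma local_rep_wedge: "local_rep A c (\<lambda>q. wedge (\<alpha> q) (\<beta> q)) x = wedge (local_rep A c \<alpha> x) (local_rep A c \<beta> x)"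
  by (simp add: local_rep_def[abs_def] wedge_map)

lemma local_rep_form_exp: "local_rep A c (\<lambda>q. form_exp (\<alpha> q)) x = form_exp (local_rep A c \<alpha> x)"
  by (simp add: local_rep_def[abs_def] form_exp_map)

lemma local_rep_one_form: "local_rep A c (\<lambda>q. one_form (\<xi> q)) x =
    one_form (\<lambda>v. \<xi> (chart_inv c x) (from_chart A c (chart_inv c x) v))"
  by (rule ext) (simp add: local_rep_def one_form_map)

lemma local_rep_two_form: "local_rep A c (\<lambda>q. two_form (B q)) x =
    two_form (\<lambda>u v. B (chart_inv c x) (from_chart A c (chart_inv c x) u) (from_chart A c (chart_inv c x) v))"
  by (rule ext) (simp add: local_rep_def two_form_map)

lemma smooth_on_wedge:
  assumes "open S" "\<And>vs. smooth_on (\<lambda>x. \<alpha> x vs) S" "\<And>vs. smooth_on (\<lambda>x. \<beta> x vs) S"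
  shows "smooth_on (\<lambda>x. wedge (\<alpha> x) (\<beta> x) vs) S"
  using assms(2,3)
proof (induction vs arbitrary: \<alpha> \<beta>)
  case Nil
  then show ?case by (simp add: smooth_on_mult[OF assms(1)])
next
  case (Cons v vs)
  show ?case unfolding wedge.simps
    by (intro smooth_on_add Cons.IH smooth_on_mult smooth_on_const assms(1) Cons.prems)
qed

lemma smooth_on_form_exp:
  assumes "open S" "\<And>vs. smooth_on (\<lambda>x. \<alpha> x vs) S"
  shows "smooth_on (\<lambda>x. form_exp (\<alpha> x) vs) S"
proof -
  have "smooth_on (\<lambda>x. wedge_power (\<alpha> x) k vs) S" for k vs
  proof (induction k arbitrary: vs)
    case 0
    then show ?case by (simp add: smooth_on_const[OF assms(1)])
  next
    case (Suc k)
    then show ?case unfolding wedge_power.simps by (intro smooth_on_wedge assms)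
  qed
  then show ?thesis unfolding form_exp_def
    by (intro smooth_on_sum smooth_on_divide smooth_on_const assms(1)) auto
qed

lemma smooth_on_one_form:
  "open S \<Longrightarrow> (\<And>v. smooth_on (\<lambda>x. \<xi> x v) S) \<Longrightarrow> smooth_on (\<lambda>x. one_form (\<xi> x) vs) S"
  by (cases "length vs = 1") (simp_all add: one_form_def smooth_on_const)

lemma smooth_on_two_form:
  "open S \<Longrightarrow> (\<And>u v. smooth_on (\<lambda>x. B x u v) S) \<Longrightarrow> smooth_on (\<lambda>x. two_form (B x) vs) S"
  by (cases "length vs = 2") (simp_all add: two_form_def smooth_on_const)

lemma smooth_form_on_wedge:
  assumes "\<forall>c\<in>A. is_chart c" "open U" "smooth_form_on A U \<alpha>" "smooth_form_on A U \<beta>"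
  shows "smooth_form_on A U (\<lambda>q. wedge (\<alpha> q) (\<beta> q))"
  using assms unfolding smooth_form_on_def local_rep_wedge
  by (auto intro!: alt_form_wedge smooth_on_wedge open_chart_image_Int)

lemma smooth_form_on_form_exp:
  assumes "\<forall>c\<in>A. is_chart c" "open U" "smooth_form_on A U \<alpha>" "\<And>q. q \<in> U \<Longrightarrow> \<alpha> q [] = 0"
  shows "smooth_form_on A U (\<lambda>q. form_exp (\<alpha> q))"
  using assms unfolding smooth_form_on_def local_rep_form_exp
  by (auto intro!: alt_form_form_exp smooth_on_form_exp open_chart_image_Int)

lemma smooth_form_on_one_form:
  assumes "\<forall>c\<in>A. is_chart c" "open U" "\<And>q. q \<in> U \<Longrightarrow> linear (\<xi> q)"
    "\<And>c v. c \<in> A \<Longrightarrow> smooth_on (\<lambda>x. \<xi> (chart_inv c x) (from_chart A c (chart_inv c x) v)) (snd c ` (U \<inter> fst c))"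
  shows "smooth_form_on A U (\<lambda>q. one_form (\<xi> q))"
  unfolding smooth_form_on_def local_rep_one_form
proof (intro conjI ballI allI)
  show "alt_form (one_form (\<xi> q))" if "q \<in> U" for q by (rule alt_form_one_form[OF assms(3)[OF that]])
  show "smooth_on (\<lambda>x. one_form (\<lambda>v. \<xi> (chart_inv c x) (from_chart A c (chart_inv c x) v)) vs) (snd c ` (U \<inter> fst c))"
    if "c \<in> A" for c vs
    using assms(1,2,4) that by (intro smooth_on_one_form) (auto intro: open_chart_image_Int)
qed

lemma smooth_form_on_two_form:
  assumes "\<forall>c\<in>A. is_chart c" "open U" "\<And>q u. q \<in> U \<Longrightarrow> linear (B q u)" "\<And>q v. q \<in> U \<Longrightarrow> linear (\<lambda>u. B q u v)"
    "\<And>q v. q \<in> U \<Longrightarrow> B q v v = 0"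
    "\<And>c u v. c \<in> A \<Longrightarrow> smooth_on (\<lambda>x. B (chart_inv c x) (from_chart A c (chart_inv c x) u)
       (from_chart A c (chart_inv c x) v)) (snd c ` (U \<inter> fst c))"
  shows "smooth_form_on A U (\<lambda>q. two_form (B q))"
  unfolding smooth_form_on_def local_rep_two_form
proof (intro conjI ballI allI)
  show "alt_form (two_form (B q))" if "q \<in> U" for q by (rule alt_form_two_form[OF assms(3-5)[OF that]])
  show "smooth_on (\<lambda>x. two_form (\<lambda>u v. B (chart_inv c x) (from_chart A c (chart_inv c x) u)
       (from_chart A c (chart_inv c x) v)) vs) (snd c ` (U \<inter> fst c))"
    if "c \<in> A" for c vs
    using assms(1,2,6) that by (intro smooth_on_two_form) (auto intro: open_chart_image_Int)
qed

lemma smooth_form_onD: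
  "smooth_form_on A U \<rho> \<Longrightarrow> c \<in> A \<Longrightarrow> smooth_on (\<lambda>x. local_rep A c \<rho> x vs) (snd c ` (U \<inter> fst c))"
  "smooth_form_on A U \<rho> \<Longrightarrow> q \<in> U \<Longrightarrow> alt_form (\<rho> q)"
  unfolding smooth_form_on_def by auto

lemma smooth_form_on_subset: "smooth_form_on A U \<rho> \<Longrightarrow> U' \<subseteq> U \<Longrightarrow> smooth_form_on A U' \<rho>"
  unfolding smooth_form_on_def by (meson Int_mono image_mono order_refl smooth_on_subset subsetD)

text \<open>Both functions have the same set of derivatives at x, so the choice operator in
  \<open>frechet_derivative\<close> returns the same value even where this set is empty.\<close>

lemma frechet_derivative_cong:
  assumes "open S" "x \<in> S" "\<And>y. y \<in> S \<Longrightarrow> f y = g y"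
  shows "frechet_derivative f (at x) = frechet_derivative g (at x)"
proof -
  have "(f has_derivative D) (at x) \<longleftrightarrow> (g has_derivative D) (at x)" for D
    using has_derivative_transform_within_open[OF _ assms(1,2), of f D UNIV g]
      has_derivative_transform_within_open[OF _ assms(1,2), of g D UNIV f] assms(3) by auto
  then show ?thesis unfolding frechet_derivative_def by simp
qed

lemma flat_ext_deriv_cong:
  assumes "open S" "x \<in> S" "\<And>y us. y \<in> S \<Longrightarrow> \<alpha> y us = \<beta> y us"
  shows "flat_ext_deriv \<alpha> x vs = flat_ext_deriv \<beta> x vs"
proof -
  have "frechet_derivative (\<lambda>y. \<alpha> y us) (at x) = frechet_derivative (\<lambda>y. \<beta> y us) (at x)" for us
    by (rule frechet_derivative_cong[OF assms(1,2)]) (rule assms(3))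
  then show ?thesis unfolding flat_ext_deriv_def by simp
qed

lemma alt_form_local_rep:
  assumes "chart_compatible A" "c \<in> A" "x \<in> snd c ` fst c" "alt_form (\<rho> (chart_inv c x))"
  shows "linear (\<lambda>u. local_rep A c \<rho> x [u, v])" "linear (\<lambda>v. local_rep A c \<rho> x [u, v])"
    "local_rep A c \<rho> x [u, v] = - local_rep A c \<rho> x [v, u]"
proof -
  have q: "chart_inv c x \<in> fst c" using chart_inv_in chart_compatibleD(2)[OF assms(1,2)] assms(3) by blast
  note l = to_from_chart(4)[OF assms(1,2) q]
  show 1: "linear (\<lambda>u. local_rep A c \<rho> x [u, v])" for v
    using linear_compose[OF l alt_form_linear_hd[OF assms(4)]] by (simp add: local_rep_def o_def)
  show 2: "linear (\<lambda>v. local_rep A c \<rho> x [u, v])" for u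
    using linear_compose[OF l alt_form_linear_hd[OF alt_form_contract[OF assms(4)]]] by (simp add: local_rep_def o_def)
  have "local_rep A c \<rho> x [w, w] = 0" for w by (simp add: local_rep_def alt_form_hd_eq[OF assms(4)])
  from this[of "u + v"] this[of u] this[of v]
  show "local_rep A c \<rho> x [u, v] = - local_rep A c \<rho> x [v, u]"
    using linear_add[OF 1, of u v "u + v"] linear_add[OF 2, of u u v] linear_add[OF 2, of v u v]
    by (simp add: eq_neg_iff_add_eq_0)
qed

section \<open>Smoothness and closedness of the horizontal extension\<close>

context flat_bundle
begin

lemma charts: "\<forall>c\<in>A. is_chart c" "\<forall>c\<in>Z. is_chart c" "\<forall>c\<in>AF. is_chart c"
  using compat by (auto dest: chart_compatibleD(2))

definition hor_form :: "'x \<Rightarrow> 'e form" where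
  "hor_form q = two_form (\<lambda>u v. of_real (hor_omega q u v))"

text \<open>In charts, \<open>hor_form\<close> is the coordinate expression of \<sigma> pulled back
  along that of the local projection to a fibre, so both claims come from
  \<open>pullback_two_form\<close>.\<close>

lemma hor_form_local:
  assumes c: "c \<in> A" and x: "x \<in> snd c ` fst c"
  shows "\<exists>T. open T \<and> x \<in> T \<and> (\<forall>vs. smooth_on (\<lambda>y. local_rep A c hor_form y vs) T)"
    and "flat_ext_deriv (local_rep A c hor_form) x vs = 0"
proof -
  define p where "p = chart_inv c x"
  have chc: "is_chart c" using charts c by blast
  have p: "p \<in> fst c" "snd c p = x" using chart_inv_in[OF chc x] chart_chart_inv[OF chc x] by (auto simp: p_def)
  obtain S \<psi> where S: "open S" "p \<in> S" and \<psi>: "smooth_map A AF S \<psi>"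
    and \<sigma>: "\<And>q u v. q \<in> S \<Longrightarrow> \<sigma> (\<psi> q) [tangent_map A AF \<psi> q u, tangent_map A AF \<psi> q v] = of_real (hor_omega q u v)"
    by (rule local_fibre_projection[of p]) (rule that)
  obtain E :: "'e \<Rightarrow> 'k" and G :: "'k \<Rightarrow> 'e" and L :: "complex \<Rightarrow> 'e"
    where EG: "bounded_linear E" "bounded_linear G" "\<And>k. E (G k) = k" and "\<And>z. d\<pi> p (L z) = z"
    by (rule trivialization_derivatives[of p]) (rule that)
  \<comment> \<open>Closedness of \<sigma> at a point is expressed in the preferred chart of that
    point. Hence e is the preferred chart at \<open>\<psi> p\<close>, and closedness in coordinates
    is used at the single point \<open>f x\<close>.\<close>
  define e where "e = chart_at AF (\<psi> p)"
  have e: "e \<in> AF" "\<psi> p \<in> fst e" "is_chart e" using chart_at_in[OF compat(3)] by (auto simp: e_def)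
  define S' where "S' = S \<inter> \<psi> -` fst e"
  have S': "open S'" "p \<in> S'" unfolding S'_def
    using continuous_open_preimage[OF _ S(1) open_chart_domain[OF e(3)]] \<psi> S e(2) by (auto simp: smooth_map_def)
  define X where "X = snd c ` (S' \<inter> fst c)"
  have X: "open X" "x \<in> X" unfolding X_def using open_chart_image_Int[OF chc S'(1)] S'(2) p by auto
  define T where "T = snd e ` fst e"
  define f where "f = snd e \<circ> \<psi> \<circ> chart_inv c"
  define B where "B z a b = local_rep AF e \<sigma> z [a, b]" for z a b
  have sf: "real_form_on AF 2 UNIV \<sigma>" and closed: "\<And>p. ext_deriv AF \<sigma> p = (\<lambda>vs. 0)"
    using fibre_symplectic unfolding symplectic_form_def by auto
  have s\<sigma>: "smooth_form_on AF UNIV \<sigma>" and \<sigma>0: "\<And>y vs. length vs \<noteq> 2 \<Longrightarrow> \<sigma> y vs = 0"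
    using sf unfolding real_form_on_def by auto
  have T: "open T" unfolding T_def by (rule open_chart_image[OF e(3)])
  have altB: "linear (B z u)" "linear (\<lambda>u. B z u v)" "B z u v = - B z v u" if "z \<in> T" for z u v
    unfolding B_def[abs_def] using that s\<sigma>
    by (intro alt_form_local_rep[OF compat(3) e(1)]; simp add: T_def smooth_form_on_def)+
  have smB: "smooth_on (\<lambda>z. B z u v) T" for u v
    using smooth_form_onD(1)[OF s\<sigma> e(1), of "[u, v]"] by (simp add: B_def T_def)
  have smf: "smooth_on f X"
    using \<psi> c e(1) unfolding smooth_map_def f_def X_def S'_def
    by (metis (no_types, lifting) Int_assoc Int_commute)
  have Xq: "chart_inv c y \<in> S" "chart_inv c y \<in> fst c" "\<psi> (chart_inv c y) \<in> fst e" "snd c (chart_inv c y) = y" if "y \<in> X" for y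
    using that chc by (auto simp: X_def S'_def chart_inv_chart)
  have fT: "f ` X \<subseteq> T" using Xq by (auto simp: f_def T_def)
  have eq: "local_rep A c hor_form y = two_form (\<lambda>u v. B (f y) (frechet_derivative f (at y) u) (frechet_derivative f (at y) v))"
    if "y \<in> X" for y
  proof -
    define q where "q = chart_inv c y"
    have q: "q \<in> S" "q \<in> fst c" "\<psi> q \<in> fst e" "snd c q = y" using Xq[OF that] by (auto simp: q_def)
    have D: "tangent_map A AF \<psi> q (from_chart A c q u) = from_chart AF e (\<psi> q) (frechet_derivative f (at y) u)" for u
      using chart_deriv_eq_tangent_map(2)[OF compat(1) c q(2) compat(3) e(1) q(3) \<psi> S(1) q(1), of u]
      by (simp add: chart_deriv_def f_def q(4))
    have fy: "chart_inv e (f y) = \<psi> q" by (simp add: f_def q_def[symmetric] chart_inv_chart[OF e(3) q(3)])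
    have "of_real (hor_omega q (from_chart A c q u) (from_chart A c q v))
        = B (f y) (frechet_derivative f (at y) u) (frechet_derivative f (at y) v)" for u v
      unfolding \<sigma>[OF q(1), symmetric] D B_def local_rep_def fy by simp
    then show ?thesis
      unfolding hor_form_def[abs_def] local_rep_two_form q_def[symmetric] by simp
  qed
  have "smooth_on (\<lambda>y. B (f y) (frechet_derivative f (at y) u) (frechet_derivative f (at y) v)) X" for u v
    by (rule pullback_two_form(1)[OF X(1) smf T fT EG altB smB])
  from smooth_on_two_form[OF X(1) this]
  have "smooth_on (\<lambda>y. local_rep A c hor_form y vs) X" for vs
    by (rule iffD1[OF smooth_on_cong[OF X(1)], rotated]) (simp add: eq)
  with X show "\<exists>T. open T \<and> x \<in> T \<and> (\<forall>vs. smooth_on (\<lambda>y. local_rep A c hor_form y vs) T)" by blast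
  have fx: "f x = snd e (\<psi> p)" by (simp add: f_def p_def)
  have two: "(\<lambda>z. two_form (B z)) = local_rep AF e \<sigma>"
  proof (intro ext)
    fix z us
    show "two_form (B z) us = local_rep AF e \<sigma> z us"
    proof (cases "length us = 2")
      case True
      then obtain a b where "us = [a, b]" by (auto simp: numeral_2_eq_2 length_Suc_conv)
      then show ?thesis by (simp add: two_form_def B_def)
    qed (simp add: two_form_def local_rep_def \<sigma>0)
  qed
  have "flat_ext_deriv (\<lambda>z. two_form (B z)) (f x) [u, v, w] = 0" for u v w
    unfolding two fx using closed[of "\<psi> p"] unfolding ext_deriv_def e_def[symmetric] by (simp add: fun_eq_iff)
  from pullback_two_form(2)[OF X(1) smf T fT EG altB smB X(2) this]
  have "flat_ext_deriv (\<lambda>y. two_form (\<lambda>u v. B (f y) (frechet_derivative f (at y) u) (frechet_derivative f (at y) v))) x vs = 0" .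
  then show "flat_ext_deriv (local_rep A c hor_form) x vs = 0"
    using flat_ext_deriv_cong[OF X, of "local_rep A c hor_form"] eq by simp
qed

lemma hor_omega_self: "hor_omega q v v = 0"
  using hor_omega_skew[of q v v] by simp

lemma smooth_form_on_hor_form: "smooth_form_on A UNIV hor_form"
  unfolding smooth_form_on_def
proof (intro conjI ballI allI)
  show "alt_form (hor_form q)" for q
    unfolding hor_form_def
    by (rule alt_form_two_form)
       (use linear_compose[OF linear_hor_omega(1), of of_real] linear_compose[OF linear_hor_omega(2), of of_real]
         bounded_linear.linear[OF bounded_linear_of_real] in \<open>auto simp: o_def hor_omega_self\<close>)
  fix c vs assume c: "c \<in> A"
  show "smooth_on (\<lambda>x. local_rep A c hor_form x vs) (snd c ` (UNIV \<inter> fst c))"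
    by (rule smooth_on_locally) (use hor_form_local(1)[OF c] in auto)
qed

end

section \<open>Sections of \<open>\<pi>*T*\<^sub>1\<^sub>,\<^sub>0 B\<close>\<close>

lemma chart_at_self_eq: "to_chart self_atlas (UNIV, \<lambda>x. x) x v = v" "from_chart self_atlas (UNIV, \<lambda>x. x) x v = v"
  by (simp_all add: to_chart_def from_chart_def o_def)

lemma tangent_map_fun:
  assumes "chart_compatible A" "c \<in> A" "q \<in> fst c" "smooth_map A self_atlas U f" "open U" "q \<in> U"
  shows "tangent_map A self_atlas f q (from_chart A c q v) = frechet_derivative (\<lambda>x. f (chart_inv c x)) (at (snd c q)) v"
  using chart_deriv_eq_tangent_map(1)[OF assms(1-3) chart_compatible_self _ _ assms(4-6), of "(UNIV, \<lambda>x. x)" v]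
  by (simp add: self_atlas_def chart_at_self_eq[unfolded self_atlas_def] chart_deriv_def o_def)

lemma from_chart_at: "chart_compatible A \<Longrightarrow> from_chart A (chart_at A q) q v = v"
  using chart_deriv_id_same chart_at_in by (metis from_chart_eq)

lemma smooth_map_funD:
  "smooth_map A self_atlas U f \<Longrightarrow> c \<in> A \<Longrightarrow> smooth_on (\<lambda>x. f (chart_inv c x)) (snd c ` (U \<inter> fst c))"
  unfolding smooth_map_def self_atlas_def by (auto simp: o_def)

text \<open>Continuity, a separate clause of \<open>smooth_map\<close>, is recovered by gluing over
  the chart domains.\<close>

lemma smooth_map_funI:
  assumes "chart_compatible A" "open U" "\<And>c. c \<in> A \<Longrightarrow> smooth_on (\<lambda>x. f (chart_inv c x)) (snd c ` (U \<inter> fst c))"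
  shows "smooth_map A self_atlas U f"
proof -
  have "continuous_on (\<Union>q\<in>U. U \<inter> fst (chart_at A q)) f"
  proof (rule continuous_on_open_UN)
    fix q assume q: "q \<in> U"
    define c where "c = chart_at A q"
    have c: "c \<in> A" "q \<in> fst c" "is_chart c" using chart_at_in[OF assms(1)] by (auto simp: c_def)
    show "open (U \<inter> fst (chart_at A q))"
      unfolding c_def[symmetric] by (intro open_Int assms(2) open_chart_domain c(3))
    have "continuous_on (U \<inter> fst c) (\<lambda>p. (\<lambda>x. f (chart_inv c x)) (snd c p))"
      by (rule continuous_on_compose2[OF smooth_on_continuous_on[OF assms(3)[OF c(1)]]])
         (use c continuous_on_chart[OF c(3)] in \<open>auto intro: continuous_on_subset\<close>)
    then show "continuous_on (U \<inter> fst (chart_at A q)) f"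
      unfolding c_def[symmetric] by (rule continuous_on_eq) (simp add: chart_inv_chart[OF c(3)])
  qed
  moreover have "(\<Union>q\<in>U. U \<inter> fst (chart_at A q)) = U" using chart_at_in(2)[OF assms(1)] by blast
  ultimately have "continuous_on U f" by simp
  then show ?thesis using assms(3) unfolding smooth_map_def self_atlas_def by (auto simp: o_def)
qed

lemma smooth_map_of_chart:
  fixes A :: "('a::topological_space, 'e::euclidean_space) chart set"
  assumes "smooth_atlas A" "c \<in> A" "open U" "U \<subseteq> fst c" "smooth_on (\<lambda>x. f (chart_inv c x)) (snd c ` U)"
  shows "smooth_map A self_atlas U f"
proof -
  have ch: "\<forall>c\<in>A. is_chart c" using assms(1) unfolding smooth_atlas_def by blast
  have chs: "\<forall>c\<in>(self_atlas :: ('n::real_normed_vector, 'n) chart set). is_chart c"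
    by (simp add: self_atlas_def is_chart_self)
  have "U \<inter> fst c = U" using assms(4) by blast
  then have o: "open (snd c ` U)" using open_chart_image_Int[of c U] ch assms(2,3) by simp
  have "smooth_map A self_atlas U ((\<lambda>x. f (chart_inv c x)) \<circ> snd c)"
    by (rule smooth_map_compose[OF ch chart_compatible_self chs smooth_map_subset[OF smooth_map_chart[OF assms(1,2)] assms(4)] assms(3) _ o])
       (use assms(5) in \<open>auto simp: smooth_map_self\<close>)
  then show ?thesis
    by (rule smooth_map_cong[OF assms(3) ch chs, rotated]) (use assms(2,4) ch in \<open>auto simp: chart_inv_chart\<close>)
qed

lemma wedge_one_forms: "wedge (one_form \<alpha>) (one_form \<beta>) = two_form (\<lambda>u v. \<alpha> u * \<beta> v - \<alpha> v * \<beta> u)"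
proof
  fix vs show "wedge (one_form \<alpha>) (one_form \<beta>) vs = two_form (\<lambda>u v. \<alpha> u * \<beta> v - \<alpha> v * \<beta> u) vs"
  proof (cases vs)
    case (Cons v us)
    have "wedge (one_form \<alpha>) (one_form \<beta>) vs = \<alpha> v * one_form \<beta> us - one_form \<alpha> us * \<beta> v"
      unfolding Cons wedge.simps contract_one_form grade_inv_one_form wedge_minus_left
        wedge_scalar_form_left wedge_scalar_form_right by simp
    then show ?thesis unfolding Cons
      by (auto simp: two_form_def one_form_def length_Suc_conv numeral_2_eq_2)
  qed simp
qed

section \<open>Holomorphic coordinates pulled back from the base\<close>

context flat_bundle
begin

lemma open_vimage_\<pi>: "open U \<Longrightarrow> open (\<pi> -` U)"
  using smooth_\<pi> open_vimage unfolding smooth_map_def by blast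

text \<open>The values of \<open>tangent_map\<close> refer to the preferred chart at \<pi> q, which
  jumps with q. Passing to a fixed holomorphic chart z gives a smooth form of type (1, 0), which
  differs from d\<pi> at each point by a nonzero complex factor.\<close>

definition dz :: "('b, complex) chart \<Rightarrow> 'x \<Rightarrow> 'e \<Rightarrow> complex" where
  "dz z q v = to_chart Z z (\<pi> q) (d\<pi> q v)"

text \<open>A base coordinate as a function of the coordinates on the total space; by
  \<open>dz_coord\<close> its differential is \<open>dz z\<close>.\<close>

definition coord :: "('x, 'e) chart \<Rightarrow> ('b, complex) chart \<Rightarrow> 'e \<Rightarrow> complex" where
  "coord c z x = snd z (\<pi> (chart_inv c x))"

lemma to_chart_Z:
  assumes "z \<in> Z" "b \<in> fst z"
  obtains h where "h \<noteq> 0" "\<And>w. to_chart Z z b w = h * w"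
proof -
  obtain h where h: "\<And>w. to_chart Z z b w = h * w"
    using chart_compatible_riemann_surface(2)[OF surface chart_at_in(1)[OF compat(2)] assms(1) chart_at_in(2)[OF compat(2)] assms(2)]
    unfolding to_chart_eq by blast
  moreover have "h \<noteq> 0"
    using h[of "from_chart Z z b 1"] to_from_chart(1)[OF compat(2) assms, of 1] by auto
  ultimately show thesis using that by blast
qed

lemma dz_d\<pi>:
  assumes "z \<in> Z" "\<pi> q \<in> fst z"
  obtains h where "h \<noteq> 0" "\<And>v. dz z q v = h * d\<pi> q v"
proof -
  obtain h where "h \<noteq> 0" "\<And>w. to_chart Z z (\<pi> q) w = h * w"
    by (rule to_chart_Z[OF assms]) (rule that)
  then show thesis by (intro that[of h]) (auto simp: dz_def)
qed

lemma linear_dz: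
  assumes "z \<in> Z" "\<pi> q \<in> fst z"
  shows "linear (dz z q)"
  using linear_compose[OF linear_d\<pi> to_from_chart(3)[OF compat(2) assms]] by (simp add: dz_def[abs_def] o_def)

lemma dz_surj:
  assumes "z \<in> Z" "\<pi> q \<in> fst z"
  obtains v where "dz z q v = t"
proof -
  obtain h where "h \<noteq> 0" "\<And>v. dz z q v = h * d\<pi> q v" by (rule dz_d\<pi>[OF assms]) (rule that)
  then show thesis by (intro that[of "hlift q (t / h)"]) (simp add: hlift)
qed

lemma open_coord_domain:
  assumes "c \<in> A" "z \<in> Z" "open U"
  shows "open (snd c ` (U \<inter> \<pi> -` fst z \<inter> fst c))"
  using charts assms by (intro open_chart_image_Int open_Int open_vimage_\<pi> open_chart_domain) auto

lemma smooth_coord: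
  assumes "c \<in> A" "z \<in> Z"
  shows "smooth_on (coord c z) (snd c ` (\<pi> -` fst z \<inter> fst c))"
proof -
  have "smooth_on (snd z \<circ> \<pi> \<circ> chart_inv c) (snd c ` (UNIV \<inter> fst c \<inter> \<pi> -` fst z))"
    using smooth_\<pi> assms unfolding smooth_map_def by blast
  then show ?thesis by (simp add: coord_def[abs_def] o_def Int_commute)
qed

lemma dz_coord:
  assumes "c \<in> A" "z \<in> Z" "q \<in> fst c" "\<pi> q \<in> fst z"
  shows "dz z q (from_chart A c q v) = frechet_derivative (coord c z) (at (snd c q)) v"
  using chart_deriv_eq_tangent_map(1)[OF compat(1) assms(1,3) compat(2) assms(2,4) smooth_\<pi>, of v]
  by (simp add: dz_def chart_deriv_def coord_def[abs_def] o_def)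

text \<open>In a flat chart N is a constant space W. Cramer's rule combines two fixed vectors of W
  with smooth coefficients so that \<open>dz\<close> takes the constant value t. Smoothness of
  horizontal objects is tested on this frame, since \<open>hlift\<close> is normalised by the
  jumping preferred chart.\<close>

lemma local_flat_frame:
  assumes z: "z \<in> Z" and p: "\<pi> p \<in> fst z"
  obtains c T n where "c \<in> A" "open T" "snd c p \<in> T" "p \<in> fst c" "T \<subseteq> snd c ` (\<pi> -` fst z \<inter> fst c)"
    "\<And>t. smooth_on (n t) T" "\<And>t y. y \<in> T \<Longrightarrow> frechet_derivative (coord c z) (at y) (n t y) = t"
    "\<And>t y. y \<in> T \<Longrightarrow> from_chart A c (chart_inv c y) (n t y) \<in> N (chart_inv c y)"
proof -
  obtain c W where c: "c \<in> A" "p \<in> fst c" and W: "\<And>q. q \<in> fst c \<Longrightarrow> to_chart A c q ` N q = W"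
    using conjunct2[OF integrable[unfolded integrable_distribution_def], THEN spec, of p]
    by (elim bexE conjE exE) (rule that, assumption, assumption, erule (1) bspec)
  have chc: "is_chart c" using charts c by blast
  note tf = to_from_chart[OF compat(1) c(1)]
  obtain h where h: "h \<noteq> 0" "\<And>v. dz z p v = h * d\<pi> p v" by (rule dz_d\<pi>[OF z p]) (rule that)
  define w where "w s = to_chart A c p (hlift p (s / h))" for s
  have wW: "w s \<in> W" for s unfolding w_def W[OF c(2), symmetric] using hlift by blast
  define F where "F y = frechet_derivative (coord c z) (at y)" for y
  define Q where "Q = snd c ` (\<pi> -` fst z \<inter> fst c)"
  have Q: "open Q" unfolding Q_def using open_coord_domain[OF c(1) z open_UNIV] by simp
  have pQ: "snd c p \<in> Q" using p c by (auto simp: Q_def)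
  have Fw: "F (snd c p) (w s) = s" for s
    unfolding F_def using dz_coord[OF c(1) z c(2) p, of "w s"] h tf(2)[OF c(2)] by (simp add: w_def hlift)
  have smF: "smooth_on (\<lambda>y. F y v) Q" for v
    unfolding F_def Q_def by (rule smooth_on_derivative[OF smooth_coord[OF c(1) z]])
  have linF: "linear (F y)" if "y \<in> Q" for y
    unfolding F_def using smooth_on_has_derivative[OF smooth_coord[OF c(1) z]] that has_derivative_linear
    unfolding Q_def by blast
  define a where "a y = F y (w 1)" for y
  define b where "b y = F y (w \<i>)" for y
  define det where "det y = Im (cnj (a y) * b y)" for y
  have smab: "smooth_on a Q" "smooth_on b Q" unfolding a_def[abs_def] b_def[abs_def] by (rule smF)+
  have smI: "smooth_on (\<lambda>x. Im (cnj (f x) * g x)) T" if "smooth_on f T" "smooth_on g T" "open T" for f g and T :: "'e set"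
    by (intro smooth_on_bounded_linear_compose[OF bounded_linear_Im] smooth_on_mult
        smooth_on_bounded_linear_compose[OF bounded_linear_cnj] that)
  have smdet: "smooth_on det Q" unfolding det_def[abs_def] by (rule smI[OF smab Q])
  define T where "T = Q \<inter> det -` (- {0})"
  have T: "open T" unfolding T_def
    by (rule continuous_open_preimage[OF smooth_on_continuous_on[OF smdet] Q]) auto
  have TQ: "T \<subseteq> Q" by (auto simp: T_def)
  define n where "n t y = (Im (cnj t * b y) / det y) *\<^sub>R w 1 + (Im (cnj (a y) * t) / det y) *\<^sub>R w \<i>" for t y
  show thesis
  proof (rule that[of c T n])
    show "snd c p \<in> T" using pQ by (simp add: T_def det_def a_def b_def Fw)
    show "smooth_on (n t) T" for t unfolding n_def[abs_def]
      by (intro smooth_on_add smooth_on_scaleR smooth_on_divide smI smooth_on_const T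
          smooth_on_subset[OF smab(1) TQ] smooth_on_subset[OF smab(2) TQ] smooth_on_subset[OF smdet TQ])
         (auto simp: T_def)
    show "frechet_derivative (coord c z) (at y) (n t y) = t" if "y \<in> T" for t y
    proof -
      have y: "y \<in> Q" "Im (cnj (a y) * b y) \<noteq> 0" using that by (auto simp: T_def det_def)
      show ?thesis
        unfolding F_def[symmetric] n_def linear_add[OF linF[OF y(1)]] linear_scale[OF linF[OF y(1)]]
          a_def[symmetric] b_def[symmetric] det_def by (rule complex_basis_solve[OF y(2)])
    qed
    show "from_chart A c (chart_inv c y) (n t y) \<in> N (chart_inv c y)" if yT: "y \<in> T" for t y
    proof -
      have q: "chart_inv c y \<in> fst c" using yT chc by (auto simp: T_def Q_def chart_inv_chart)
      have "subspace W" unfolding W[OF q, symmetric] by (rule linear_subspace_image[OF tf(3)[OF q] subspace_N])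
      then have "n t y \<in> W" unfolding n_def using wW by (intro subspace_add subspace_scale)
      then obtain m where "m \<in> N (chart_inv c y)" "n t y = to_chart A c (chart_inv c y) m" using W[OF q] by blast
      then show ?thesis using tf(2)[OF q] by simp
    qed
  qed (use c T TQ in \<open>auto simp: Q_def\<close>)
qed

text \<open>Locally \<open>\<theta> = f dz\<close>, so \<open>d\<theta> = \<tau> \<and> \<theta>\<close> for \<open>\<tau> = df / f\<close>, and \<open>\<tau>\<close> may be changed by
  multiples of \<open>\<theta>\<close>. The \<open>\<xi>\<close> that annihilates the \<open>(1, 0)\<close>-part of \<open>N\<close> does not depend on the
  local choices, so no partition of unity is needed.\<close>

lemma differential_of_section:
  assumes U: "open U" and sm: "smooth_form_on A U (\<lambda>q. one_form (\<theta> q))"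
    and \<theta>: "\<And>q. q \<in> U \<Longrightarrow> \<exists>a\<noteq>0. \<forall>v. \<theta> q v = a * d\<pi> q v"
  obtains \<xi> where "smooth_form_on A U (\<lambda>q. one_form (\<xi> q))"
    "\<And>q vs. q \<in> U \<Longrightarrow> ext_deriv A (\<lambda>q. one_form (\<theta> q)) q vs = wedge (one_form (\<xi> q)) (one_form (\<theta> q)) vs"
proof -
  define d\<theta> where "d\<theta> q u v = ext_deriv A (\<lambda>q. one_form (\<theta> q)) q [u, v]" for q u v
  \<comment> \<open>The complex horizontal vector e = (hlift 1 - \<i> hlift \<i>) / (2
    \<theta>(hlift 1)) satisfies \<theta>(e) = 1, because \<theta> is complex linear in the base
    vector. Here \<xi>(v) is d\<theta>(v, e), so \<xi>(e) = 0.\<close>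
  define \<xi> where "\<xi> q v = (d\<theta> q v (hlift q 1) - \<i> * d\<theta> q v (hlift q \<i>)) / (2 * \<theta> q (hlift q 1))" for q v
  \<comment> \<open>On the domain of the chart z, \<theta> = f dz, \<tau> = df / f and k = \<tau>(e)
    with the horizontal vector e just described, whence \<xi> = \<tau> - k \<theta>.\<close>
  define f where "f z q = \<theta> q (hlift q 1) / dz z q (hlift q 1)" for z q
  define \<tau> where "\<tau> z q v = tangent_map A self_atlas (f z) q v / f z q" for z q v
  define k where "k z q = (\<tau> z q (hlift q 1) - \<i> * \<tau> z q (hlift q \<i>)) / (2 * \<theta> q (hlift q 1))" for z q
  define dom where "dom z = U \<inter> \<pi> -` fst z" for z :: "('b, complex) chart"
  have dom: "open (dom z)" if "z \<in> Z" for z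
    unfolding dom_def using U that charts by (intro open_Int open_vimage_\<pi> open_chart_domain) auto
  have \<theta>c: "smooth_on (\<lambda>x. \<theta> (chart_inv c x) (from_chart A c (chart_inv c x) v)) (snd c ` (U \<inter> fst c))"
    if "c \<in> A" for c v
    using smooth_form_onD(1)[OF sm that, of "[v]"] unfolding local_rep_one_form by (simp add: one_form_def)
  have f: "\<theta> q v = f z q * dz z q v" "f z q \<noteq> 0" if zq: "z \<in> Z" "q \<in> dom z" for z q v
  proof -
    have q: "q \<in> U" "\<pi> q \<in> fst z" using zq by (auto simp: dom_def)
    obtain a where a: "a \<noteq> 0" "\<And>v. \<theta> q v = a * d\<pi> q v" using \<theta>[OF q(1)] by blast
    obtain h where h: "h \<noteq> 0" "\<And>v. dz z q v = h * d\<pi> q v" by (rule dz_d\<pi>[OF zq(1) q(2)]) (rule that)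
    have "f z q = a / h" by (simp add: f_def a h hlift)
    then show "\<theta> q v = f z q * dz z q v" "f z q \<noteq> 0" using a h by auto
  qed
  have smf: "smooth_map A self_atlas (dom z) (f z)" if z: "z \<in> Z" for z
  proof (rule smooth_map_funI[OF compat(1) dom[OF z]])
    fix c assume c: "c \<in> A"
    have chc: "is_chart c" using charts c by blast
    let ?S = "snd c ` (dom z \<inter> fst c)"
    have S: "open ?S" by (rule open_chart_image_Int[OF chc dom[OF z]])
    have smD: "smooth_on (\<lambda>y. frechet_derivative (coord c z) (at y) v) ?S" for v
      by (rule smooth_on_subset[OF smooth_on_derivative[OF smooth_coord[OF c z]]]) (auto simp: dom_def)
    show "smooth_on (\<lambda>x. f z (chart_inv c x)) ?S"
    proof (rule smooth_on_locally)
      fix x assume x: "x \<in> ?S"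
      then obtain q where q: "q \<in> dom z" "q \<in> fst c" "x = snd c q" by blast
      obtain v where v: "dz z q v = 1" using dz_surj[OF z, of q 1] q(1) by (auto simp: dom_def)
      \<comment> \<open>\<open>hlift\<close> is not known to vary smoothly, so near q the quotient
        defining f is computed on a constant coordinate vector at which \<open>dz\<close> equals 1
        at q.\<close>
      define v0 where "v0 = to_chart A c q v"
      define T where "T = ?S \<inter> (\<lambda>y. frechet_derivative (coord c z) (at y) v0) -` (- {0})"
      have T: "open T" unfolding T_def
        by (rule continuous_open_preimage[OF smooth_on_continuous_on[OF smD] S]) auto
      have "frechet_derivative (coord c z) (at x) v0 = 1"
        using dz_coord[OF c z q(2), of v0] q v to_from_chart(2)[OF compat(1) c q(2)] by (simp add: v0_def dom_def)
      then have xT: "x \<in> T" using x by (simp add: T_def)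
      have "smooth_on (\<lambda>y. \<theta> (chart_inv c y) (from_chart A c (chart_inv c y) v0) / frechet_derivative (coord c z) (at y) v0) T"
        by (intro smooth_on_divide T smooth_on_subset[OF \<theta>c[OF c]] smooth_on_subset[OF smD])
           (auto simp: T_def dom_def)
      then have "smooth_on (\<lambda>x. f z (chart_inv c x)) T"
      proof (rule iffD1[OF smooth_on_cong[OF T], rotated])
        fix y assume y: "y \<in> T"
        then obtain q' where q': "q' \<in> dom z" "q' \<in> fst c" "y = snd c q'" by (auto simp: T_def)
        have "frechet_derivative (coord c z) (at y) v0 \<noteq> 0" using y by (simp add: T_def)
        then show "\<theta> (chart_inv c y) (from_chart A c (chart_inv c y) v0) / frechet_derivative (coord c z) (at y) v0 = f z (chart_inv c y)"
          using f(1)[OF z q'(1), of "from_chart A c q' v0"] dz_coord[OF c z q'(2), of v0] q'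
          by (simp add: chart_inv_chart[OF chc] dom_def)
      qed
      with T xT show "\<exists>T. open T \<and> x \<in> T \<and> smooth_on (\<lambda>x. f z (chart_inv c x)) T" by blast
    qed
  qed
  have lin\<tau>: "linear (\<tau> z q)" if z: "z \<in> Z" and q: "q \<in> dom z" for z q
  proof -
    have "linear (tangent_map A self_atlas (f z) q)"
      by (rule linear_tangent_map[OF compat(1) chart_compatible_self smf[OF z] dom[OF z] q])
    from linear_complex_scale[OF this, of "inverse (f z q)"] show ?thesis
      by (simp add: \<tau>_def[abs_def] divide_inverse mult.commute)
  qed
  have d: "ext_deriv A (\<lambda>q. one_form (\<theta> q)) q vs = wedge (one_form (\<tau> z q)) (one_form (\<theta> q)) vs"
    if z: "z \<in> Z" and q: "q \<in> dom z" for z q vs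
  proof -
    define c where "c = chart_at A q"
    have c: "c \<in> A" "q \<in> fst c" "is_chart c" using chart_at_in[OF compat(1)] by (auto simp: c_def)
    have fc: "from_chart A c q v = v" for v unfolding c_def by (rule from_chart_at[OF compat(1)])
    define F where "F = coord c z"
    define fc where "fc y = f z (chart_inv c y)" for y
    let ?S = "snd c ` (dom z \<inter> fst c)"
    define x where "x = snd c q"
    have S: "open ?S" "x \<in> ?S" using open_chart_image_Int[OF c(3) dom[OF z]] q c by (auto simp: x_def)
    have F: "smooth_on F ?S" unfolding F_def
      by (rule smooth_on_subset[OF smooth_coord[OF c(1) z]]) (auto simp: dom_def)
    have fcs: "smooth_on fc ?S" unfolding fc_def by (rule smooth_map_funD[OF smf[OF z] c(1)])
    have loc: "local_rep A c (\<lambda>q. one_form (\<theta> q)) y = one_form (\<lambda>v. fc y * frechet_derivative F (at y) v)"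
      if yS: "y \<in> ?S" for y
    proof -
      obtain q' where q': "q' \<in> dom z" "q' \<in> fst c" "y = snd c q'" using yS by blast
      show ?thesis unfolding local_rep_one_form
        using f(1)[OF z q'(1)] dz_coord[OF c(1) z q'(2)] q'
        by (simp add: chart_inv_chart[OF c(3)] dom_def fc_def F_def)
    qed
    have der: "frechet_derivative (\<lambda>y. fc y * frechet_derivative F (at y) v) (at x) u =
      fc x * frechet_derivative (\<lambda>y. frechet_derivative F (at y) v) (at x) u
      + frechet_derivative fc (at x) u * frechet_derivative F (at x) v" for u v
      by (simp only: frechet_derivative_at[OF has_derivative_mult[OF smooth_on_has_derivative[OF fcs S(2)]
          smooth_on_has_derivative[OF smooth_on_derivative[OF F, of v] S(2)]], symmetric])
    have Dfc: "frechet_derivative fc (at x) u = tangent_map A self_atlas (f z) q u" for u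
      using tangent_map_fun[OF compat(1) c(1,2) smf[OF z] dom[OF z] q, of u]
      unfolding fc x_def fc_def[abs_def] by simp
    have DF: "fc x * frechet_derivative F (at x) u = \<theta> q u" for u
      using dz_coord[OF c(1) z c(2), of u] f(1)[OF z q, of u] q unfolding fc
      by (simp add: fc_def x_def F_def dom_def chart_inv_chart[OF c(3,2)])
    have fx: "fc x = f z q" by (simp add: fc_def x_def chart_inv_chart[OF c(3,2)])
    have "ext_deriv A (\<lambda>q. one_form (\<theta> q)) q vs = flat_ext_deriv (local_rep A c (\<lambda>q. one_form (\<theta> q))) x vs"
      by (simp add: ext_deriv_def c_def x_def)
    also have "\<dots> = flat_ext_deriv (\<lambda>y. one_form (\<lambda>v. fc y * frechet_derivative F (at y) v)) x vs"
      by (rule flat_ext_deriv_cong[OF S]) (simp add: loc)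
    \<comment> \<open>The second derivatives of F cancel by symmetry, leaving df \<and> dz = \<tau>
      \<and> \<theta>.\<close>
    also have "\<dots> = two_form (\<lambda>u v. \<tau> z q u * \<theta> q v - \<tau> z q v * \<theta> q u) vs"
      unfolding flat_ext_deriv_one_form der two_form_def
      using second_derivative_symmetric[OF S(1) F S(2), of "vs ! 1" "vs ! 0"]
      by (simp add: \<tau>_def Dfc[symmetric] DF[symmetric] fx[symmetric] f(2)[OF z q, folded fx])
    finally show ?thesis by (simp add: wedge_one_forms)
  qed
  have \<xi>: "\<xi> q v = \<tau> z q v - k z q * \<theta> q v" "\<theta> q (hlift q s) = s * \<theta> q (hlift q 1)" "\<theta> q (hlift q 1) \<noteq> 0"
    if z: "z \<in> Z" and q: "q \<in> dom z" for z q v s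
  proof -
    obtain a where a: "a \<noteq> 0" "\<And>v. \<theta> q v = a * d\<pi> q v" using \<theta>[of q] q by (auto simp: dom_def)
    show s: "\<theta> q (hlift q s) = s * \<theta> q (hlift q 1)" for s by (simp add: a hlift)
    show nz: "\<theta> q (hlift q 1) \<noteq> 0" by (simp add: a hlift)
    have dd: "d\<theta> q u w = \<tau> z q u * \<theta> q w - \<tau> z q w * \<theta> q u" for u w
      unfolding d\<theta>_def d[OF z q] wedge_one_forms by (simp add: two_form_def)
    have "(a * x - b * y - \<i> * (a * (\<i> * x) - c * y)) / (2 * x) = a - (b - \<i> * c) / (2 * x) * y"
      if "x \<noteq> 0" for a b c x y :: complex using that by (simp add: field_simps)
    then show "\<xi> q v = \<tau> z q v - k z q * \<theta> q v"
      unfolding \<xi>_def k_def dd s[of \<i>] using nz by blast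
  qed
  have smk: "\<exists>S. open S \<and> p \<in> S \<and> S \<subseteq> dom z \<and> smooth_map A self_atlas S (k z)" if z: "z \<in> Z" and p: "p \<in> dom z" for z p
  proof -
    have pz: "\<pi> p \<in> fst z" using p by (simp add: dom_def)
    obtain c T n where c: "c \<in> A" and T: "open T" "snd c p \<in> T" and pc: "p \<in> fst c" and TS: "T \<subseteq> snd c ` (\<pi> -` fst z \<inter> fst c)"
      and n: "\<And>t. smooth_on (n t) T" "\<And>t y. y \<in> T \<Longrightarrow> frechet_derivative (coord c z) (at y) (n t y) = t"
      "\<And>t y. y \<in> T \<Longrightarrow> from_chart A c (chart_inv c y) (n t y) \<in> N (chart_inv c y)"
      by (rule local_flat_frame[OF z pz]) (rule that)
    have chc: "is_chart c" using charts c by blast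
    define S where "S = dom z \<inter> (fst c \<inter> snd c -` T)"
    have S: "open S" unfolding S_def
      by (intro open_Int dom[OF z] continuous_open_preimage[OF continuous_on_chart[OF chc] open_chart_domain[OF chc] T(1)])
    have Sc: "S \<subseteq> fst c" "S \<inter> fst c = S" by (auto simp: S_def)
    have So: "open (snd c ` S)" using open_chart_image_Int[OF chc S] Sc by simp
    have ST: "snd c ` S \<subseteq> T" by (auto simp: S_def)
    define fc where "fc y = f z (chart_inv c y)" for y
    have "smooth_on fc (snd c ` (dom z \<inter> fst c))" unfolding fc_def by (rule smooth_map_funD[OF smf[OF z] c])
    then have fcs: "smooth_on fc (snd c ` S)" by (rule smooth_on_subset) (auto simp: S_def)
    have fc0: "fc y \<noteq> 0" if "y \<in> snd c ` S" for y
      using that f(2)[OF z] by (auto simp: fc_def chart_inv_chart[OF chc] S_def)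
    have nS: "smooth_on (n t) (snd c ` S)" for t by (rule smooth_on_subset[OF n(1) ST])
    \<comment> \<open>This is k in terms of the smooth flat frame. One factor \<open>fc y\<close>
      comes from \<tau> = df / f, the other from \<theta> having the value f on \<open>n 1\<close>.
      The frame differs from \<open>hlift\<close> by the complex factor s, under which the quotient
      does not change.\<close>
    have eq: "(frechet_derivative fc (at y) (n 1 y) - \<i> * frechet_derivative fc (at y) (n \<i> y)) / (2 * fc y * fc y) = k z (chart_inv c y)"
      if yS: "y \<in> snd c ` S" for y
    proof -
      obtain q where q: "q \<in> dom z" "q \<in> fst c" "y = snd c q" "y \<in> T" using yS by (auto simp: S_def)
      have qy: "chart_inv c y = q" using q chart_inv_chart[OF chc] by simp
      have qz: "\<pi> q \<in> fst z" using q by (simp add: dom_def)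
      obtain h where h: "h \<noteq> 0" "\<And>v. dz z q v = h * d\<pi> q v" by (rule dz_d\<pi>[OF z qz]) (rule that)
      define s where "s = 1 / h"
      have nt: "from_chart A c q (n t y) = hlift q (t * s)" for t
      proof -
        have "dz z q (from_chart A c q (n t y)) = t"
          using dz_coord[OF c z q(2) qz] n(2)[OF q(4)] q(3) by simp
        then have "d\<pi> q (from_chart A c q (n t y)) = t * s" using h by (simp add: s_def field_simps)
        then show ?thesis using hlift_unique n(3)[OF q(4), of t] unfolding qy by metis
      qed
      have D: "frechet_derivative fc (at y) (n t y) = f z q * \<tau> z q (hlift q (t * s))" for t
        using tangent_map_fun[OF compat(1) c q(2) smf[OF z] dom[OF z] q(1), of "n t y"] f(2)[OF z q(1)]
        unfolding nt by (simp add: fc_def[abs_def] q(3) \<tau>_def)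
      have lh: "hlift q (Complex a b) = a *\<^sub>R hlift q 1 + b *\<^sub>R hlift q \<i>" for a b
      proof -
        have "Complex a b = a *\<^sub>R 1 + b *\<^sub>R \<i>" by (simp add: complex_eq_iff)
        then show ?thesis by (simp only: linear_add[OF linear_hlift] linear_scale[OF linear_hlift])
      qed
      obtain a b where ab: "s = Complex a b" by (cases s)
      have "\<i> * s = Complex (- b) a" by (simp add: ab complex_eq_iff)
      \<comment> \<open>t \<mapsto> \<tau>(hlift t) - \<i> \<tau>(hlift (\<i> t)) is complex linear
        although \<tau> and \<open>hlift\<close> are only real linear.\<close>
      then have num: "\<tau> z q (hlift q (1 * s)) - \<i> * \<tau> z q (hlift q (\<i> * s)) = s * (\<tau> z q (hlift q 1) - \<i> * \<tau> z q (hlift q \<i>))"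
        unfolding mult_1 ab by (simp only: lh linear_add[OF lin\<tau>[OF z q(1)]] linear_scale[OF lin\<tau>[OF z q(1)]])
           (simp add: complex_eq_iff algebra_simps)
      have "\<theta> q (hlift q s) = f z q"
        using f(1)[OF z q(1), of "hlift q s"] h by (simp add: hlift s_def)
      then have th: "s * \<theta> q (hlift q 1) = f z q" using \<xi>(2)[OF z q(1), of s] by simp
      have "k z q = (s * (\<tau> z q (hlift q 1) - \<i> * \<tau> z q (hlift q \<i>))) / (2 * (s * \<theta> q (hlift q 1)))"
        using h by (simp add: k_def s_def)
      also have "\<dots> = (\<tau> z q (hlift q (1 * s)) - \<i> * \<tau> z q (hlift q (\<i> * s))) / (2 * f z q)"
        unfolding num th ..
      finally have kq: "k z q = (\<tau> z q (hlift q (1 * s)) - \<i> * \<tau> z q (hlift q (\<i> * s))) / (2 * f z q)" .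
      have "(x * a - \<i> * (x * b)) / (2 * x * x) = (a - \<i> * b) / (2 * x)" if "x \<noteq> 0" for a b x :: complex
        using that by (simp add: field_simps)
      moreover have "fc y = f z q" by (simp add: fc_def qy)
      ultimately show ?thesis unfolding D qy kq using f(2)[OF z q(1)] by simp
    qed
    have "smooth_on (\<lambda>y. (frechet_derivative fc (at y) (n 1 y) - \<i> * frechet_derivative fc (at y) (n \<i> y)) / (2 * fc y * fc y)) (snd c ` S)"
      by (intro smooth_on_divide smooth_on_diff smooth_on_mult smooth_on_const smooth_on_derivative_apply So fcs nS) (simp add: fc0)
    then have "smooth_on (\<lambda>y. k z (chart_inv c y)) (snd c ` S)"
      by (rule iffD1[OF smooth_on_cong[OF So], rotated]) (rule eq)
    from smooth_map_of_chart[OF atlas c S Sc(1) this]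
    show ?thesis using S p pc T(2) by (intro exI[of _ S]) (auto simp: S_def)
  qed
  show thesis
  proof (rule that[of \<xi>])
    have pz: "\<exists>z. z \<in> Z \<and> p \<in> dom z" if "p \<in> U" for p
      using that chart_at_in[OF compat(2), of "\<pi> p"] by (intro exI[of _ "chart_at Z (\<pi> p)"]) (simp add: dom_def)
    show "ext_deriv A (\<lambda>q. one_form (\<theta> q)) q vs = wedge (one_form (\<xi> q)) (one_form (\<theta> q)) vs" if qU: "q \<in> U" for q vs
    proof -
      obtain z where z: "z \<in> Z" "q \<in> dom z" using pz[OF qU] by blast
      show ?thesis unfolding d[OF z] wedge_one_forms \<xi>(1)[OF z] by (simp add: two_form_def algebra_simps)
    qed
    show "smooth_form_on A U (\<lambda>q. one_form (\<xi> q))"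
    proof (rule smooth_form_on_one_form[OF charts(1) U])
      show "linear (\<xi> q)" if qU: "q \<in> U" for q
      proof -
        obtain z where z: "z \<in> Z" "q \<in> dom z" using pz[OF qU] by blast
        obtain a where a: "\<And>v. \<theta> q v = a * d\<pi> q v" using \<theta>[OF qU] by blast
        have "\<xi> q = (\<lambda>v. \<tau> z q v - (k z q * a) * d\<pi> q v)"
          using \<xi>(1)[OF z] by (simp add: a fun_eq_iff mult.assoc)
        then show ?thesis by (simp add: linear_compose_sub[OF lin\<tau>[OF z] linear_complex_scale[OF linear_d\<pi>]])
      qed
      fix c v assume c: "c \<in> A"
      have chc: "is_chart c" using charts c by blast
      show "smooth_on (\<lambda>x. \<xi> (chart_inv c x) (from_chart A c (chart_inv c x) v)) (snd c ` (U \<inter> fst c))"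
      proof (rule smooth_on_locally)
        fix x assume "x \<in> snd c ` (U \<inter> fst c)"
        then obtain p where p: "p \<in> U" "p \<in> fst c" "x = snd c p" by blast
        obtain z where z: "z \<in> Z" "p \<in> dom z" using pz[OF p(1)] by blast
        obtain S where S: "open S" "p \<in> S" "S \<subseteq> dom z" "smooth_map A self_atlas S (k z)" using smk[OF z] by blast
        let ?T = "snd c ` (S \<inter> fst c)"
        have T: "open ?T" by (rule open_chart_image_Int[OF chc S(1)])
        define fc where "fc y = f z (chart_inv c y)" for y
        have fcs: "smooth_on fc ?T" unfolding fc_def
          by (rule smooth_map_funD[OF smooth_map_subset[OF smf[OF z(1)] S(3)] c])
        have fc0: "fc y \<noteq> 0" if "y \<in> ?T" for y
          using that f(2)[OF z(1)] S(3) by (auto simp: fc_def chart_inv_chart[OF chc])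
        have "smooth_on (\<lambda>y. frechet_derivative fc (at y) v / fc y
            - k z (chart_inv c y) * \<theta> (chart_inv c y) (from_chart A c (chart_inv c y) v)) ?T"
          by (intro smooth_on_diff smooth_on_divide smooth_on_mult T smooth_on_derivative fcs
              smooth_map_funD[OF S(4) c] smooth_on_subset[OF \<theta>c[OF c]])
             (use S(3) fc0 in \<open>auto simp: dom_def\<close>)
        then have "smooth_on (\<lambda>x. \<xi> (chart_inv c x) (from_chart A c (chart_inv c x) v)) ?T"
        proof (rule iffD1[OF smooth_on_cong[OF T], rotated])
          fix y assume "y \<in> ?T"
          then obtain q where q: "q \<in> S" "q \<in> fst c" "y = snd c q" by blast
          have qd: "q \<in> dom z" using q S(3) by blast
          have qy: "chart_inv c y = q" using q chart_inv_chart[OF chc] by simp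
          show "frechet_derivative fc (at y) v / fc y - k z (chart_inv c y) * \<theta> (chart_inv c y) (from_chart A c (chart_inv c y) v)
            = \<xi> (chart_inv c y) (from_chart A c (chart_inv c y) v)"
            unfolding qy \<xi>(1)[OF z(1) qd]
            using tangent_map_fun[OF compat(1) c q(2) smf[OF z(1)] dom[OF z(1)] qd, of v]
            by (simp add: \<tau>_def fc_def[abs_def] q(3) chart_inv_chart[OF chc q(2)])
        qed
        moreover have "x \<in> ?T" using p S(2) by blast
        ultimately show "\<exists>T. open T \<and> x \<in> T \<and> smooth_on (\<lambda>x. \<xi> (chart_inv c x) (from_chart A c (chart_inv c x) v)) T"
          using T by blast
      qed
    qed
  qed
qed

end

section \<open>The generalized complex structure\<close>

lemma wedge_in_Reals:
  assumes "\<And>us. \<alpha> us \<in> \<real>" "\<And>us. \<beta> us \<in> \<real>"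
  shows "wedge \<alpha> \<beta> vs \<in> \<real>"
  using assms by (induction vs arbitrary: \<alpha> \<beta>) auto

lemma wedge_degree:
  assumes "\<And>us. length us \<noteq> m \<Longrightarrow> \<alpha> us = 0" "\<And>us. length us \<noteq> n \<Longrightarrow> \<beta> us = 0" "length vs \<noteq> m + n"
  shows "wedge \<alpha> \<beta> vs = 0"
  using assms
proof (induction vs arbitrary: \<alpha> \<beta> m n)
  case Nil
  then show ?case by (cases "m = 0") auto
next
  case (Cons v vs)
  have "wedge (contract v \<alpha>) \<beta> vs = 0"
  proof (cases m)
    case 0
    then have "contract v \<alpha> = (\<lambda>us. 0)" using Cons.prems(1) by auto
    then show ?thesis by (simp add: wedge_zero_left)
  next
    case (Suc m')
    show ?thesis by (rule Cons.IH[of m' _ n]) (use Cons.prems Suc in auto)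
  qed
  moreover have "wedge (grade_inv \<alpha>) (contract v \<beta>) vs = 0"
  proof (cases n)
    case 0
    then have "contract v \<beta> = (\<lambda>us. 0)" using Cons.prems(2) by auto
    then show ?thesis by (simp add: wedge_zero_right)
  next
    case (Suc n')
    show ?thesis by (rule Cons.IH[of m _ n']) (use Cons.prems Suc in auto)
  qed
  ultimately show ?case by simp
qed

lemma flat_ext_deriv_scalar_form:
  "flat_ext_deriv (\<lambda>y. scalar_form (f y)) x = one_form (\<lambda>v. frechet_derivative f (at x) v)"
proof
  fix vs :: "'a list"
  show "flat_ext_deriv (\<lambda>y. scalar_form (f y)) x vs = one_form (\<lambda>v. frechet_derivative f (at x) v) vs"
  proof (cases vs)
    case (Cons v us)
    have "contract v (scalar_form c) = (\<lambda>us. 0)" for c by (auto simp: scalar_form_def)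
    then have "flat_ext_deriv (\<lambda>y. contract v (scalar_form (f y))) x us = 0"
      by (simp add: flat_ext_deriv_def)
    then show ?thesis unfolding Cons flat_ext_deriv_Cons
      by (auto simp: form_deriv_def scalar_form_def one_form_def)
  qed simp
qed

lemma smooth_form_on_differentiable:
  "smooth_form_on A U \<rho> \<Longrightarrow> c \<in> A \<Longrightarrow> x \<in> snd c ` (U \<inter> fst c) \<Longrightarrow> (\<lambda>y. local_rep A c \<rho> y vs) differentiable (at x)"
  using smooth_form_onD(1) smooth_on_differentiable by blast

lemma wedge_form_exp_left_commute:
  "wedge (form_exp (two_form B)) (wedge (one_form \<xi>) \<beta>) vs = wedge (one_form \<xi>) (wedge (form_exp (two_form B)) \<beta>) vs"
proof -
  have "wedge (form_exp (two_form B)) (one_form \<xi>) = wedge (one_form \<xi>) (form_exp (two_form B))"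
    by (rule ext) (rule wedge_form_exp_one_form_commute)
  then show ?thesis by (simp add: wedge_assoc)
qed

section \<open>The real 1-form d^cV\<close>

locale pluriharmonic_bundle = flat_bundle A Z AF \<pi> \<sigma> \<omega> N
  for A :: "('x::topological_space, 'e::euclidean_space) chart set"
    and Z :: "('b::topological_space, complex) chart set"
    and AF :: "('f::topological_space, 'k::real_normed_vector) chart set"
    and \<pi> :: "'x \<Rightarrow> 'b" and \<sigma> :: "'f \<Rightarrow> 'k form" and \<omega> :: "'x \<Rightarrow> 'e \<Rightarrow> 'e \<Rightarrow> real" and N :: "'x \<Rightarrow> 'e set" +
  fixes V :: "'b \<Rightarrow> real"
  assumes pluri: "pluriharmonic Z V" and V_pos: "V b > 0"
begin

lemma smooth_V: "smooth_map Z self_atlas UNIV V"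
  using pluri unfolding pluriharmonic_def by blast

lemma charts_self: "\<forall>c\<in>(self_atlas :: ('n::real_normed_vector, 'n) chart set). is_chart c"
  by (simp add: self_atlas_def is_chart_self)

lemma smooth_V\<pi>: "smooth_map A self_atlas UNIV (\<lambda>p. V (\<pi> p))"
  using smooth_map_compose[OF charts(1) compat(2) charts_self smooth_\<pi> open_UNIV smooth_V open_UNIV]
  by (simp add: o_def)

definition dV :: "'b \<Rightarrow> complex \<Rightarrow> real" where
  "dV b = tangent_map Z self_atlas V b"

text \<open>The convention d^cV(v) = dV(\<i> d\<pi> v) gives d^cV + \<i> dV = 2 \<i> \<partial>V.
  Multiplication by \<i> in the preferred chart is the complex structure because the charts are
  holomorphic.\<close>

definition dcV :: "'x \<Rightarrow> 'e \<Rightarrow> complex" where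
  "dcV q v = of_real (dV (\<pi> q) (\<i> * d\<pi> q v))"

definition dV\<pi> :: "'x \<Rightarrow> 'e \<Rightarrow> real" where
  "dV\<pi> q v = tangent_map A self_atlas (\<lambda>p. V (\<pi> p)) q v"

lemma linear_dV: "linear (dV b)"
  unfolding dV_def by (rule linear_tangent_map[OF compat(2) chart_compatible_self smooth_V]) auto

lemma dV\<pi>_eq: "dV\<pi> q v = dV (\<pi> q) (d\<pi> q v)"
  using tangent_map_compose[OF compat(1,2) chart_compatible_self smooth_\<pi> open_UNIV _ smooth_V open_UNIV, of q v]
  by (simp add: dV\<pi>_def dV_def o_def)

text \<open>In a holomorphic coordinate \<open>w\<close> on \<open>B\<close>, \<open>gV\<close> is \<open>2 \<i> \<partial>V / \<partial>w\<close>.\<close>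

definition gV :: "('b, complex) chart \<Rightarrow> complex \<Rightarrow> complex" where
  "gV z w = of_real (frechet_derivative (\<lambda>w. V (chart_inv z w)) (at w) \<i>)
    + \<i> * of_real (frechet_derivative (\<lambda>w. V (chart_inv z w)) (at w) 1)"

lemma gV_holomorphic:
  assumes z: "z \<in> Z"
  shows "smooth_on (gV z) (snd z ` fst z)"
    and "w \<in> snd z ` fst z \<Longrightarrow> \<exists>g'. \<forall>s. frechet_derivative (gV z) (at w) s = g' * s"
proof -
  define f where "f w = V (chart_inv z w)" for w
  define P where "P w = frechet_derivative f (at w) 1" for w
  define Q where "Q w = frechet_derivative f (at w) \<i>" for w
  let ?T = "snd z ` fst z"
  have T: "open ?T" using open_chart_image charts z by blast
  have f: "smooth_on f ?T" unfolding f_def using smooth_map_funD[OF smooth_V z] by simp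
  have P: "smooth_on P ?T" and Q: "smooth_on Q ?T" unfolding P_def Q_def by (rule smooth_on_derivative[OF f])+
  have g: "gV z = (\<lambda>w. of_real (Q w) + \<i> * of_real (P w))"
    by (simp add: gV_def[abs_def] P_def Q_def f_def[abs_def])
  show "smooth_on (gV z) ?T" unfolding g
    by (intro smooth_on_add smooth_on_mult smooth_on_const smooth_on_of_real T P Q)
  assume w: "w \<in> ?T"
  let ?DP = "frechet_derivative P (at w)" and ?DQ = "frechet_derivative Q (at w)"
  have dP: "((\<lambda>w. complex_of_real (P w)) has_derivative (\<lambda>s. of_real (?DP s))) (at w)"
    by (rule bounded_linear.has_derivative[OF bounded_linear_of_real smooth_on_has_derivative[OF P w]])
  have dQ: "((\<lambda>w. complex_of_real (Q w)) has_derivative (\<lambda>s. of_real (?DQ s))) (at w)"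
    by (rule bounded_linear.has_derivative[OF bounded_linear_of_real smooth_on_has_derivative[OF Q w]])
  have wb: "wirtinger_bar (\<lambda>w. complex_of_real (f w)) w' = (of_real (P w') + \<i> * of_real (Q w')) / 2" if "w' \<in> ?T" for w'
    unfolding wirtinger_bar_def frechet_derivative_bounded_linear_compose[OF bounded_linear_of_real smooth_on_differentiable[OF f that]]
    by (simp add: P_def Q_def)
  have "frechet_derivative (wirtinger_bar (\<lambda>w. complex_of_real (f w))) (at w)
      = frechet_derivative (\<lambda>w. (of_real (P w) + \<i> * of_real (Q w)) / 2) (at w)"
    by (rule frechet_derivative_cong[OF T w wb])
  also have "\<dots> = (\<lambda>s. (of_real (?DP s) + \<i> * of_real (?DQ s)) / 2)"
    by (rule frechet_derivative_at[symmetric])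
       (intro bounded_linear.has_derivative[OF bounded_linear_divide] has_derivative_add has_derivative_mult_right dP dQ)
  finally have D: "frechet_derivative (wirtinger_bar (\<lambda>w. complex_of_real (f w))) (at w)
      = (\<lambda>s. (of_real (?DP s) + \<i> * of_real (?DQ s)) / 2)" .
  have quarter: "(x / 2 - \<i> * (y / 2)) / 2 = (x - \<i> * y) / 4" for x y :: complex
    by (simp add: diff_divide_distrib)
  have "wirtinger (wirtinger_bar (\<lambda>w. complex_of_real (f w))) w = 0"
    using pluri z w unfolding pluriharmonic_def f_def by blast
  then have "of_real (?DP 1) + \<i> * of_real (?DQ 1) - \<i> * (of_real (?DP \<i>) + \<i> * of_real (?DQ \<i>)) = 0"
    unfolding wirtinger_def D quarter by simp
  \<comment> \<open>The real part of the equation is Laplace's equation, the imaginary part the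
    equality of the mixed derivatives; together they are the Cauchy-Riemann equations for
    \<open>Q + \<i> P\<close>.\<close>
  then have harm: "?DQ \<i> = - ?DP 1" "?DP \<i> = ?DQ 1" by (simp_all add: complex_eq_iff)
  have Dg: "frechet_derivative (gV z) (at w) = (\<lambda>s. of_real (?DQ s) + \<i> * of_real (?DP s))"
    unfolding g by (rule frechet_derivative_at[symmetric]) (intro has_derivative_add has_derivative_mult_right dP dQ)
  have "of_real (?DQ s) + \<i> * of_real (?DP s) = (of_real (?DQ 1) + \<i> * of_real (?DP 1)) * s" for s
  proof -
    have s: "s = Re s *\<^sub>R 1 + Im s *\<^sub>R \<i>" by (simp add: complex_eq_iff)
    have "?DP s = Re s * ?DP 1 + Im s * ?DP \<i>" "?DQ s = Re s * ?DQ 1 + Im s * ?DQ \<i>"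
      using has_derivative_linear[OF smooth_on_has_derivative[OF P w]] has_derivative_linear[OF smooth_on_has_derivative[OF Q w]]
      by (subst s, simp only: linear_add linear_scale real_scaleR_def)+
    then show ?thesis unfolding harm by (simp add: complex_eq_iff algebra_simps)
  qed
  then show "\<exists>g'. \<forall>s. frechet_derivative (gV z) (at w) s = g' * s" unfolding Dg by blast
qed

text \<open>For a real linear L on the complex plane, s \<mapsto> L(\<i> s) + \<i> L(s) is complex
  linear, so the sum is of type (1, 0). In the proof h exchanges the preferred chart for z.\<close>

lemma dcV_plus_dV:
  assumes z: "z \<in> Z" and q: "\<pi> q \<in> fst z"
  shows "dcV q v + \<i> * of_real (dV\<pi> q v) = gV z (snd z (\<pi> q)) * dz z q v"
proof -
  obtain h where h: "h \<noteq> 0" "\<And>w. to_chart Z z (\<pi> q) w = h * w" by (rule to_chart_Z[OF z q]) (rule that)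
  define L where "L = frechet_derivative (\<lambda>w. V (chart_inv z w)) (at (snd z (\<pi> q)))"
  have L: "dV (\<pi> q) s = L (h * s)" for s
    using tangent_map_fun[OF compat(2) z q smooth_V open_UNIV, of "to_chart Z z (\<pi> q) s"]
      to_from_chart(2)[OF compat(2) z q, of s] by (simp add: dV_def L_def h)
  have linL: "linear L"
  proof -
    have "L = (\<lambda>s. dV (\<pi> q) (s / h))" using h by (simp add: L)
    moreover have "linear (\<lambda>s. s / h)" by (rule bounded_linear.linear[OF bounded_linear_divide])
    ultimately show ?thesis using linear_compose[OF _ linear_dV] by (simp add: o_def)
  qed
  have "of_real (L (\<i> * s)) + \<i> * of_real (L s) = (of_real (L \<i>) + \<i> * of_real (L 1)) * s" for s
  proof -
    have s: "s = Re s *\<^sub>R 1 + Im s *\<^sub>R \<i>" and is1: "\<i> * s = Re s *\<^sub>R \<i> + (- Im s) *\<^sub>R 1"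
      by (simp_all add: complex_eq_iff)
    have "L s = Re s * L 1 + Im s * L \<i>"
      by (subst s) (simp only: linear_add[OF linL] linear_scale[OF linL] real_scaleR_def)
    moreover have "L (\<i> * s) = Re s * L \<i> - Im s * L 1"
      unfolding is1 by (simp add: linear_add[OF linL] linear_scale[OF linL] linear_diff[OF linL])
    ultimately show ?thesis by (simp add: complex_eq_iff algebra_simps)
  qed
  from this[of "h * d\<pi> q v"] show ?thesis
    by (simp add: dcV_def dV\<pi>_eq L gV_def L_def[symmetric] dz_def h mult.left_commute)
qed

text \<open>The splitting d^cV = 2 \<i> \<partial>V - \<i> dV prepares closedness: in the first
  summand a holomorphic function multiplies the differential of the coordinate, and the second
  summand is exact.\<close>

lemma dcV_coord:
  assumes c: "c \<in> A" and z: "z \<in> Z" and q: "q \<in> fst c" "\<pi> q \<in> fst z"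
  shows "dcV q (from_chart A c q v) = gV z (coord c z (snd c q)) * frechet_derivative (coord c z) (at (snd c q)) v
    + frechet_derivative (\<lambda>y. - (\<i> * of_real (V (\<pi> (chart_inv c y))))) (at (snd c q)) v"
proof -
  have chc: "is_chart c" using charts c by blast
  have x: "snd c q \<in> snd c ` (UNIV \<inter> fst c)" using q by blast
  have V: "smooth_on (\<lambda>y. V (\<pi> (chart_inv c y))) (snd c ` (UNIV \<inter> fst c))" by (rule smooth_map_funD[OF smooth_V\<pi> c])
  have bl: "bounded_linear (\<lambda>r. - (\<i> * complex_of_real r))"
    by (intro bounded_linear_minus bounded_linear_const_mult bounded_linear_of_real)
  have "frechet_derivative (\<lambda>y. - (\<i> * of_real (V (\<pi> (chart_inv c y))))) (at (snd c q)) v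
     = - (\<i> * of_real (dV\<pi> q (from_chart A c q v)))"
    unfolding frechet_derivative_bounded_linear_compose[OF bl smooth_on_differentiable[OF V x]]
    using tangent_map_fun[OF compat(1) c q(1) smooth_V\<pi> open_UNIV, of v] by (simp add: dV\<pi>_def)
  moreover have "dcV q (from_chart A c q v) = gV z (snd z (\<pi> q)) * dz z q (from_chart A c q v) - \<i> * of_real (dV\<pi> q (from_chart A c q v))"
    using dcV_plus_dV[OF z q(2)] by (simp add: eq_diff_eq)
  ultimately show ?thesis
    by (simp add: dz_coord[OF c z q] coord_def chart_inv_chart[OF chc q(1)])
qed

lemma dcV_local:
  assumes c: "c \<in> A" and q: "q \<in> fst c"
  shows "\<exists>T. open T \<and> snd c q \<in> T \<and> (\<forall>v. smooth_on (\<lambda>x. dcV (chart_inv c x) (from_chart A c (chart_inv c x) v)) T)"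
    and "flat_ext_deriv (local_rep A c (\<lambda>q. one_form (dcV q))) (snd c q) vs = 0"
proof -
  have chc: "is_chart c" using charts c by blast
  define z where "z = chart_at Z (\<pi> q)"
  have z: "z \<in> Z" "\<pi> q \<in> fst z" "is_chart z" using chart_at_in[OF compat(2)] by (auto simp: z_def)
  define T where "T = snd c ` (\<pi> -` fst z \<inter> fst c)"
  have T: "open T" "snd c q \<in> T" unfolding T_def using open_coord_domain[OF c z(1) open_UNIV] q z(2) by auto
  define F where "F = coord c z"
  define G where "G y = gV z (F y)" for y
  define K where "K y = - (\<i> * complex_of_real (V (\<pi> (chart_inv c y))))" for y
  have F: "smooth_on F T" unfolding F_def T_def by (rule smooth_coord[OF c z(1)])
  have FT: "F ` T \<subseteq> snd z ` fst z" by (auto simp: F_def T_def coord_def chart_inv_chart[OF chc])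
  have zT: "open (snd z ` fst z)" by (rule open_chart_image[OF z(3)])
  have G: "smooth_on G T" unfolding G_def
    by (rule smooth_on_compose[OF T(1) zT FT F gV_holomorphic(1)[OF z(1)]])
  have "smooth_on (\<lambda>y. V (\<pi> (chart_inv c y))) (snd c ` (UNIV \<inter> fst c))" by (rule smooth_map_funD[OF smooth_V\<pi> c])
  then have "smooth_on (\<lambda>y. V (\<pi> (chart_inv c y))) T" by (rule smooth_on_subset) (auto simp: T_def)
  then have K: "smooth_on K T" unfolding K_def
    by (intro smooth_on_minus smooth_on_mult smooth_on_const smooth_on_of_real T)
  have eq: "dcV (chart_inv c y) (from_chart A c (chart_inv c y) v) = G y * frechet_derivative F (at y) v + frechet_derivative K (at y) v"
    if "y \<in> T" for y v
    using that dcV_coord[OF c z(1), of _ v] by (auto simp: T_def chart_inv_chart[OF chc] G_def F_def K_def[abs_def])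
  have "smooth_on (\<lambda>x. dcV (chart_inv c x) (from_chart A c (chart_inv c x) v)) T" for v
    by (rule iffD1[OF smooth_on_cong[OF T(1)] smooth_on_add[OF T(1) smooth_on_mult[OF T(1) G smooth_on_derivative[OF F]]
          smooth_on_derivative[OF K]]]) (simp add: eq)
  with T show "\<exists>T. open T \<and> snd c q \<in> T \<and> (\<forall>v. smooth_on (\<lambda>x. dcV (chart_inv c x) (from_chart A c (chart_inv c x) v)) T)"
    by blast
  let ?x = "snd c q"
  have "F ?x \<in> snd z ` fst z" using FT T(2) by blast
  then obtain g' where g': "\<And>s. frechet_derivative (gV z) (at (F ?x)) s = g' * s" using gV_holomorphic(2)[OF z(1)] by blast
  have "(gV z has_derivative frechet_derivative (gV z) (at (F ?x))) (at (F ?x))"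
    using smooth_on_has_derivative[OF gV_holomorphic(1)[OF z(1)] \<open>F ?x \<in> _\<close>] .
  from diff_chain_at[OF smooth_on_has_derivative[OF F T(2)] this]
  \<comment> \<open>Holomorphy of \<open>gV\<close> makes dG a multiple of dF, so dG \<and> dF
    vanishes in the exterior derivative of G dF.\<close>
  have DG: "frechet_derivative G (at ?x) u = g' * frechet_derivative F (at ?x) u" for u
    unfolding G_def[abs_def] by (simp add: o_def frechet_derivative_at[symmetric] g')
  have der: "frechet_derivative (\<lambda>y. G y * frechet_derivative F (at y) v + frechet_derivative K (at y) v) (at ?x) u
    = (G ?x * frechet_derivative (\<lambda>y. frechet_derivative F (at y) v) (at ?x) u
      + frechet_derivative G (at ?x) u * frechet_derivative F (at ?x) v)
      + frechet_derivative (\<lambda>y. frechet_derivative K (at y) v) (at ?x) u" for u v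
    by (simp only: frechet_derivative_at[OF has_derivative_add[OF has_derivative_mult[OF smooth_on_has_derivative[OF G T(2)]
          smooth_on_has_derivative[OF smooth_on_derivative[OF F, of v] T(2)]]
          smooth_on_has_derivative[OF smooth_on_derivative[OF K, of v] T(2)]], symmetric])
  have "flat_ext_deriv (local_rep A c (\<lambda>q. one_form (dcV q))) ?x vs
    = flat_ext_deriv (\<lambda>y. one_form (\<lambda>v. G y * frechet_derivative F (at y) v + frechet_derivative K (at y) v)) ?x vs"
    by (rule flat_ext_deriv_cong[OF T]) (simp add: local_rep_one_form eq)
  also have "\<dots> = 0"
    unfolding flat_ext_deriv_one_form der DG
    using second_derivative_symmetric[OF T(1) F T(2), of "vs ! 1" "vs ! 0"] second_derivative_symmetric[OF T(1) K T(2), of "vs ! 1" "vs ! 0"]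
    by simp
  finally show "flat_ext_deriv (local_rep A c (\<lambda>q. one_form (dcV q))) ?x vs = 0" .
qed

lemma linear_dcV: "linear (dcV q)"
proof -
  have "linear (\<lambda>v. \<i> * d\<pi> q v)" by (rule linear_complex_scale[OF linear_d\<pi>])
  from linear_compose[OF linear_compose[OF this linear_dV] bounded_linear.linear[OF bounded_linear_of_real]]
  show ?thesis by (simp add: dcV_def[abs_def] o_def)
qed

lemma smooth_form_on_dcV: "smooth_form_on A UNIV (\<lambda>q. one_form (dcV q))"
proof (rule smooth_form_on_one_form[OF charts(1) open_UNIV linear_dcV])
  fix c v assume c: "c \<in> A"
  show "smooth_on (\<lambda>x. dcV (chart_inv c x) (from_chart A c (chart_inv c x) v)) (snd c ` (UNIV \<inter> fst c))"
    by (rule smooth_on_locally) (use dcV_local(1)[OF c] in blast)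
qed

section \<open>The twisting 3-form\<close>

definition Hform :: "'x \<Rightarrow> 'e form" where
  "Hform q = wedge (one_form (dcV q)) (hor_form q)"

lemma smooth_Hform: "smooth_form_on A UNIV Hform"
  unfolding Hform_def[abs_def]
  by (rule smooth_form_on_wedge[OF charts(1) open_UNIV smooth_form_on_dcV smooth_form_on_hor_form])

lemma real_form_Hform: "real_form_on A 3 UNIV Hform"
proof -
  have "one_form (dcV q) us \<in> \<real>" "hor_form q us \<in> \<real>" for q us
    by (auto simp: one_form_def dcV_def hor_form_def two_form_def)
  then have "Hform q vs \<in> \<real>" for q vs unfolding Hform_def by (rule wedge_in_Reals)
  moreover have "Hform q vs = 0" if "length vs \<noteq> 3" for q vs
    unfolding Hform_def by (rule wedge_degree[of 1 _ 2]) (use that in \<open>auto simp: one_form_def hor_form_def two_form_def\<close>)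
  ultimately show ?thesis unfolding real_form_on_def using smooth_Hform by blast
qed

lemma closed_Hform: "ext_deriv A Hform p = (\<lambda>vs. 0)"
proof
  fix vs
  define c where "c = chart_at A p"
  have c: "c \<in> A" "p \<in> fst c" using chart_at_in[OF compat(1)] by (auto simp: c_def)
  let ?x = "snd c p" and ?a = "local_rep A c (\<lambda>q. one_form (dcV q))" and ?w = "local_rep A c hor_form"
  have x: "?x \<in> snd c ` (UNIV \<inter> fst c)" "?x \<in> snd c ` fst c" using c by auto
  have "ext_deriv A Hform p vs = flat_ext_deriv (\<lambda>y. wedge (?a y) (?w y)) ?x vs"
    by (simp add: ext_deriv_def c_def[symmetric] Hform_def[abs_def] local_rep_wedge[symmetric])
  also have "\<dots> = wedge (flat_ext_deriv ?a ?x) (?w ?x) vs + wedge (grade_inv (?a ?x)) (flat_ext_deriv ?w ?x) vs"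
    by (rule flat_ext_deriv_wedge)
       (use smooth_form_on_differentiable[OF smooth_form_on_dcV c(1) x(1)]
          smooth_form_on_differentiable[OF smooth_form_on_hor_form c(1) x(1)] in auto)
  also have "flat_ext_deriv ?a ?x = (\<lambda>vs. 0)" using dcV_local(2)[OF c] by blast
  also have "flat_ext_deriv ?w ?x = (\<lambda>vs. 0)" using hor_form_local(2)[OF c(1) x(2)] by blast
  finally show "ext_deriv A Hform p vs = 0" by (simp add: wedge_zero_left wedge_zero_right)
qed

section \<open>The line bundle of spinors\<close>

definition BV :: "'x \<Rightarrow> 'e \<Rightarrow> 'e \<Rightarrow> complex" where
  "BV q u v = \<i> * of_real (V (\<pi> q) * hor_omega q u v)"

definition kappa :: "'x \<Rightarrow> 'e form set" where
  "kappa q = wedge (form_exp (two_form (BV q))) ` kappa_I A Z \<pi> q"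

lemma BV_linear: "linear (BV q u)" "linear (\<lambda>u. BV q u v)" "BV q v v = 0"
proof -
  have *: "linear (\<lambda>u. \<i> * of_real (r * f u))" if "linear f" for r and f :: "'e \<Rightarrow> real"
    using that by (simp add: linear_iff algebra_simps scaleR_conv_of_real)
  show "linear (BV q u)" "linear (\<lambda>u. BV q u v)"
    unfolding BV_def[abs_def] by (intro * linear_hor_omega)+
  show "BV q v v = 0" by (simp add: BV_def hor_omega_self)
qed

text \<open>In this form the Leibniz rule differentiates only V, as \<open>hor_form\<close> is
  closed.\<close>

lemma two_form_BV: "two_form (BV q) = wedge (scalar_form (\<i> * of_real (V (\<pi> q)))) (hor_form q)"
  by (rule ext) (simp add: wedge_scalar_form_left hor_form_def two_form_def BV_def)

lemma smooth_form_on_scaled: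
  fixes r :: complex
  shows "smooth_form_on A UNIV (\<lambda>q. two_form (\<lambda>u v. r * of_real (V (\<pi> q) * hor_omega q u v)))"
proof (rule smooth_form_on_two_form[OF charts(1) open_UNIV])
  have *: "linear (\<lambda>u. r * of_real (s * f u))" if "linear f" for s and f :: "'e \<Rightarrow> real"
    using that by (simp add: linear_iff algebra_simps scaleR_conv_of_real)
  show "linear (\<lambda>v. r * of_real (V (\<pi> q) * hor_omega q u v))" "linear (\<lambda>u. r * of_real (V (\<pi> q) * hor_omega q u v))" for q u v
    by (intro * linear_hor_omega)+
  show "r * of_real (V (\<pi> q) * hor_omega q v v) = 0" for q v by (simp add: hor_omega_self)
  fix c u v assume c: "c \<in> A"
  let ?S = "snd c ` (UNIV \<inter> fst c)"
  have S: "open ?S" by (rule open_chart_image_Int) (use charts c in auto)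
  have V: "smooth_on (\<lambda>y. V (\<pi> (chart_inv c y))) ?S" by (rule smooth_map_funD[OF smooth_V\<pi> c])
  have w: "smooth_on (\<lambda>x. of_real (hor_omega (chart_inv c x) (from_chart A c (chart_inv c x) u) (from_chart A c (chart_inv c x) v)) :: complex) ?S"
    using smooth_form_onD(1)[OF smooth_form_on_hor_form c, of "[u, v]"]
    by (simp add: hor_form_def[abs_def] local_rep_two_form two_form_def)
  show "smooth_on (\<lambda>x. r * of_real (V (\<pi> (chart_inv c x)) * hor_omega (chart_inv c x) (from_chart A c (chart_inv c x) u)
       (from_chart A c (chart_inv c x) v))) ?S"
    unfolding of_real_mult by (intro smooth_on_mult smooth_on_const smooth_on_of_real S V w)
qed

lemma smooth_form_on_BV: "smooth_form_on A UNIV (\<lambda>q. two_form (BV q))"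
  using smooth_form_on_scaled[of \<i>] by (simp add: BV_def[abs_def])

lemma smooth_form_on_exp_BV: "smooth_form_on A UNIV (\<lambda>q. form_exp (two_form (BV q)))"
  by (rule smooth_form_on_form_exp[OF charts(1) open_UNIV smooth_form_on_BV]) simp

lemma nondegenerate_vertical:
  assumes "u \<in> vertical A Z \<pi> q" "\<And>v. v \<in> vertical A Z \<pi> q \<Longrightarrow> \<omega> q u v = 0"
  shows "u = 0"
  using conjunct1[OF conjunct2[OF nondegenerate[unfolded nondegenerate_2form_along_def]], THEN spec, THEN bspec, OF assms(1)]
    assms(2) by blast

text \<open>Locally exp(\<i> V \<omega>) \<and> dz generates \<open>kappa\<close>. The kernel of dz
  is the vertical space, where V \<omega> is nondegenerate because V > 0, and dz attains 1 and \<i>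
  on horizontal lifts; these are the hypotheses of \<open>pure_exp_spinor\<close> and
  \<open>real_rank_zero_exp_spinor\<close>.\<close>

lemma almost_generalized_complex_kappa: "almost_generalized_complex A kappa"
  unfolding almost_generalized_complex_def
proof
  fix p
  define z where "z = chart_at Z (\<pi> p)"
  have z: "z \<in> Z" "\<pi> p \<in> fst z" "is_chart z" using chart_at_in[OF compat(2)] by (auto simp: z_def)
  define U where "U = \<pi> -` fst z"
  have U: "open U" unfolding U_def by (rule open_vimage_\<pi>[OF open_chart_domain[OF z(3)]])
  define \<rho> where "\<rho> q = wedge (form_exp (two_form (BV q))) (one_form (dz z q))" for q
  have "smooth_form_on A U (\<lambda>q. one_form (dz z q))"
  proof (rule smooth_form_on_one_form[OF charts(1) U])
    show "linear (dz z q)" if "q \<in> U" for q using linear_dz[OF z(1)] that by (simp add: U_def)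
    fix c v assume c: "c \<in> A"
    have chc: "is_chart c" using charts c by blast
    show "smooth_on (\<lambda>x. dz z (chart_inv c x) (from_chart A c (chart_inv c x) v)) (snd c ` (U \<inter> fst c))"
      by (rule iffD1[OF smooth_on_cong smooth_on_derivative[OF smooth_coord[OF c z(1)], of v, folded U_def]])
         (use open_chart_image_Int[OF chc U] dz_coord[OF c z(1)] in \<open>auto simp: chart_inv_chart[OF chc] U_def\<close>)
  qed
  then have sm: "smooth_form_on A U \<rho>" unfolding \<rho>_def[abs_def]
    by (rule smooth_form_on_wedge[OF charts(1) U smooth_form_on_subset[OF smooth_form_on_exp_BV subset_UNIV]])
  have "pure_spinor (\<rho> q) \<and> real_rank_zero (\<rho> q) \<and> kappa q = range (\<lambda>a::complex. \<lambda>vs. a * \<rho> q vs)" if "q \<in> U" for q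
  proof (intro conjI)
    have qz: "\<pi> q \<in> fst z" using that by (simp add: U_def)
    obtain h where h: "h \<noteq> 0" "\<And>v. dz z q v = h * d\<pi> q v" by (rule dz_d\<pi>[OF z(1) qz]) (rule that)
    have n: "dz z q (hlift q (1 / h)) = 1" "dz z q (hlift q (\<i> / h)) = \<i>" using h by (simp_all add: hlift)
    show "pure_spinor (\<rho> q)" unfolding \<rho>_def
      by (rule pure_exp_spinor[OF linear_dz[OF z(1) qz] n(1) BV_linear])
    show "real_rank_zero (\<rho> q)" unfolding \<rho>_def BV_def[abs_def]
    proof (rule real_rank_zero_exp_spinor[OF linear_dz[OF z(1) qz] n])
      show "linear (\<lambda>u. V (\<pi> q) * hor_omega q u v)" for v
        using linear_hor_omega(1)[of q v] by (simp add: linear_iff algebra_simps)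
      fix u assume u: "dz z q u = 0" and 0: "\<And>v. dz z q v = 0 \<Longrightarrow> V (\<pi> q) * hor_omega q u v = 0"
      have vu: "u \<in> vertical A Z \<pi> q" using u h by (simp add: vertical_iff)
      show "u = 0"
      proof (rule nondegenerate_vertical[OF vu])
        fix v assume v: "v \<in> vertical A Z \<pi> q"
        then have "V (\<pi> q) * hor_omega q u v = 0" using 0 h by (simp add: vertical_iff)
        then show "\<omega> q u v = 0"
          using V_pos[of "\<pi> q"] by (simp add: hor_omega_def vproj_of_vertical[OF vu] vproj_of_vertical[OF v])
      qed
    qed
    \<comment> \<open>\<open>kappa_I\<close> is spanned by d\<pi> in the preferred chart; rescaling
      by h turns this into the span of the smooth form \<open>dz z\<close>.\<close>
    have "wedge E (one_form (\<lambda>v. a * d\<pi> q v)) = (\<lambda>vs. (a / h) * wedge E (one_form (dz z q)) vs)" for a and E :: "'e form"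
    proof -
      have 0: "one_form (\<lambda>v. a * d\<pi> q v) = (\<lambda>vs. (a / h) * one_form (dz z q) vs)"
        using h by (simp add: one_form_def fun_eq_iff)
      show ?thesis unfolding 0 by (rule ext) (rule wedge_scale_right)
    qed
    then have "kappa q = range (\<lambda>a vs. (a / h) * \<rho> q vs)"
      unfolding kappa_def kappa_I_def \<rho>_def image_image by simp
    also have "\<dots> = (\<lambda>a vs. a * \<rho> q vs) ` range (\<lambda>a. a / h)" by (simp add: image_image)
    also have "range (\<lambda>a. a / h) = UNIV"
      using h(1) by (intro surjI[of _ "\<lambda>a. a * h"]) simp
    finally show "kappa q = range (\<lambda>a::complex. \<lambda>vs. a * \<rho> q vs)" .
  qed
  with U sm z(2) show "\<exists>U \<rho>. open U \<and> p \<in> U \<and> smooth_form_on A U \<rho> \<and>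
     (\<forall>q\<in>U. pure_spinor (\<rho> q) \<and> real_rank_zero (\<rho> q) \<and> kappa q = range (\<lambda>a::complex. \<lambda>vs. a * \<rho> q vs))"
    by (intro exI[of _ U] exI[of _ \<rho>]) (simp add: U_def)
qed

text \<open>Formulated at a single point, so that \<xi> is just a covector there and its smooth
  choice is made elsewhere. The multiple of \<theta> arising from H and d(V \<omega>) stands to the
  left of \<omega>; centrality of 2-forms brings it next to \<rho>, where \<theta> \<and> \<theta> =
  0.\<close>

lemma twisted_deriv_exp_spinor:
  assumes U: "open U" "q \<in> U" and \<rho>: "\<And>q. q \<in> U \<Longrightarrow> \<rho> q = wedge (form_exp (two_form (BV q))) (one_form (\<theta> q))"
    and sm: "smooth_form_on A U (\<lambda>q. one_form (\<theta> q))"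
    and \<theta>: "a \<noteq> 0" "\<And>v. \<theta> q v = a * d\<pi> q v"
    and \<xi>: "\<And>vs. ext_deriv A (\<lambda>q. one_form (\<theta> q)) q vs = wedge (one_form \<xi>) (one_form (\<theta> q)) vs"
  shows "twisted_ext_deriv A Hform \<rho> q vs = wedge (one_form \<xi>) (\<rho> q) vs"
proof -
  define c where "c = chart_at A q"
  have c: "c \<in> A" "q \<in> fst c" "is_chart c" using chart_at_in[OF compat(1)] by (auto simp: c_def)
  define x where "x = snd c q"
  have cx: "chart_inv c x = q" unfolding x_def by (rule chart_inv_chart[OF c(3,2)])
  have fc: "from_chart A c q v = v" for v unfolding c_def by (rule from_chart_at[OF compat(1)])
  \<comment> \<open>In the preferred chart at q the coordinate expression of a form at q is the form
    itself.\<close>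
  have at_x: "local_rep A c \<alpha> x = \<alpha> q" for \<alpha> :: "'x \<Rightarrow> 'e form"
    unfolding local_rep_def[abs_def] cx fc by simp
  let ?S = "snd c ` (U \<inter> fst c)"
  have S: "open ?S" "x \<in> ?S" using open_chart_image_Int[OF c(3) U(1)] U(2) c(2) by (auto simp: x_def)
  have xU: "x \<in> snd c ` (UNIV \<inter> fst c)" "x \<in> snd c ` fst c" using c by (auto simp: x_def)
  let ?E = "form_exp (two_form (BV q))" and ?\<Theta> = "one_form (\<theta> q)" and ?R = "\<rho> q"
  define Bc where "Bc y u v = BV (chart_inv c y) (from_chart A c (chart_inv c y) u) (from_chart A c (chart_inv c y) v)" for y u v
  have Bc: "local_rep A c (\<lambda>q. two_form (BV q)) = (\<lambda>y. two_form (Bc y))"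
    by (rule ext) (simp add: local_rep_two_form Bc_def[abs_def])
  have dB: "form_differentiable (\<lambda>y. two_form (Bc y)) x"
    using smooth_form_on_differentiable[OF smooth_form_on_BV c(1) xU(1)] unfolding Bc by blast
  have d\<Theta>: "form_differentiable (local_rep A c (\<lambda>q. one_form (\<theta> q))) x"
    using smooth_form_on_differentiable[OF sm c(1) S(2)] by blast
  have Vd: "(\<lambda>y. V (\<pi> (chart_inv c y))) differentiable (at x)"
    by (rule smooth_on_differentiable[OF smooth_map_funD[OF smooth_V\<pi> c(1)] xU(1)])
  define \<beta> where "\<beta> v = \<i> * complex_of_real (dV\<pi> q v)" for v
  have bl: "bounded_linear (\<lambda>r. \<i> * complex_of_real r)"
    by (intro bounded_linear_const_mult bounded_linear_of_real)
  have D\<beta>: "frechet_derivative (\<lambda>y. \<i> * complex_of_real (V (\<pi> (chart_inv c y)))) (at x) = \<beta>"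
  proof
    fix v show "frechet_derivative (\<lambda>y. \<i> * complex_of_real (V (\<pi> (chart_inv c y)))) (at x) v = \<beta> v"
      unfolding frechet_derivative_bounded_linear_compose[OF bl Vd]
      using tangent_map_fun[OF compat(1) c(1,2) smooth_V\<pi> open_UNIV, of v]
      by (simp add: \<beta>_def dV\<pi>_def x_def fc)
  qed
  have "(\<lambda>y. \<i> * complex_of_real (V (\<pi> (chart_inv c y)))) differentiable (at x)"
    using bounded_linear.has_derivative[OF bl] Vd unfolding differentiable_def by blast
  then have sd: "form_differentiable (\<lambda>y. scalar_form (\<i> * complex_of_real (V (\<pi> (chart_inv c y))))) x"
    unfolding scalar_form_def by (intro allI, case_tac "vs = []") (simp_all only: if_True if_False differentiable_const simp_thms)
  have sc: "local_rep A c (\<lambda>q. scalar_form (\<i> * of_real (V (\<pi> q)))) = (\<lambda>y. scalar_form (\<i> * of_real (V (\<pi> (chart_inv c y)))))"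
    by (intro ext) (simp add: local_rep_def scalar_form_def)
  have Bw: "(\<lambda>y. two_form (Bc y)) = (\<lambda>y. wedge (scalar_form (\<i> * of_real (V (\<pi> (chart_inv c y))))) (local_rep A c hor_form y))"
    unfolding Bc[symmetric] two_form_BV by (rule ext) (simp only: local_rep_wedge fun_cong[OF sc])
  have hd: "form_differentiable (local_rep A c hor_form) x"
    using smooth_form_on_differentiable[OF smooth_form_on_hor_form c(1) xU(1)] by blast
  have dh: "flat_ext_deriv (local_rep A c hor_form) x = (\<lambda>vs. 0)" using hor_form_local(2)[OF c(1) xU(2)] by blast
  have dBc: "flat_ext_deriv (\<lambda>y. two_form (Bc y)) x = wedge (one_form \<beta>) (hor_form q)"
    unfolding Bw by (intro ext) (simp add: flat_ext_deriv_wedge[OF sd hd] dh wedge_zero_right flat_ext_deriv_scalar_form D\<beta> at_x)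
  have Bx: "two_form (Bc x) = two_form (BV q)" using at_x[of "\<lambda>q. two_form (BV q)"] unfolding Bc .
  have dE: "flat_ext_deriv (\<lambda>y. form_exp (two_form (Bc y))) x = wedge (wedge (one_form \<beta>) (hor_form q)) ?E"
    by (rule ext) (simp add: flat_ext_deriv_form_exp[OF dB] dBc Bx)
  have loc: "local_rep A c \<rho> y = wedge (form_exp (two_form (Bc y))) (local_rep A c (\<lambda>q. one_form (\<theta> q)) y)" if "y \<in> ?S" for y
  proof -
    have "chart_inv c y \<in> U" using that by (auto simp: chart_inv_chart[OF c(3)])
    from \<rho>[OF this] have "local_rep A c \<rho> y = local_rep A c (\<lambda>q. wedge (form_exp (two_form (BV q))) (one_form (\<theta> q))) y"
      by (simp add: local_rep_def[abs_def])
    then show ?thesis by (simp add: local_rep_wedge local_rep_form_exp fun_cong[OF Bc])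
  qed
  have "ext_deriv A \<rho> q vs = flat_ext_deriv (local_rep A c \<rho>) x vs"
    by (simp add: ext_deriv_def c_def x_def)
  also have "\<dots> = flat_ext_deriv (\<lambda>y. wedge (form_exp (two_form (Bc y))) (local_rep A c (\<lambda>q. one_form (\<theta> q)) y)) x vs"
    by (rule flat_ext_deriv_cong[OF S]) (simp add: loc)
  also have "\<dots> = wedge (wedge (wedge (one_form \<beta>) (hor_form q)) ?E) ?\<Theta> vs
      + wedge ?E (flat_ext_deriv (local_rep A c (\<lambda>q. one_form (\<theta> q))) x) vs"
    unfolding flat_ext_deriv_wedge[OF form_differentiable_form_exp[OF dB] d\<Theta>] dE Bx at_x grade_inv_form_exp ..
  also have "flat_ext_deriv (local_rep A c (\<lambda>q. one_form (\<theta> q))) x = wedge (one_form \<xi>) ?\<Theta>"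
    using \<xi> by (intro ext) (simp add: ext_deriv_def c_def x_def)
  also have "wedge (wedge (wedge (one_form \<beta>) (hor_form q)) ?E) ?\<Theta> vs = wedge (one_form \<beta>) (wedge (hor_form q) ?R) vs"
  proof -
    have "wedge (wedge (wedge (one_form \<beta>) (hor_form q)) ?E) ?\<Theta> vs = wedge (wedge (one_form \<beta>) (hor_form q)) ?R vs"
      unfolding \<rho>[OF U(2)] by (rule wedge_assoc[symmetric])
    then show ?thesis by (simp add: wedge_assoc)
  qed
  also have "wedge ?E (wedge (one_form \<xi>) ?\<Theta>) vs = wedge (one_form \<xi>) ?R vs"
    unfolding \<rho>[OF U(2)] by (rule wedge_form_exp_left_commute)
  finally have "twisted_ext_deriv A Hform \<rho> q vs = wedge (one_form (dcV q)) (wedge (hor_form q) ?R) vs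
      + wedge (one_form \<beta>) (wedge (hor_form q) ?R) vs + wedge (one_form \<xi>) ?R vs"
    by (simp add: twisted_ext_deriv_def Hform_def wedge_assoc)
  also have "wedge (one_form (dcV q)) (wedge (hor_form q) ?R) vs + wedge (one_form \<beta>) (wedge (hor_form q) ?R) vs = 0"
  proof -
    define z where "z = chart_at Z (\<pi> q)"
    have z: "z \<in> Z" "\<pi> q \<in> fst z" using chart_at_in[OF compat(2)] by (auto simp: z_def)
    obtain h where h: "h \<noteq> 0" "\<And>v. dz z q v = h * d\<pi> q v" by (rule dz_d\<pi>[OF z]) (rule that)
    \<comment> \<open>The sum d^cV + \<i> dV is \<open>gV\<close> times dz by
      \<open>dcV_plus_dV\<close>; dz is h d\<pi> and \<theta> is a d\<pi>, whence the
      factor.\<close>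
    define s where "s = gV z (snd z (\<pi> q)) * h / a"
    have "dcV q v + \<beta> v = s * \<theta> q v" for v
      using dcV_plus_dV[OF z, of v] \<theta> by (simp add: \<beta>_def s_def h)
    then have "(\<lambda>us. one_form (dcV q) us + one_form \<beta> us) = (\<lambda>us. s * ?\<Theta> us)"
      by (simp add: one_form_def fun_eq_iff)
    then have "wedge (one_form (dcV q)) (wedge (hor_form q) ?R) vs + wedge (one_form \<beta>) (wedge (hor_form q) ?R) vs
      = s * wedge ?\<Theta> (wedge (hor_form q) ?R) vs"
      by (simp add: wedge_add_left[symmetric] wedge_scale_left)
    also have "wedge ?\<Theta> (wedge (hor_form q) ?R) vs = wedge (hor_form q) (wedge ?\<Theta> ?R) vs"
      unfolding hor_form_def by (rule wedge_two_form_left_commute[symmetric])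
    also have "wedge ?\<Theta> ?R = (\<lambda>us. 0)"
      unfolding \<rho>[OF U(2)] by (rule ext) (rule wedge_one_form_form_exp_self)
    finally show ?thesis by (simp add: wedge_zero_right)
  qed
  finally show ?thesis by simp
qed

lemma integrable_kappa: "integrable_wrt A Hform kappa"
  unfolding integrable_wrt_def
proof (intro allI impI)
  fix U \<rho> assume "open U \<and> smooth_form_on A U \<rho> \<and> (\<forall>q\<in>U. \<rho> q \<in> kappa q \<and> \<rho> q \<noteq> (\<lambda>vs. 0))"
  then have U: "open U" and sm: "smooth_form_on A U \<rho>" and \<rho>: "\<And>q. q \<in> U \<Longrightarrow> \<rho> q \<in> kappa q" "\<And>q. q \<in> U \<Longrightarrow> \<rho> q \<noteq> (\<lambda>vs. 0)"
    by auto
  \<comment> \<open>The exponential starts with 1, so the degree 1 part of the spinor is its form of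
    type (1, 0); smoothness of \<theta> is read off from \<rho>.\<close>
  define \<theta> where "\<theta> q v = \<rho> q [v]" for q v
  have form: "(\<exists>a\<noteq>0. \<forall>v. \<theta> q v = a * d\<pi> q v) \<and> \<rho> q = wedge (form_exp (two_form (BV q))) (one_form (\<theta> q))" if q: "q \<in> U" for q
  proof -
    obtain a where a: "\<rho> q = wedge (form_exp (two_form (BV q))) (one_form (\<lambda>v. a * d\<pi> q v))"
      using \<rho>(1)[OF q] unfolding kappa_def kappa_I_def by blast
    have t: "\<theta> q = (\<lambda>v. a * d\<pi> q v)"
      unfolding \<theta>_def a by (simp only: wedge_form_exp_one_form_singleton)
    have "a \<noteq> 0"
    proof
      assume "a = 0"
      then have 0: "one_form (\<lambda>v. a * d\<pi> q v) = (\<lambda>vs. 0)" by (simp add: one_form_def fun_eq_iff)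
      have "\<rho> q = (\<lambda>vs. 0)" unfolding a 0 by (rule ext) (rule wedge_zero_right)
      then show False using \<rho>(2)[OF q] by contradiction
    qed
    then show ?thesis using t a by auto
  qed
  have lin: "linear (\<theta> q)" if "q \<in> U" for q
    using alt_form_linear_hd[OF smooth_form_onD(2)[OF sm that], of "[]"] by (simp add: \<theta>_def[abs_def])
  have sm\<theta>: "smooth_form_on A U (\<lambda>q. one_form (\<theta> q))"
  proof (rule smooth_form_on_one_form[OF charts(1) U lin])
    fix c v assume "c \<in> A"
    from smooth_form_onD(1)[OF sm this, of "[v]"]
    show "smooth_on (\<lambda>x. \<theta> (chart_inv c x) (from_chart A c (chart_inv c x) v)) (snd c ` (U \<inter> fst c))"
      by (simp add: \<theta>_def local_rep_def)
  qed
  obtain \<xi> where \<xi>: "smooth_form_on A U (\<lambda>q. one_form (\<xi> q))"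
    "\<And>q vs. q \<in> U \<Longrightarrow> ext_deriv A (\<lambda>q. one_form (\<theta> q)) q vs = wedge (one_form (\<xi> q)) (one_form (\<theta> q)) vs"
    by (rule differential_of_section[OF U sm\<theta>]) (use form in blast)+
  have zero: "smooth_field A U (\<lambda>q. 0)"
    unfolding smooth_field_def
  proof
    fix c assume c: "c \<in> A"
    have chc: "is_chart c" using charts c by blast
    show "smooth_on (\<lambda>x. to_chart A c (chart_inv c x) 0) (snd c ` (U \<inter> fst c))"
      by (rule iffD1[OF smooth_on_cong smooth_on_const[of _ 0]])
         (use open_chart_image_Int[OF chc U] linear_0[OF to_from_chart(3)[OF compat(1) c]] in \<open>auto simp: chart_inv_chart[OF chc]\<close>)
  qed
  \<comment> \<open>The vector part of the Clifford element is zero: the covector \<xi> from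
    d\<theta> = \<xi> \<and> \<theta> suffices.\<close>
  have "twisted_ext_deriv A Hform \<rho> q = clifford ((0, 0), \<xi> q) (\<rho> q)" if q: "q \<in> U" for q
  proof
    fix vs
    obtain a where a: "a \<noteq> 0" "\<And>v. \<theta> q v = a * d\<pi> q v" using form[OF q] by blast
    have "twisted_ext_deriv A Hform \<rho> q vs = wedge (one_form (\<xi> q)) (\<rho> q) vs"
      by (rule twisted_deriv_exp_spinor[OF U q _ sm\<theta> a \<xi>(2)[OF q]]) (use form in blast)
    moreover have "\<rho> q (0 # vs) = 0"
      using linear_0[OF alt_form_linear_hd[OF smooth_form_onD(2)[OF sm q], of vs]] .
    ultimately show "twisted_ext_deriv A Hform \<rho> q vs = clifford ((0, 0), \<xi> q) (\<rho> q) vs"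
      by (simp add: clifford_def)
  qed
  with zero \<xi>(1) show "\<exists>u v \<xi>. smooth_field A U u \<and> smooth_field A U v \<and> smooth_form_on A U (\<lambda>q. one_form (\<xi> q)) \<and>
       (\<forall>q\<in>U. twisted_ext_deriv A Hform \<rho> q = clifford ((u q, v q), \<xi> q) (\<rho> q))"
    by (intro exI[of _ "\<lambda>q. 0"] exI[of _ \<xi>]) simp
qed

lemma generalized_complex_kappa: "generalized_complex_structure A kappa"
  unfolding generalized_complex_structure_def
  using almost_generalized_complex_kappa integrable_kappa real_form_Hform closed_Hform by blast

section \<open>The pair of P/V and I\<close>

lemma nondegenerate_scaled: "nondegenerate_2form_along A (vertical A Z \<pi>) (\<lambda>p u v. V (\<pi> p) * \<omega> p u v)"
  unfolding nondegenerate_2form_along_def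
proof (intro conjI allI ballI impI)
  fix p u v w a b assume u: "u \<in> vertical A Z \<pi> p" "v \<in> vertical A Z \<pi> p" "w \<in> vertical A Z \<pi> p"
  show "V (\<pi> p) * \<omega> p (a *\<^sub>R u + b *\<^sub>R v) w = a * (V (\<pi> p) * \<omega> p u w) + b * (V (\<pi> p) * \<omega> p v w)"
    unfolding \<omega>_bilinear(1)[OF u] by (simp add: algebra_simps)
  show "V (\<pi> p) * \<omega> p u v = - (V (\<pi> p) * \<omega> p v u)"
    using \<omega>_bilinear(2)[OF u] by simp
next
  fix p v assume "v \<in> vertical A Z \<pi> p" "v \<noteq> 0"
  then obtain w where "w \<in> vertical A Z \<pi> p" "\<omega> p v w \<noteq> 0" using nondegenerate_vertical by blast
  then show "\<exists>w\<in>vertical A Z \<pi> p. V (\<pi> p) * \<omega> p v w \<noteq> 0" using V_pos[of "\<pi> p"] by (intro bexI[of _ w]) auto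
next
  fix U Y W assume *: "open U \<and> smooth_field A U Y \<and> smooth_field A U W \<and> (\<forall>q\<in>U. Y q \<in> vertical A Z \<pi> q \<and> W q \<in> vertical A Z \<pi> q)"
  then have U: "open U" and sm: "smooth_map A self_atlas U (\<lambda>q. \<omega> q (Y q) (W q))"
    using conjunct2[OF conjunct2[OF nondegenerate[unfolded nondegenerate_2form_along_def]], THEN spec, THEN spec, THEN spec, THEN mp, OF *] by auto
  show "smooth_map A self_atlas U (\<lambda>q. V (\<pi> q) * \<omega> q (Y q) (W q))"
  proof (rule smooth_map_funI[OF compat(1) U])
    fix c assume c: "c \<in> A"
    show "smooth_on (\<lambda>x. V (\<pi> (chart_inv c x)) * \<omega> (chart_inv c x) (Y (chart_inv c x)) (W (chart_inv c x))) (snd c ` (U \<inter> fst c))"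
      by (intro smooth_on_mult smooth_map_funD[OF sm c] smooth_map_funD[OF smooth_map_subset[OF smooth_V\<pi>] c] open_chart_image_Int U)
         (use charts c in auto)
  qed
qed

lemma generalized_complex_pair_kappa:
  assumes "poisson_structure_of (vertical A Z \<pi>) (\<lambda>p u v. V (\<pi> p) * \<omega> p u v) PV"
  shows "generalized_complex_pair A (vertical A Z \<pi>) PV (kappa_I A Z \<pi>)"
proof -
  define \<eta> where "\<eta> q = two_form (\<lambda>u v. of_real (V (\<pi> q) * hor_omega q u v))" for q
  have "smooth_form_on A UNIV \<eta>" using smooth_form_on_scaled[of 1] by (simp add: \<eta>_def[abs_def])
  then have \<eta>: "real_form_on A 2 UNIV \<eta>"
    unfolding real_form_on_def by (auto simp: \<eta>_def two_form_def)
  \<comment> \<open>No B-field appears: H compensates the failure of V \<omega> to be closed, so C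
    is zero and the exponent is \<i> \<eta>, with \<eta> the extension of V \<omega> by zero on
    N.\<close>
  have C: "real_form_on A 2 UNIV (\<lambda>q vs. 0)"
    unfolding real_form_on_def smooth_form_on_def local_rep_def
    using charts by (auto simp: alt_form_def linear_zero intro!: smooth_on_const open_chart_image_Int open_chart_image)
  have e: "(\<lambda>vs. 0 + \<i> * \<eta> q vs) = two_form (BV q)" for q
    by (auto simp: \<eta>_def BV_def[abs_def] two_form_def fun_eq_iff)
  have "\<eta> q [u, v] = of_real (V (\<pi> q) * \<omega> q u v)" if "u \<in> vertical A Z \<pi> q" "v \<in> vertical A Z \<pi> q" for q u v
    using that by (simp add: \<eta>_def two_form_def hor_omega_def vproj_of_vertical)
  then have "\<forall>p. \<exists>U C \<eta>. open U \<and> p \<in> U \<and> real_form_on A 2 U C \<and> real_form_on A 2 U \<eta> \<and>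
        (\<forall>q\<in>U. (\<forall>u\<in>vertical A Z \<pi> q. \<forall>v\<in>vertical A Z \<pi> q. \<eta> q [u, v] = of_real (V (\<pi> q) * \<omega> q u v)) \<and>
           kappa q = wedge (form_exp (\<lambda>vs. C q vs + \<i> * \<eta> q vs)) ` kappa_I A Z \<pi> q)"
    using C \<eta> e by (intro allI exI[of _ UNIV] exI[of _ "\<lambda>q vs. 0"] exI[of _ \<eta>]) (simp add: kappa_def)
  with nondegenerate_scaled assms generalized_complex_kappa show ?thesis
    unfolding generalized_complex_pair_def by (intro exI[of _ "\<lambda>p u v. V (\<pi> p) * \<omega> p u v"] exI[of _ kappa]) simp
qed

end

theorem proposition4p14:
  fixes A :: "('x::{t2_space,second_countable_topology}, 'e::euclidean_space) chart set"
    and Z :: "('b::{t2_space,second_countable_topology}, complex) chart set"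
    and AF :: "('f::{t2_space,second_countable_topology}, 'k::real_normed_vector) chart set"
    and \<pi> :: "'x \<Rightarrow> 'b"
    and \<sigma> :: "'f \<Rightarrow> 'k form"
    and \<omega> :: "'x \<Rightarrow> 'e \<Rightarrow> 'e \<Rightarrow> real"
    and N :: "'x \<Rightarrow> 'e set"
    and P PV :: "'x \<Rightarrow> ('e \<Rightarrow> real) \<Rightarrow> 'e"
    and V :: "'b \<Rightarrow> real"
  assumes "smooth_structure A"
    and "riemann_surface Z"
    and "\<not> compact (UNIV :: 'b set)"
    and "flat_symplectic_fibre_bundle A Z \<pi> AF \<sigma> \<omega> N"
    and "poisson_structure_of (vertical A Z \<pi>) \<omega> P"
    and "pluriharmonic Z V"
    and "\<forall>b. V b > 0"
    and "\<not> V constant_on UNIV"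
    and "poisson_structure_of (vertical A Z \<pi>) (\<lambda>p u v. V (\<pi> p) * \<omega> p u v) PV"
  shows "generalized_complex_pair A (vertical A Z \<pi>) PV (kappa_I A Z \<pi>)"
proof -
  interpret pluriharmonic_bundle A Z AF \<pi> \<sigma> \<omega> N V
    by unfold_locales (use assms in \<open>auto simp: smooth_structure_def\<close>)
  show ?thesis using assms by (intro generalized_complex_pair_kappa)
qed

end
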